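(* Let $X$ be a complete separable metric space and let $Y$ be a complete metric space. Let $T$ be a metric space, let $t \mapsto \nu_t$, $T \to \mathcal P_r(Y)$, be a mapping continuous in the weak topology, let $t \mapsto \mu_t$, $T \to \mathcal P_r(X)$, be a mapping continuous in the total variation norm, and suppose that the measures $\mu_t$ are non-atomic for all $t \in T$. Let $h \colon X \times Y \times T \to [0, \infty)$ be a continuous function; write $h_t(x,y)=h(x,y,t)$. Suppose that for every $t\in T$ there are functions $a_t \in L^1(\mu_t)$ and $b_t \in L^1(\nu_t)$ such that $h(x, y, t) \le a_t(x) + b_t(y)$ for all $x\in X$, $y\in Y$, $t\in T$, and $$ \lim_{R \to +\infty} \sup_{t \in T} \Bigl(\int_{\{a_t \ge R\}} a_t \, d\mu_t + \int_{\{b_t \ge R\}} b_t \, d\nu_t \Bigr) = 0. $$ Then for any $\varepsilon > 0$ one can select, for all $t\in T$, $\varepsilon$-optimal Monge mappings $T_t^{\varepsilon}\colon X\to Y$ for the cost functions $h_t$ and measures $\mu_t$, $\nu_t$ (in particular $\mu_t \circ (T_t^{\varepsilon})^{-1} = \nu_t$ for every $t \in T$) such that $T_t^{\varepsilon}$ is continuous in $t$ in the sense of convergence $\mu_t$-a.e.: for every $t\in T$ and every sequence $t_n \to t$ in $T$, $T_{t_n}^{\varepsilon} \to T_t^{\varepsilon}$ $\mu_t$-a.e. as $n\to\infty$.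
   Context: A nonnegative Radon measure on a topological space $X$ is a bounded Borel measure $\mu\ge 0$ such that for every Borel set $B$ and every $\varepsilon>0$ there is a compact set $K\subset B$ with $\mu(B\setminus K)<\varepsilon$. $\mathcal P_r(X)$ and $\mathcal P_r(Y)$ denote the spaces of Radon probability measures on $X$ and $Y$; the weak topology is generated by the seminorms $\mu\mapsto|\int f\,d\mu|$, where $f$ is a bounded continuous function. For probability measures $\mu$ on $X$ and $\nu$ on $Y$, $\Pi(\mu,\nu)$ denotes the set of Borel probability measures $\sigma$ on $X\times Y$ with marginals $\mu$ and $\nu$, that is, $\sigma(A\times Y)=\mu(A)$ and $\sigma(X\times B)=\nu(B)$ for all Borel $A\subset X$, $B\subset Y$. For a nonnegative Borel cost function $h$ on $X\times Y$, the Kantorovich cost is $K_h(\mu,\nu)=\inf\{\int h\,d\sigma:\sigma\in\Pi(\mu,\nu)\}$. For a Borel mapping $S\colon X\to Y$, $(\mu\circ S^{-1})(B)=\mu(S^{-1}(B))$ for Borel sets $B\subset Y$. Given $\varepsilon>0$, an $\varepsilon$-optimal Monge mapping for the cost function $h$ and measures $\mu,\nu$ is a Borel mapping $S\colon X\to Y$ such that $\mu\circ S^{-1}=\nu$ and $\int_X h(x,S(x))\,\mu(dx)\le K_h(\mu,\nu)+\varepsilon$. *)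

theory Defs
  imports "HOL-Probability.Probability"
begin

text \<open>A Borel measure on the topological space formed by a whole type is a term of type
  \<open>'a measure\<close> whose \<open>\<sigma>\<close>-algebra is that of \<open>borel\<close>.\<close>

definition radon_measure :: "'a::t2_space measure \<Rightarrow> bool" where
  "radon_measure \<mu> \<longleftrightarrow> sets \<mu> = sets borel \<and> finite_measure \<mu> \<and>
    (\<forall>B\<in>sets borel. \<forall>\<epsilon>>0. \<exists>K. compact K \<and> K \<subseteq> B \<and> measure \<mu> (B - K) < \<epsilon>)"

definition radon_prob :: "'a::t2_space measure set" where
  "radon_prob = {\<mu>. radon_measure \<mu> \<and> prob_space \<mu>}"

text \<open>The topology induced on \<open>radon_prob\<close> by the seminorms
  \<open>\<mu> \<mapsto> \<bar>\<integral>f d\<mu>\<bar>\<close>: the subbasic open sets are the balls of these seminorms.\<close>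

definition weak_topology :: "'a::t2_space measure topology" where
  "weak_topology = topology_generated_by
    {{\<mu> \<in> radon_prob. \<bar>(\<integral>x. f x \<partial>\<mu>) - (\<integral>x. f x \<partial>\<mu>\<^sub>0)\<bar> < r} | f \<mu>\<^sub>0 r.
      continuous_on UNIV (f :: 'a \<Rightarrow> real) \<and> bounded (range f) \<and> \<mu>\<^sub>0 \<in> radon_prob \<and> r > 0}"

text \<open>The total variation norm of the signed measure \<open>\<mu> - \<nu>\<close>, for finite Borel measures
  (the sums are bounded by the sum of the two total masses, so the supremum is a genuine one).\<close>

definition tv_dist :: "'a::topological_space measure \<Rightarrow> 'a measure \<Rightarrow> real" where
  "tv_dist \<mu> \<nu> = (SUP P \<in> {P. finite P \<and> P \<subseteq> sets borel \<and> disjoint P}.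
     \<Sum>A\<in>P. \<bar>measure \<mu> A - measure \<nu> A\<bar>)"

definition tv_continuous :: "('c::topological_space \<Rightarrow> 'a::topological_space measure) \<Rightarrow> bool" where
  "tv_continuous \<mu> \<longleftrightarrow> (\<forall>t. ((\<lambda>s. tv_dist (\<mu> s) (\<mu> t)) \<longlongrightarrow> 0) (at t))"

definition atom :: "'a measure \<Rightarrow> 'a set \<Rightarrow> bool" where
  "atom \<mu> A \<longleftrightarrow> A \<in> sets \<mu> \<and> emeasure \<mu> A > 0 \<and>
    (\<forall>B\<in>sets \<mu>. B \<subseteq> A \<longrightarrow> emeasure \<mu> B = 0 \<or> emeasure \<mu> B = emeasure \<mu> A)"

definition nonatomic :: "'a measure \<Rightarrow> bool" where
  "nonatomic \<mu> \<longleftrightarrow> (\<nexists>A. atom \<mu> A)"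

text \<open>The \<open>\<sigma>\<close>-algebra is the Borel one of the product space, which for general factors
  may be larger than the product \<open>\<sigma>\<close>-algebra \<open>borel \<Otimes>\<^sub>M borel\<close>.\<close>

definition couplings ::
  "'a::topological_space measure \<Rightarrow> 'b::topological_space measure \<Rightarrow> ('a \<times> 'b) measure set" where
  "couplings \<mu> \<nu> = {\<sigma>. sets \<sigma> = sets borel \<and> prob_space \<sigma> \<and>
     (\<forall>A\<in>sets borel. emeasure \<sigma> (A \<times> UNIV) = emeasure \<mu> A) \<and>
     (\<forall>B\<in>sets borel. emeasure \<sigma> (UNIV \<times> B) = emeasure \<nu> B)}"

text \<open>Cost functions are nonnegative; integrals of costs take values in \<open>[0, \<infinity>]\<close>.\<close>

definition kantorovich_cost ::
  "('a::topological_space \<Rightarrow> 'b::topological_space \<Rightarrow> real) \<Rightarrow> 'a measure \<Rightarrow> 'b measure \<Rightarrow> ennreal" where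
  "kantorovich_cost h \<mu> \<nu> = (INF \<sigma> \<in> couplings \<mu> \<nu>. \<integral>\<^sup>+(x, y). ennreal (h x y) \<partial>\<sigma>)"

definition eps_optimal_monge ::
  "real \<Rightarrow> ('a::topological_space \<Rightarrow> 'b::topological_space \<Rightarrow> real) \<Rightarrow> 'a measure \<Rightarrow> 'b measure
    \<Rightarrow> ('a \<Rightarrow> 'b) \<Rightarrow> bool" where
  "eps_optimal_monge \<epsilon> h \<mu> \<nu> S \<longleftrightarrow> S \<in> borel_measurable borel \<and> distr \<mu> borel S = \<nu> \<and>
     (\<integral>\<^sup>+x. ennreal (h x (S x)) \<partial>\<mu>) \<le> kantorovich_cost h \<mu> \<nu> + ennreal \<epsilon>"

end

theory Submission
  imports Defs
begin

text \<open>Truncating the cost, which is harmless by uniform integrability, we may assume it bounded.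

  The measures \<open>\<nu> t\<close> are images of Lebesgue measure on \<open>(0, 1)\<close> under maps \<open>\<xi> t\<close> such that
  \<open>(t, u) \<mapsto> \<xi> t u\<close> is, for every \<open>t\<close>, continuous at \<open>(t, u)\<close> for almost all \<open>u\<close>. This turns
  the second marginal into a constant one. A near-optimal coupling at one parameter, averaged over
  finitely many cells of \<open>X\<close>, becomes a bounded density with respect to \<open>\<mu> t\<close> times Lebesgue
  measure; since \<open>\<mu>\<close> is continuous in total variation, after a small correction of the marginals
  this density is a near-optimal plan for all nearby parameters. A partition of unity on the
  parameter space glues these local plans to a continuous family of near-optimal plans.

  Finally each plan is replaced by the graph of a map: on every cell of a fine countable partition
  of \<open>X\<close> the distribution function of the nonatomic measure \<open>\<mu> t\<close>, followed by a
  parametrization of the part of the second marginal coming from the cell, produces a map with the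
  same marginals which moves the cost only by its oscillation over the cell.\<close>

section \<open>Partitions of unity on metric spaces\<close>

text \<open>The second space need not be separable and the measures on it move only weakly, whereas
  \<mu> moves in total variation. This asymmetry fixes the roles: cells, conditional distribution
  functions and the other discontinuous objects live on X, where integrals of arbitrary bounded
  Borel functions are continuous in the parameter, while Y enters through continuous partitions of
  unity and through tightness. The parameter space need not be compact, so no single mesh of cells
  serves all parameters, and a change of mesh must not make the maps jump on a set of positive
  measure. Moreover, a template near a parameter is chosen after the neighbourhood on which it is
  used, so the estimates on that neighbourhood have to be uniform over all candidate templates. The
  error budget is a multiple of a single \<eta>: \<open>6 + 10 * B\<close> for a template,
  \<open>3 * B\<close> for correcting its marginals, \<open>2 + 4 * B\<close> for passing from a
  plan to a map.\<close>

definition partition_of_unity :: "('i \<Rightarrow> 'a::topological_space \<Rightarrow> real) \<Rightarrow> bool" where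
  "partition_of_unity P \<longleftrightarrow> (\<forall>i. continuous_on UNIV (P i)) \<and> (\<forall>i x. 0 \<le> P i x) \<and>
    (\<forall>x. finite {i. P i x \<noteq> 0}) \<and> (\<forall>x. (\<Sum>i | P i x \<noteq> 0. P i x) = 1)"

lemma partition_of_unityD:
  assumes "partition_of_unity P"
  shows "continuous_on UNIV (P i)" "0 \<le> P i x" "finite {i. P i x \<noteq> 0}"
    "(\<Sum>i | P i x \<noteq> 0. P i x) = 1"
  using assms by (auto simp: partition_of_unity_def)

lemma partition_of_unity_sum_superset:
  assumes "partition_of_unity P" "finite F" "{i. P i x \<noteq> 0} \<subseteq> F"
  shows "(\<Sum>i\<in>F. P i x * g i) = (\<Sum>i | P i x \<noteq> 0. P i x * g i)"
  using assms by (intro sum.mono_neutral_right) auto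

lemma partition_of_unity_sum_le_1:
  assumes "partition_of_unity P" "finite F"
  shows "(\<Sum>i\<in>F. P i x) \<le> 1"
proof -
  have fin: "finite {i. P i x \<noteq> 0}"
    using assms by (simp add: partition_of_unityD)
  have "(\<Sum>i\<in>F. P i x) \<le> (\<Sum>i\<in>F \<union> {i. P i x \<noteq> 0}. P i x)"
    using assms fin by (intro sum_mono2) (auto simp: partition_of_unityD)
  also have "\<dots> = 1"
    using partition_of_unity_sum_superset[of P "F \<union> {i. P i x \<noteq> 0}" x "\<lambda>_. 1"] assms fin
    by (simp add: partition_of_unityD)
  finally show ?thesis .
qed

lemma partition_of_unity_le_1:
  assumes "partition_of_unity P"
  shows "P i x \<le> 1"
  using partition_of_unity_sum_le_1[OF assms, of "{i}" x] by simp

text \<open>No local finiteness is needed: near \<open>x0\<close> the terms that vanish at \<open>x0\<close> carry only a small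
  part of the total weight \<open>1\<close>.\<close>

lemma partition_of_unity_isCont_sum:
  assumes P: "partition_of_unity P"
    and cont: "\<And>i. isCont (\<lambda>x. P i x * g i x) x0"
    and bound: "\<And>i x. P i x \<noteq> 0 \<Longrightarrow> \<bar>g i x\<bar> \<le> c"
  shows "isCont (\<lambda>x. \<Sum>i | P i x \<noteq> 0. P i x * g i x) x0"
proof -
  define F where "F = {i. P i x0 \<noteq> 0}"
  have F: "finite F" using P by (simp add: F_def partition_of_unityD)
  define S where "S x = (\<Sum>i | P i x \<noteq> 0. P i x * g i x)" for x
  define SF where "SF x = (\<Sum>i\<in>F. P i x * g i x)" for x
  define PF where "PF x = (\<Sum>i\<in>F. P i x)" for x
  have SF0: "SF x0 = S x0" by (simp add: SF_def S_def F_def)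
  have PF0: "PF x0 = 1" using P by (simp add: PF_def F_def partition_of_unityD)
  have isF: "isCont SF x0" unfolding SF_def by (intro isCont_sum) (use cont in auto)
  have P_c: "isCont (P i) x0" for i
    using partition_of_unityD(1)[OF P] by (simp add: continuous_on_eq_continuous_at)
  have iPF: "isCont PF x0" unfolding PF_def by (intro isCont_sum) (use P_c in auto)
  have le: "\<bar>S x - SF x\<bar> \<le> c * (1 - PF x)" for x
  proof -
    let ?A = "{i. P i x \<noteq> 0}"
    have fin: "finite ?A" using P by (simp add: partition_of_unityD)
    have "SF x = (\<Sum>i\<in>F \<inter> ?A. P i x * g i x)"
      unfolding SF_def using F by (intro sum.mono_neutral_right) auto
    moreover have "S x = (\<Sum>i\<in>F \<inter> ?A. P i x * g i x) + (\<Sum>i\<in>?A - F. P i x * g i x)"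
      unfolding S_def using fin by (subst sum.union_disjoint[symmetric]) (auto intro!: sum.cong)
    ultimately have 1: "S x - SF x = (\<Sum>i\<in>?A - F. P i x * g i x)" by simp
    have "PF x = (\<Sum>i\<in>F \<inter> ?A. P i x)"
      unfolding PF_def using F by (intro sum.mono_neutral_right) auto
    moreover have "1 = (\<Sum>i\<in>F \<inter> ?A. P i x) + (\<Sum>i\<in>?A - F. P i x)"
      unfolding partition_of_unityD(4)[OF P, of x, symmetric]
      using fin by (subst sum.union_disjoint[symmetric]) (auto intro!: sum.cong)
    ultimately have 2: "1 - PF x = (\<Sum>i\<in>?A - F. P i x)" by simp
    have "\<bar>S x - SF x\<bar> \<le> (\<Sum>i\<in>?A - F. \<bar>P i x * g i x\<bar>)" unfolding 1 by (rule sum_abs)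
    also have "\<dots> \<le> (\<Sum>i\<in>?A - F. c * P i x)"
      using partition_of_unityD(2)[OF P] bound
      by (intro sum_mono) (auto simp: abs_mult mult.commute[of c] intro!: mult_left_mono)
    also have "\<dots> = c * (1 - PF x)" unfolding 2 by (simp add: sum_distrib_left)
    finally show ?thesis .
  qed
  have le': "SF x - c * (1 - PF x) \<le> S x" "S x \<le> SF x + c * (1 - PF x)" for x
    using le[of x] by linarith+
  have "((\<lambda>x. SF x - c * (1 - PF x)) \<longlongrightarrow> S x0) (at x0)" "((\<lambda>x. SF x + c * (1 - PF x)) \<longlongrightarrow> S x0) (at x0)"
    using isF iPF by (auto simp: isCont_def SF0 PF0 intro!: tendsto_eq_intros)
  then have "(S \<longlongrightarrow> S x0) (at x0)"
    by (rule tendsto_sandwich[rotated 2]) (use le' in \<open>auto intro!: always_eventually\<close>)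
  then show ?thesis by (simp add: isCont_def S_def[abs_def])
qed

lemma lipschitz_isCont:
  fixes f :: "'a::metric_space \<Rightarrow> real"
  assumes "\<And>x y. f x \<le> f y + L * dist x y"
  shows "isCont f x"
proof -
  have "((\<lambda>y. f x - L * dist x y) \<longlongrightarrow> f x) (at x)" "((\<lambda>y. f x + L * dist y x) \<longlongrightarrow> f x) (at x)"
    by (auto intro!: tendsto_eq_intros)
  then have "(f \<longlongrightarrow> f x) (at x)"
    by (rule tendsto_sandwich[rotated 2])
      (use assms[of x] assms[of _ x] in \<open>auto simp: algebra_simps intro!: always_eventually\<close>)
  then show ?thesis by (simp add: isCont_def)
qed

text \<open>With a bound uniform in the index, suprema over arbitrary index sets keep the Lipschitz
  constant. This is the source of continuity below for functions assembled from infinitely many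
  others.\<close>

lemma lipschitz_SUP:
  fixes f :: "'i \<Rightarrow> 'a::metric_space \<Rightarrow> real"
  assumes "I \<noteq> {}" "\<And>i x. i \<in> I \<Longrightarrow> f i x \<le> c" "\<And>i. i \<in> I \<Longrightarrow> f i x \<le> f i y + L * dist x y"
  shows "(SUP i\<in>I. f i x) \<le> (SUP i\<in>I. f i y) + L * dist x y"
proof (rule cSUP_least[OF assms(1)])
  fix i assume i: "i \<in> I"
  have "f i y \<le> (SUP i\<in>I. f i y)"
    using i assms(2) by (intro cSUP_upper) (auto simp: bdd_above_def)
  with assms(3)[OF i] show "f i x \<le> (SUP i\<in>I. f i y) + L * dist x y" by linarith
qed

text \<open>Following Stone's proof of paracompactness: with respect to a well-order of the points,
  \<open>p n a\<close> lives where \<open>a\<close> is the first point with \<open>f a > 2 ^ (- n)\<close>, so for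
  fixed \<open>n\<close> at most one of them is nonzero; subtracting half of the supremum of all the \<open>p\<close>
  leaves only finitely many \<open>n\<close>.\<close>

lemma partition_of_unity_exists:
  fixes r :: "'a::metric_space \<Rightarrow> real"
  assumes r: "\<And>a. 0 < r a"
  obtains P :: "nat \<times> 'a \<Rightarrow> 'a \<Rightarrow> real"
  where "partition_of_unity P" "\<And>i x. P i x \<noteq> 0 \<Longrightarrow> dist x (snd i) < r (snd i)"
proof -
  obtain R where R: "well_order_on (UNIV::'a set) R" using card_of_well_order_on by blast
  define less where "less a b \<longleftrightarrow> (a, b) \<in> R \<and> a \<noteq> b" for a b
  have tot: "less a b \<or> a = b \<or> less b a" for a b
    using R by (auto simp: less_def well_order_on_def linear_order_on_def total_on_def)
  have "{(a, b). less a b} = R - Id" by (auto simp: less_def)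
  then have wfR: "wf {(a, b). less a b}"
    using R by (simp add: well_order_on_def)
  \<comment> \<open>Tents supported in the prescribed balls; capping the radius at 1 keeps them
    bounded, so that the suprema below exist.\<close>
  define f where "f a x = max 0 (min 1 (r a) - dist x a)" for a x
  have f01: "0 \<le> f a x" "f a x \<le> 1" for a x
    using zero_le_dist[of x a] unfolding f_def by linarith+
  have f_lip: "f a x \<le> f a y + 1 * dist x y" for a x y
    using dist_triangle[of y a x] by (auto simp: f_def dist_commute)
  define s where "s a x = (SUP b\<in>{b. less b a}. f b x)" for a x
  \<comment> \<open>The least point has no predecessors, and \<open>Sup {}\<close> is unspecified on
    the reals.\<close>
  define s' where "s' a x = (if {b. less b a} = {} then 0 else s a x)" for a x
  have s'_lip: "s' a x \<le> s' a y + 1 * dist x y" for a x y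
  proof (cases "{b. less b a} = {}")
    case False
    then have "s a x \<le> s a y + 1 * dist x y"
      unfolding s_def by (rule lipschitz_SUP) (use f_lip f01 in auto)
    with False show ?thesis by (simp only: s'_def if_False)
  qed (simp add: s'_def)
  have s'_ge: "f b x \<le> s' a x" if "less b a" for a b x
    using that f01 by (auto simp: s'_def s_def intro!: cSUP_upper bdd_aboveI[of _ 1])
  have s'_le: "s' a x \<le> c" if "\<And>b. less b a \<Longrightarrow> f b x \<le> c" "0 \<le> c" for a x c
    using that by (auto simp: s'_def s_def intro!: cSUP_least)
  have s'_pos: "0 \<le> s' a x" for a x
  proof (cases "{b. less b a} = {}")
    case False
    then obtain b where "less b a" by blast
    from s'_ge[OF this, of x] f01(1)[of b x] show ?thesis by linarith
  qed (simp add: s'_def)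
  define p where "p n a x = max 0 (min (f a x - (1/2)^n) ((1/2)^n - s' a x))" for n :: nat and a x
  have p0: "0 \<le> p n a x" for n a x by (simp add: p_def)
  have p_le: "p n a x \<le> (1/2)^n" for n a x using s'_pos[of a x] by (auto simp: p_def)
  have p_le1: "p n a x \<le> 1" for n a x
    using p_le[of n a x] power_le_one[of "1/2::real" n] by simp
  have p_lip: "p n a x \<le> p n a y + 1 * dist x y" for n a x y
    using f_lip[of a x y] s'_lip[of a y x] unfolding p_def dist_commute[of y x] by (auto simp: max_def min_def)
  have p_ex: "\<exists>n a. 0 < p n a x" for x
  proof -
    have "0 < f x x" using r[of x] by (simp add: f_def)
    then have "x \<in> {a. 0 < f a x}" by simp
    from wfE_min[OF wfR this] obtain a where a: "0 < f a x" "\<And>b. less b a \<Longrightarrow> \<not> 0 < f b x"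
      by auto
    obtain n where n: "(1/2)^n < f a x" using a(1) real_arch_pow_inv[of "f a x" "1/2"] by auto
    have "s' a x \<le> 0" using a(2) by (intro s'_le) (auto simp: not_less)
    then have "s' a x < (1/2)^n" using zero_less_power[of "1/2::real" n] by linarith
    with n have "0 < p n a x" by (simp add: p_def less_max_iff_disj)
    then show ?thesis by blast
  qed
  have p_uniq: "a = b" if "0 < p n a x" "0 < p n b x" for n a b x
  proof (rule ccontr)
    assume "a \<noteq> b"
    moreover have False if "less a b" "0 < p n a x" "0 < p n b x" for a b
      using s'_ge[OF that(1), of x] that(2,3) by (auto simp: p_def max_def min_def split: if_splits)
    ultimately show False using tot[of a b] that by blast
  qed
  define M where "M x = (SUP (n, a)\<in>UNIV. p n a x)" for x
  have M_lip: "M x \<le> M y + 1 * dist x y" for x y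
    unfolding M_def case_prod_beta using p_le1 p_lip by (intro lipschitz_SUP) auto
  have M_ge: "p n a x \<le> M x" for n a x
    unfolding M_def case_prod_beta
    using p_le1 by (intro cSUP_upper2[of _ _ "(n, a)"]) (auto intro!: bdd_aboveI[of _ 1])
  have M_pos: "0 < M x" for x using p_ex[of x] M_ge by (meson less_le_trans)
  define q where "q n a x = max 0 (p n a x - M x / 2)" for n a x
  have q0: "0 \<le> q n a x" for n a x by (simp add: q_def)
  have q_lip: "q n a x \<le> q n a y + 2 * dist x y" for n a x y
    using p_lip[of n a x y] M_lip[of y x] zero_le_dist[of x y] unfolding q_def dist_commute[of y x] by linarith
  have q_le1: "q n a x \<le> 1" for n a x using p_le1[of n a x] M_pos[of x] by (auto simp: q_def)
  have q_p: "0 < p n a x" if "q n a x \<noteq> 0" for n a x using that M_pos[of x] by (auto simp: q_def max_def split: if_splits)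
  have q_uniq: "a = b" if "q n a x \<noteq> 0" "q n b x \<noteq> 0" for n a b x
    using p_uniq q_p that by blast
  have q_ex: "\<exists>n a. q n a x \<noteq> 0" for x
  proof (rule ccontr)
    assume "\<not> ?thesis"
    then have "p n a x \<le> M x / 2" for n a unfolding q_def by (metis diff_gt_0_iff_gt max.absorb4 not_le order_less_irrefl)
    then have "(SUP (n, a)\<in>UNIV. p n a x) \<le> M x / 2" by (intro cSUP_least) auto
    then have "M x \<le> M x / 2" unfolding M_def[symmetric] .
    with M_pos[of x] show False by simp
  qed
  \<comment> \<open>At most one term is nonzero, so the sum is a supremum; in this form it is
    visibly Lipschitz, although the index of the nonzero term moves with \<open>x\<close>.\<close>
  have G: "(\<Sum>a | q n a x \<noteq> 0. q n a x) = (SUP a. q n a x)" "finite {a. q n a x \<noteq> 0}" for n x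
  proof -
    consider (z) "\<And>a. q n a x = 0" | (nz) a where "q n a x \<noteq> 0" by blast
    then show "(\<Sum>a | q n a x \<noteq> 0. q n a x) = (SUP a. q n a x)"
    proof cases
      case nz
      then have "{a. q n a x \<noteq> 0} = {a}" using q_uniq by blast
      moreover have "(SUP a. q n a x) = q n a x"
      proof (rule antisym)
        show "(SUP a. q n a x) \<le> q n a x"
        proof (rule cSUP_least)
          show "q n b x \<le> q n a x" for b
            using q0[of n a x] nz q_uniq[of n b x a] by (cases "q n b x = 0") auto
        qed simp
        show "q n a x \<le> (SUP a. q n a x)"
          using q_le1 by (intro cSUP_upper bdd_aboveI[of _ 1]) auto
      qed
      ultimately show ?thesis by simp
    qed simp
    have "{a. q n a x \<noteq> 0} \<subseteq> {SOME a. q n a x \<noteq> 0}"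
      using q_uniq someI[of "\<lambda>a. q n a x \<noteq> 0"] by blast
    then show "finite {a. q n a x \<noteq> 0}" by (rule finite_subset) simp
  qed
  \<comment> \<open>\<open>M\<close> is 1-Lipschitz, so it exceeds \<open>M x0 / 2\<close> on the
    ball of that radius, and there a level with \<open>(1/2)^n < M x0 / 4\<close> stays below half
    of \<open>M\<close>.\<close>
  have loc: "\<exists>d>0. \<exists>N. \<forall>x n a. dist x x0 < d \<longrightarrow> q n a x \<noteq> 0 \<longrightarrow> n < N" for x0
  proof -
    obtain N where N: "(1/2)^N < M x0 / 4" using M_pos[of x0] real_arch_pow_inv[of "M x0 / 4" "1/2"] by auto
    have "n < N" if "dist x x0 < M x0 / 2" "q n a x \<noteq> 0" for x n a
    proof (rule ccontr)
      assume "\<not> n < N"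
      then have "(1/2::real)^n \<le> (1/2)^N" by (intro power_decreasing) auto
      moreover have "M x / 2 < p n a x" using that(2) by (auto simp: q_def max_def split: if_splits)
      ultimately show False
        using M_lip[of x0 x] that(1) p_le[of n a x] N unfolding dist_commute[of x0 x] by linarith
    qed
    then show ?thesis using M_pos[of x0] by (intro exI[of _ "M x0 / 2"]) auto
  qed
  define Q where "Q = (\<lambda>(n, a) x. q n a x)"
  have supp: "{i. Q i x \<noteq> 0} = Sigma {..<N} (\<lambda>n. {a. q n a x \<noteq> 0})" if "\<forall>n a. q n a x \<noteq> 0 \<longrightarrow> n < N" for x N
    using that by (auto simp: Q_def)
  have finQ: "finite {i. Q i x \<noteq> 0}" for x
  proof -
    obtain N where "\<forall>n a. q n a x \<noteq> 0 \<longrightarrow> n < N" using loc[of x] by (metis dist_self)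
    from supp[OF this] show ?thesis using G(2) by simp
  qed
  define S where "S x = (\<Sum>i | Q i x \<noteq> 0. Q i x)" for x
  have S_pos: "0 < S x" for x
    unfolding S_def using q_ex[of x] q0 finQ by (intro sum_pos) (auto simp: Q_def less_le split: prod.splits)
  have S_cont: "isCont S x0" for x0
  proof -
    obtain d N where d: "d > 0" and N: "\<And>x n a. dist x x0 < d \<Longrightarrow> q n a x \<noteq> 0 \<Longrightarrow> n < N" using loc[of x0] by blast
    have eq: "S x = (\<Sum>n<N. SUP a. q n a x)" if "dist x x0 < d" for x
    proof -
      have *: "\<forall>n a. q n a x \<noteq> 0 \<longrightarrow> n < N" using N that by blast
      have "S x = (\<Sum>(n, a)\<in>Sigma {..<N} (\<lambda>n. {a. q n a x \<noteq> 0}). q n a x)"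
        unfolding S_def supp[OF *] by (intro sum.cong) (auto simp: Q_def)
      also have "\<dots> = (\<Sum>n<N. \<Sum>a | q n a x \<noteq> 0. q n a x)"
        using G(2) by (subst sum.Sigma) auto
      finally show ?thesis by (simp add: G(1))
    qed
    have "isCont (\<lambda>x. SUP a. q n a x) x0" for n
      using q_le1 q_lip by (intro lipschitz_isCont[where L = 2] lipschitz_SUP) auto
    then have "isCont (\<lambda>x. \<Sum>n<N. SUP a. q n a x) x0" by (intro isCont_sum) auto
    moreover have "\<forall>\<^sub>F x in nhds x0. S x = (\<Sum>n<N. SUP a. q n a x)"
      using eq d by (auto simp: eventually_nhds_metric)
    ultimately show ?thesis by (simp add: isCont_cong)
  qed
  define P where "P i x = Q i x / S x" for i x
  have Pnz: "P i x \<noteq> 0 \<longleftrightarrow> Q i x \<noteq> 0" for i x using S_pos[of x] by (simp add: P_def)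
  have "isCont (P i) x" for i x
  proof -
    have "isCont (Q i) x" using q_lip by (cases i) (auto simp: Q_def intro!: lipschitz_isCont[where L = 2])
    then show ?thesis unfolding P_def using S_cont S_pos[of x] by (intro isCont_divide) auto
  qed
  moreover have "(\<Sum>i | P i x \<noteq> 0. P i x) = 1" for x
    unfolding Pnz using S_pos[of x] unfolding P_def sum_divide_distrib[symmetric] by (simp add: S_def)
  moreover have "0 \<le> P i x" for i x
    using q0 S_pos[of x] by (cases i) (auto simp: P_def Q_def)
  ultimately have "partition_of_unity P"
    using finQ by (simp only: partition_of_unity_def Pnz continuous_on_eq_continuous_at[OF open_UNIV] simp_thms ball_UNIV)
  moreover have "dist x (snd i) < r (snd i)" if "P i x \<noteq> 0" for i x
  proof -
    obtain n a where i: "i = (n, a)" by (cases i)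
    have "0 < p n a x" using that unfolding Pnz by (intro q_p) (auto simp: Q_def i)
    then have "(1/2)^n < f a x" by (simp add: p_def less_max_iff_disj)
    then have "0 < f a x" using zero_less_power[of "1/2::real" n] by linarith
    then show ?thesis by (simp add: f_def i max_def split: if_splits)
  qed
  ultimately show thesis by (rule that)
qed

section \<open>Parametrizing a weakly continuous family of measures\<close>

lemma radon_measureD:
  assumes "radon_measure M"
  shows "sets M = sets borel" "finite_measure M" "space M = UNIV"
    "\<And>B e. B \<in> sets borel \<Longrightarrow> e > 0 \<Longrightarrow> \<exists>K. compact K \<and> K \<subseteq> B \<and> measure M (B - K) < e"
  using assms sets_eq_imp_space_eq[of M borel] by (auto simp: radon_measure_def)

lemma integrable_bounded:
  fixes f :: "'a::topological_space \<Rightarrow> real"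
  assumes "sets M = sets borel" "finite_measure M" "f \<in> borel_measurable borel" "\<And>x. \<bar>f x\<bar> \<le> c"
  shows "integrable M f"
  using assms by (intro finite_measure.integrable_const_bound[of M f c]) (auto cong: measurable_cong_sets)

text \<open>The finitely many members active at a point still sum to more than \<open>1 - e\<close>
  on an open neighbourhood of it; compactness leaves finitely many such points.\<close>

lemma partition_of_unity_compact:
  assumes P: "partition_of_unity P" and K: "compact K" and e: "e > 0"
  shows "\<exists>F. finite F \<and> (\<forall>x\<in>K. 1 - e < (\<Sum>i\<in>F. P i x))"
proof -
  define A where "A x = {i. P i x \<noteq> 0}" for x
  define O' where "O' x = {z. 1 - e < (\<Sum>i\<in>A x. P i z)}" for x
  have "open (O' x)" for x
    unfolding O'_def using partition_of_unityD(1)[OF P]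
    by (intro open_Collect_less continuous_intros) auto
  moreover have "K \<subseteq> (\<Union>x\<in>K. O' x)"
    using e by (auto simp: O'_def A_def partition_of_unityD(4)[OF P])
  ultimately obtain C where C: "C \<subseteq> K" "finite C" "K \<subseteq> (\<Union>x\<in>C. O' x)"
    using compactE_image[OF K, of K O'] by metis
  have fA: "finite (A x)" for x using P by (simp add: A_def partition_of_unityD)
  have "1 - e < (\<Sum>i\<in>(\<Union>y\<in>C. A y). P i x)" if x: "x \<in> K" for x
  proof -
    obtain y where y: "y \<in> C" "x \<in> O' y" using C x by blast
    have "(\<Sum>i\<in>A y. P i x) \<le> (\<Sum>i\<in>(\<Union>y\<in>C. A y). P i x)"
      using y C fA partition_of_unityD(2)[OF P] by (intro sum_mono2) auto
    with y show ?thesis by (simp add: O'_def)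
  qed
  then show ?thesis using C fA by (intro exI[of _ "\<Union>y\<in>C. A y"]) auto
qed

text \<open>A word lists the indices chosen at the successive levels, the most recent one first; the
  masses of the words of a given length cut the interval \<open>J t []\<close> into consecutive intervals
  \<open>J t w\<close>, whose endpoints depend continuously on the parameter because they are integrals of
  continuous functions.\<close>

locale interval_tree =
  fixes n :: "'c::metric_space \<Rightarrow> 'b::complete_space measure"
    and P :: "nat \<Rightarrow> 'i \<Rightarrow> 'b \<Rightarrow> real"
    and less :: "'i \<Rightarrow> 'i \<Rightarrow> bool"
    and ctr :: "'i \<Rightarrow> 'b"
  assumes radon: "\<And>t. radon_measure (n t)"
    and weak: "\<And>f c. continuous_on UNIV f \<Longrightarrow> (\<And>y. \<bar>f y :: real\<bar> \<le> c) \<Longrightarrow>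
      continuous_on UNIV (\<lambda>t. \<integral>y. f y \<partial>n t)"
    and pou: "\<And>k. partition_of_unity (P k)"
    and small: "\<And>k i y. P k i y \<noteq> 0 \<Longrightarrow> dist y (ctr i) < (1/2)^k"
    and less_total: "\<And>i j. less i j \<or> i = j \<or> less j i"
    and less_irrefl: "\<And>i. \<not> less i i"
    and less_trans: "\<And>i j k. less i j \<Longrightarrow> less j k \<Longrightarrow> less i k"
begin

lemmas n_sets = radon_measureD(1)[OF radon] and n_finite = radon_measureD(2)[OF radon]
  and n_space = radon_measureD(3)[OF radon]

text \<open>The weight of all indices preceding \<open>i\<close>, whose integral places the left
  endpoint. The 0/1 coefficients make it an instance of
  \<open>partition_of_unity_isCont_sum\<close>, which gives continuity even though infinitely many
  indices may precede \<open>i\<close>.\<close>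

definition Z :: "nat \<Rightarrow> 'i \<Rightarrow> 'b \<Rightarrow> real" where
  "Z k i y = (\<Sum>j | P k j y \<noteq> 0. P k j y * (if less j i then 1 else 0))"

primrec Q :: "'i list \<Rightarrow> 'b \<Rightarrow> real" where
  "Q [] y = 1"
| "Q (i # w) y = Q w y * P (length w) i y"

definition m :: "'c \<Rightarrow> 'i list \<Rightarrow> real" where
  "m t w = (\<integral>y. Q w y \<partial>n t)"

primrec L :: "'c \<Rightarrow> 'i list \<Rightarrow> real" where
  "L t [] = 0"
| "L t (i # w) = L t w + (\<integral>y. Q w y * Z (length w) i y \<partial>n t)"

definition J :: "'c \<Rightarrow> 'i list \<Rightarrow> real set" where
  "J t w = {L t w <..< L t w + m t w}"

lemma P_cont: "continuous_on UNIV (P k i)" and P0: "0 \<le> P k i y" and P1: "P k i y \<le> 1"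
  using pou[of k] by (auto simp: partition_of_unityD partition_of_unity_le_1)

lemma Q0: "0 \<le> Q w y" and Q1: "Q w y \<le> 1"
  by (induction w) (auto simp: P0 P1 mult_le_one)

lemma Q_cont: "continuous_on UNIV (Q w)"
  by (induction w) (auto intro!: continuous_intros P_cont)

lemma Z_cont: "continuous_on UNIV (Z k i)"
proof -
  have "isCont (Z k i) y" for y
    unfolding Z_def using P_cont[of k]
    by (intro partition_of_unity_isCont_sum[where c = 1] pou)
      (auto simp: continuous_on_eq_continuous_at intro!: continuous_intros)
  then show ?thesis by (simp add: continuous_on_eq_continuous_at)
qed

lemma Z0: "0 \<le> Z k i y"
  unfolding Z_def by (intro sum_nonneg) (auto simp: P0)

lemma Z_eq: "Z k i y = (\<Sum>j | P k j y \<noteq> 0 \<and> less j i. P k j y)"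
proof -
  have f: "finite {j. P k j y \<noteq> 0}" using pou[of k] by (simp add: partition_of_unityD)
  show ?thesis unfolding Z_def using f by (intro sum.mono_neutral_cong_right) auto
qed

lemma Z_P: "Z k i y + P k i y = (\<Sum>j | P k j y \<noteq> 0 \<and> (less j i \<or> j = i). P k j y)"
proof -
  define A where "A = {j. P k j y \<noteq> 0 \<and> less j i}"
  define B where "B = {j. P k j y \<noteq> 0 \<and> (less j i \<or> j = i)}"
  have "finite {j. P k j y \<noteq> 0}" using pou[of k] by (rule partition_of_unityD)
  then have A: "finite A" by (rule rev_finite_subset) (auto simp: A_def)
  have "i \<notin> A" using less_irrefl by (simp add: A_def)
  have "B = (if P k i y = 0 then A else insert i A)" by (auto simp: A_def B_def)
  then have "sum (\<lambda>j. P k j y) B = sum (\<lambda>j. P k j y) A + P k i y"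
    using A \<open>i \<notin> A\<close> by simp
  then show ?thesis unfolding Z_eq A_def B_def by simp
qed

lemma Z_P_le: "Z k i y + P k i y \<le> 1"
  unfolding Z_P using pou[of k] by (intro partition_of_unity_sum_le_1) (auto simp: partition_of_unityD)

lemma Z_P_le_Z: "less i i' \<Longrightarrow> Z k i y + P k i y \<le> Z k i' y"
  unfolding Z_P Z_eq[of k i'] using pou[of k] less_trans
  by (intro sum_mono2) (auto simp: partition_of_unityD P0)

lemma integrable_n:
  assumes "continuous_on UNIV f" "\<And>y. \<bar>f y :: real\<bar> \<le> c"
  shows "integrable (n t) f"
  using integrable_bounded[OF n_sets n_finite borel_measurable_continuous_onI[OF assms(1)] assms(2)] .

lemma integrable_Q: "integrable (n t) (Q w)"
  by (rule integrable_n[where c = 1]) (auto simp: Q_cont Q0 Q1)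

lemma Z1: "Z k i y \<le> 1"
  using Z_P_le[of k i y] P0[of k i y] by linarith

lemma QZ1: "\<bar>Q w y * Z k i y\<bar> \<le> 1"
  by (simp add: abs_mult Q0 Q1 Z0 Z1 mult_le_one)

lemma integrable_QZ: "integrable (n t) (\<lambda>y. Q w y * Z k i y)"
  by (rule integrable_n[where c = 1]) (intro continuous_intros Q_cont Z_cont QZ1)+

lemma m0: "0 \<le> m t w"
  unfolding m_def by (simp add: Q0)

lemma L_Cons_ge: "L t w \<le> L t (i # w)"
  by (simp add: Q0 Z0)

lemma L_m_Cons_le: "L t (i # w) + m t (i # w) \<le> L t w + m t w"
proof -
  have "(\<integral>y. Q w y * Z (length w) i y \<partial>n t) + m t (i # w) =
      (\<integral>y. Q w y * Z (length w) i y + Q (i # w) y \<partial>n t)"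
    unfolding m_def by (rule Bochner_Integration.integral_add[OF integrable_QZ integrable_Q, symmetric])
  also have "\<dots> \<le> m t w"
    unfolding m_def
  proof (intro integral_mono)
    show "Q w y * Z (length w) i y + Q (i # w) y \<le> Q w y" for y
      using mult_left_mono[OF Z_P_le[of "length w" i y] Q0[of w y]] by (simp add: algebra_simps)
  qed (intro Bochner_Integration.integrable_add integrable_QZ integrable_Q)+
  finally show ?thesis by simp
qed

lemma J_Cons_subset: "J t (i # w) \<subseteq> J t w"
  using L_Cons_ge[of t w i] L_m_Cons_le[of t i w] by (auto simp: J_def simp del: L.simps)

lemma J_subset_Nil: "J t w \<subseteq> J t []"
  by (induction w) (use J_Cons_subset in blast)+

lemma L_m_Cons_le_L:
  assumes "less i i'"
  shows "L t (i # w) + m t (i # w) \<le> L t (i' # w)"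
proof -
  have "(\<integral>y. Q w y * Z (length w) i y \<partial>n t) + m t (i # w) =
      (\<integral>y. Q w y * Z (length w) i y + Q (i # w) y \<partial>n t)"
    unfolding m_def by (rule Bochner_Integration.integral_add[OF integrable_QZ integrable_Q, symmetric])
  also have "\<dots> \<le> (\<integral>y. Q w y * Z (length w) i' y \<partial>n t)"
  proof (intro integral_mono)
    show "Q w y * Z (length w) i y + Q (i # w) y \<le> Q w y * Z (length w) i' y" for y
      using mult_left_mono[OF Z_P_le_Z[OF assms, of "length w" y] Q0[of w y]] by (simp add: algebra_simps)
  qed (intro Bochner_Integration.integrable_add integrable_QZ integrable_Q)+
  finally show ?thesis by simp
qed

text \<open>Children lie inside their parents, so by induction the parents coincide, and siblings
  are separated by \<open>L_m_Cons_le_L\<close>.\<close>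

lemma J_unique: "length w = length w' \<Longrightarrow> u \<in> J t w \<Longrightarrow> u \<in> J t w' \<Longrightarrow> w = w'"
proof (induction w arbitrary: w')
  case (Cons i v)
  then obtain i' v' where w': "w' = i' # v'" by (cases w') auto
  have "u \<in> J t v" "u \<in> J t v'" 
    using J_Cons_subset[of t i v] J_Cons_subset[of t i' v'] Cons.prems(2,3) by (auto simp only: w')
  then have v: "v' = v" using Cons.IH[of v'] Cons.prems w' by simp
  have "L t (i # v) < u" "u < L t (i # v) + m t (i # v)" "L t (i' # v) < u" "u < L t (i' # v) + m t (i' # v)"
    using Cons.prems(2,3) by (auto simp only: J_def w' v greaterThanLessThan_iff)
  then have "i = i'"
    using less_total[of i i'] L_m_Cons_le_L[of i i' t v] L_m_Cons_le_L[of i' i t v] by linarith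
  then show ?case using w' v by simp
qed auto

lemma J_open: "open (J t w)" by (simp add: J_def)

lemma m_cont: "isCont (\<lambda>t. m t w) t"
  using weak[of "Q w" 1] Q_cont Q0 Q1 by (auto simp: m_def continuous_on_eq_continuous_at)

lemma L_cont: "isCont (\<lambda>t. L t w) t"
proof (induction w)
  case (Cons i w)
  have "continuous_on UNIV (\<lambda>t. \<integral>y. Q w y * Z (length w) i y \<partial>n t)"
    by (rule weak[where c = 1]) (intro continuous_intros Q_cont Z_cont QZ1)+
  with Cons show ?case by (auto simp: continuous_on_eq_continuous_at)
qed simp

text \<open>The intervals are open and their endpoints are continuous in the parameter. Joint
  stability in parameter and position is what later makes \<open>param\<close> jointly
  continuous.\<close>

lemma J_stable:
  assumes "u \<in> J t w"
  shows "\<forall>\<^sub>F (s, v) in nhds (t, u). v \<in> J s w"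
proof -
  have t1: "((\<lambda>p. L (fst p) w) \<longlongrightarrow> L t w) (nhds (t, u))" "((\<lambda>p. m (fst p) w) \<longlongrightarrow> m t w) (nhds (t, u))"
    "((\<lambda>p. snd p) \<longlongrightarrow> u) (nhds (t, u))"
    using L_cont[where w = w and t = t] m_cont[where w = w and t = t]
    by (auto simp: isCont_def tendsto_nhds_iff nhds_prod
        intro: filterlim_compose[OF _ filterlim_fst] filterlim_snd)
  have "\<forall>\<^sub>F p in nhds (t, u). L (fst p) w < snd p"
    using t1 assms by (intro order_tendstoD(2)[OF tendsto_diff[OF t1(1) t1(3)], of 0, simplified]) (auto simp: J_def)
  moreover have "\<forall>\<^sub>F p in nhds (t, u). snd p < L (fst p) w + m (fst p) w"
    using order_tendstoD(2)[OF tendsto_diff[OF t1(3) tendsto_add[OF t1(1,2)]], of 0] assms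
    by (auto simp: J_def)
  ultimately show ?thesis by eventually_elim (auto simp: J_def)
qed

text \<open>\<open>F\<close> is enlarged to all words with a head and a tail occurring in
  \<open>F\<close>; over this product set the sum factors.\<close>

lemma sum_Q_le_1: "finite F \<Longrightarrow> F \<subseteq> {w. length w = k} \<Longrightarrow> (\<Sum>w\<in>F. Q w y) \<le> 1"
proof (induction k arbitrary: F)
  case 0
  then have "F \<subseteq> {[]}" by auto
  then consider "F = {}" | "F = {[]}" by blast
  then show ?case by cases auto
next
  case (Suc k)
  let ?A = "(\<lambda>(i, w). i # w) ` (hd ` F \<times> tl ` F)"
  have len: "length w = Suc k" if "w \<in> F" for w using Suc.prems that by auto
  have "F \<subseteq> ?A"
  proof
    fix w assume w: "w \<in> F"
    then obtain i v where "w = i # v" using len[OF w] by (cases w) auto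
    moreover from this have "i \<in> hd ` F" "v \<in> tl ` F"
      using w by (auto intro: rev_image_eqI)
    ultimately show "w \<in> ?A" by (intro image_eqI[of _ _ "(i, v)"]) auto
  qed
  then have "(\<Sum>w\<in>F. Q w y) \<le> (\<Sum>w\<in>?A. Q w y)"
    using Suc.prems(1) by (intro sum_mono2) (auto simp: Q0 P0 simp del: Q.simps)
  also have "\<dots> = (\<Sum>p\<in>hd ` F \<times> tl ` F. Q (fst p # snd p) y)"
    by (subst sum.reindex) (auto simp: inj_on_def case_prod_beta)
  also have "\<dots> = (\<Sum>p\<in>hd ` F \<times> tl ` F. P k (fst p) y * Q (snd p) y)"
    using len by (intro sum.cong) auto
  also have "\<dots> = (\<Sum>i\<in>hd ` F. P k i y) * (\<Sum>w\<in>tl ` F. Q w y)"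
    by (simp add: sum_product sum.cartesian_product case_prod_beta)
  also have "\<dots> \<le> 1"
  proof (intro mult_le_one)
    show "(\<Sum>i\<in>hd ` F. P k i y) \<le> 1"
      using Suc.prems(1) by (intro partition_of_unity_sum_le_1[OF pou]) auto
    show "(\<Sum>w\<in>tl ` F. Q w y) \<le> 1"
      using Suc.prems(1) len by (intro Suc.IH) auto
    show "0 \<le> (\<Sum>w\<in>tl ` F. Q w y)" by (intro sum_nonneg Q0)
  qed
  finally show ?case .
qed

lemma sum_Q_compact:
  assumes "compact K" "e > 0"
  shows "\<exists>F. finite F \<and> F \<subseteq> {w. length w = k} \<and> (\<forall>y\<in>K. 1 - e \<le> (\<Sum>w\<in>F. Q w y))"
  using assms(2)
proof (induction k arbitrary: e)
  case 0
  then show ?case by (intro exI[of _ "{[]}"]) auto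
next
  case (Suc k)
  \<comment> \<open>Two factors are each at least \<open>1 - e'\<close>, and
    \<open>(1 - e')^2\<close> is at least \<open>1 - 2 * e'\<close>; the cap at 1 keeps the factors
    nonnegative.\<close>
  define e' where "e' = min (e / 2) 1"
  have e': "e' > 0" using Suc.prems by (simp add: e'_def)
  obtain F where F: "finite F" "F \<subseteq> {w. length w = k}" "\<And>y. y \<in> K \<Longrightarrow> 1 - e' \<le> (\<Sum>w\<in>F. Q w y)"
    using Suc.IH[OF e'] by blast
  obtain G where G: "finite G" "\<And>y. y \<in> K \<Longrightarrow> 1 - e' < (\<Sum>i\<in>G. P k i y)"
    using partition_of_unity_compact[OF pou[of k] assms(1) e'] by blast
  let ?A = "(\<lambda>(i, w). i # w) ` (G \<times> F)"
  have "1 - e \<le> (\<Sum>w\<in>?A. Q w y)" if "y \<in> K" for y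
  proof -
    have "1 - e \<le> (1 - e') * (1 - e')" using e' by (simp add: e'_def min_def algebra_simps)
    also have "\<dots> \<le> (\<Sum>i\<in>G. P k i y) * (\<Sum>w\<in>F. Q w y)"
      using F(3)[OF that] G(2)[OF that] by (intro mult_mono) (auto simp: e'_def intro!: sum_nonneg P0 Q0)
    also have "\<dots> = (\<Sum>p\<in>G \<times> F. P k (fst p) y * Q (snd p) y)"
      by (simp add: sum_product sum.cartesian_product case_prod_beta)
    also have "\<dots> = (\<Sum>p\<in>G \<times> F. Q (fst p # snd p) y)"
      using F by (intro sum.cong) auto
    also have "\<dots> = (\<Sum>w\<in>?A. Q w y)"
      by (subst sum.reindex) (auto simp: inj_on_def case_prod_beta)
    finally show ?thesis .
  qed
  then show ?case using F G by (intro exI[of _ ?A]) auto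
qed

text \<open>Lebesgue measure on the interval from 0 to the total mass of \<open>n t\<close>. The
  mass is left free because the construction is applied both to probability measures and to the
  parts of a second marginal coming from single cells.\<close>

definition N :: "'c \<Rightarrow> real measure" where
  "N t = density lborel (indicator (J t []))"

lemma N_sets[simp]: "sets (N t) = sets borel" and N_space[simp]: "space (N t) = UNIV"
  by (auto simp: N_def)

lemma emeasure_N:
  assumes [measurable]: "B \<in> sets borel"
  shows "emeasure (N t) B = emeasure lborel (J t [] \<inter> B)"
  by (simp add: N_def emeasure_density indicator_inter_arith[symmetric] J_def)

lemma J_borel[measurable]: "J t w \<in> sets borel" by (simp add: J_def)

lemma emeasure_N_J: "emeasure (N t) (J t w) = ennreal (m t w)"
proof -
  have "J t [] \<inter> J t w = J t w" using J_subset_Nil by blast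
  then have "emeasure (N t) (J t w) = emeasure lborel (J t w)" by (simp add: emeasure_N)
  also have "\<dots> = ennreal (m t w)" using m0[of t w] by (simp add: J_def)
  finally show ?thesis .
qed

lemma N_finite: "finite_measure (N t)"
proof
  have "emeasure (N t) UNIV = emeasure (N t) (J t [])" by (simp add: emeasure_N)
  then show "emeasure (N t) (space (N t)) \<noteq> \<infinity>" by (simp add: emeasure_N_J)
qed

lemma measure_N_J: "measure (N t) (J t w) = m t w"
  using emeasure_N_J[of t w] m0[of t w] by (simp add: measure_def)

lemma m_Nil: "m t [] = measure (n t) UNIV"
  using n_space[of t] by (simp add: m_def)

lemma measure_N_UNIV: "measure (N t) UNIV = m t []"
proof -
  have "emeasure (N t) UNIV = emeasure (N t) (J t [])" by (simp add: emeasure_N)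
  then show ?thesis using measure_N_J[of t "[]"] by (simp add: measure_def)
qed

lemma measure_N_UN:
  assumes "finite F" "F \<subseteq> {w. length w = k}"
  shows "measure (N t) (\<Union>w\<in>F. J t w) = (\<integral>y. (\<Sum>w\<in>F. Q w y) \<partial>n t)"
proof -
  have "disjoint_family_on (J t) F"
    unfolding disjoint_family_on_def
  proof (intro ballI impI equals0I)
    fix w w' u assume "w \<in> F" "w' \<in> F" "w \<noteq> w'" "u \<in> J t w \<inter> J t w'"
    then show False using J_unique[of w w' u t] assms(2) by auto
  qed
  then have "measure (N t) (\<Union>w\<in>F. J t w) = (\<Sum>w\<in>F. measure (N t) (J t w))"
    using assms by (intro finite_measure.finite_measure_finite_Union[OF N_finite]) auto
  also have "\<dots> = (\<integral>y. (\<Sum>w\<in>F. Q w y) \<partial>n t)"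
    by (simp add: measure_N_J m_def integrable_Q)
  finally show ?thesis .
qed

definition lev :: "'c \<Rightarrow> nat \<Rightarrow> real set" where
  "lev t k = (\<Union>w\<in>{w. length w = k}. J t w)"

lemma lev_open: "open (lev t k)" by (auto simp: lev_def J_open)

lemma lev_borel[measurable]: "lev t k \<in> sets borel" using lev_open by (rule borel_open)

text \<open>There may be uncountably many words, so mass could escape between their intervals.
  Tightness excludes this: on a compact set carrying almost all of \<open>n t\<close>, finitely many
  words have almost all the weight.\<close>

lemma measure_lev: "measure (N t) (lev t k) = m t []"
proof (rule antisym)
  interpret N: finite_measure "N t" by (rule N_finite)
  interpret n: finite_measure "n t" by (rule n_finite)
  show "measure (N t) (lev t k) \<le> m t []"
    using N.bounded_measure[of "lev t k"] measure_N_UNIV[of t] unfolding N_space by linarith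
  have "m t [] \<le> measure (N t) (lev t k) + e" if "e > 0" for e
  proof -
    \<comment> \<open>The loss is \<open>e' * m t []\<close> from the incomplete weights on
      \<open>K\<close> and at most \<open>e'\<close> from outside \<open>K\<close>.\<close>
    define e' where "e' = e / (1 + m t [])"
    have e': "e' > 0" using that m0[of t "[]"] by (simp add: e'_def)
    have "\<exists>K. compact K \<and> K \<subseteq> UNIV \<and> measure (n t) (UNIV - K) < e'"
      by (rule radon_measureD(4)[OF radon]) (simp_all add: e')
    then obtain K where K: "compact K" "measure (n t) (UNIV - K) < e'" by blast
    obtain F where F: "finite F" "F \<subseteq> {w. length w = k}" "\<And>y. y \<in> K \<Longrightarrow> 1 - e' \<le> (\<Sum>w\<in>F. Q w y)"
      using sum_Q_compact[OF K(1) e', of k] by (elim exE conjE) (rule that, blast+)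
    have Kb[measurable]: "K \<in> sets borel" using K(1) by (simp add: borel_closed compact_imp_closed)
    have int: "integrable (n t) (indicator (UNIV - K) :: _ \<Rightarrow> real)"
    proof (rule integrable_real_indicator)
      show "UNIV - K \<in> sets (n t)" unfolding n_sets by measurable
      show "emeasure (n t) (UNIV - K) < \<infinity>" by (simp add: n.emeasure_eq_measure)
    qed
    have "(1 - e') * m t [] - measure (n t) (UNIV - K) = (\<integral>y. 1 - e' \<partial>n t) - (\<integral>y. indicator (UNIV - K) y \<partial>n t)"
      by (simp add: m_Nil n_space)
    also have "\<dots> = (\<integral>y. 1 - e' - indicator (UNIV - K) y \<partial>n t)"
      using int by (subst Bochner_Integration.integral_diff) auto
    also have "\<dots> \<le> (\<integral>y. (\<Sum>w\<in>F. Q w y) \<partial>n t)"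
    proof (rule integral_mono)
      show "integrable (n t) (\<lambda>y. 1 - e' - indicator (UNIV - K) y)"
        using int by (intro Bochner_Integration.integrable_diff) auto
      show "1 - e' - indicator (UNIV - K) y \<le> (\<Sum>w\<in>F. Q w y)" for y
        using F(3)[of y] e' sum_nonneg[of F "\<lambda>w. Q w y"] Q0 by (cases "y \<in> K") auto
    qed (auto intro: integrable_Q)
    also have "\<dots> = measure (N t) (\<Union>w\<in>F. J t w)" using F by (simp add: measure_N_UN)
    also have "\<dots> \<le> measure (N t) (lev t k)"
    proof (rule N.finite_measure_mono)
      show "(\<Union>w\<in>F. J t w) \<subseteq> lev t k" using F(2) by (auto simp: lev_def)
    qed simp
    finally have "m t [] \<le> measure (N t) (lev t k) + e' * (1 + m t [])"
      using K(2) by (simp add: algebra_simps)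
    moreover have "1 + m t [] \<noteq> 0" using m0[of t "[]"] by linarith
    then have "e' * (1 + m t []) = e" unfolding e'_def by (simp only: times_divide_eq_left) (rule nonzero_mult_div_cancel_right)
    ultimately show ?thesis by linarith
  qed
  then show "m t [] \<le> measure (N t) (lev t k)" by (rule field_le_epsilon)
qed

lemma AE_lev: "AE u in N t. \<forall>k. u \<in> lev t k"
proof -
  interpret N: finite_measure "N t" by (rule N_finite)
  have "AE u in N t. u \<in> lev t k" for k
  proof -
    have "measure (N t) (UNIV - lev t k) = 0"
      using N.finite_measure_compl[of "lev t k"] by (simp add: measure_lev measure_N_UNIV)
    then have "UNIV - lev t k \<in> null_sets (N t)" by (simp add: null_sets_def N.emeasure_eq_measure)
    from AE_not_in[OF this] show ?thesis by eventually_elim simp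
  qed
  then show ?thesis by (simp add: AE_all_countable)
qed

section \<open>The limit map, its joint continuity and its law\<close>

definition word :: "'c \<Rightarrow> real \<Rightarrow> nat \<Rightarrow> 'i list" where
  "word t u k = (THE w. length w = k \<and> u \<in> J t w)"

text \<open>Where no interval of the next level contains \<open>u\<close> the previous value is
  kept. Thus the sequence is Cauchy for every \<open>u\<close>, not just almost every one, and its
  limit is a Borel map without further modification.\<close>

primrec approx :: "'c \<Rightarrow> real \<Rightarrow> nat \<Rightarrow> 'b" where
  "approx t u 0 = undefined"
| "approx t u (Suc k) = (if u \<in> lev t (Suc k) then ctr (hd (word t u (Suc k))) else approx t u k)"

lemma word_eq: "u \<in> J t w \<Longrightarrow> length w = k \<Longrightarrow> word t u k = w"
  unfolding word_def using J_unique by (intro the_equality) blast+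

lemma approx_J:
  assumes "u \<in> J t w" "length w = Suc k"
  shows "approx t u (Suc k) = ctr (hd w)"
proof -
  have "u \<in> lev t (Suc k)" using assms by (auto simp: lev_def)
  then show ?thesis using word_eq[OF assms] by simp
qed

lemma J_P_nonzero:
  assumes "u \<in> J t w"
  shows "\<exists>y. Q w y \<noteq> 0"
proof (rule ccontr)
  assume "\<not> ?thesis"
  then have "m t w = 0" by (simp add: m_def)
  then show False using assms by (simp add: J_def)
qed

text \<open>A nonempty interval belongs to a word whose weight is nonzero at some point
  \<open>y\<close>; the centres chosen at the last two levels are both close to this
  \<open>y\<close>.\<close>

lemma approx_step: "dist (approx t u (Suc k)) (approx t u (Suc (Suc k))) \<le> 2 * (1/2)^k"
proof (cases "u \<in> lev t (Suc (Suc k))")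
  case True
  then obtain w where w: "length w = Suc (Suc k)" "u \<in> J t w" by (auto simp: lev_def)
  then obtain i j v where v: "w = i # j # v" "length v = k" by (auto simp: length_Suc_conv)
  have "u \<in> J t (j # v)" using J_Cons_subset w v by blast
  then have a: "approx t u (Suc k) = ctr j" using approx_J[of u t "j # v" k] v by simp
  have b: "approx t u (Suc (Suc k)) = ctr i" using approx_J[of u t w "Suc k"] v w by simp
  obtain y where y: "Q w y \<noteq> 0" using J_P_nonzero w by blast
  then have "dist y (ctr i) < (1/2)^Suc k" "dist y (ctr j) < (1/2)^k"
    using small[of "Suc k" i y] small[of k j y] v by auto
  moreover have "(1/2::real)^Suc k \<le> (1/2)^k" by simp
  ultimately show ?thesis unfolding a b using dist_triangle3[of "ctr j" "ctr i" y] by linarith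
next
  case False
  then have "approx t u (Suc (Suc k)) = approx t u (Suc k)" by simp
  then show ?thesis by (simp del: approx.simps)
qed

text \<open>The subtracted term makes the induction close: its decrease from \<open>j\<close> to
  \<open>Suc j\<close> is \<open>2 * (1/2)^(k + j)\<close>, the bound of
  \<open>approx_step\<close>.\<close>

lemma approx_steps: "dist (approx t u (Suc k)) (approx t u (Suc (k + j))) \<le> 4 * (1/2)^k - 4 * (1/2)^(k + j)"
proof (induction j)
  case (Suc j)
  then show ?case
    using approx_step[of t u "k + j"]
      dist_triangle[of "approx t u (Suc k)" "approx t u (Suc (k + Suc j))" "approx t u (Suc (k + j))"]
    by (simp del: approx.simps)
qed simp

lemma approx_dist:
  assumes "k \<le> l"
  shows "dist (approx t u (Suc k)) (approx t u (Suc l)) \<le> 4 * (1/2)^k"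
proof -
  have "dist (approx t u (Suc k)) (approx t u (Suc l)) \<le> 4 * (1/2)^k - 4 * (1/2)^l"
    using approx_steps[of t u k "l - k"] assms by simp
  moreover have "0 \<le> (1/2::real)^l" by simp
  ultimately show ?thesis by linarith
qed

lemma Cauchy_approx: "Cauchy (\<lambda>k. approx t u (Suc k))"
proof (rule metric_CauchyI)
  fix e :: real assume "e > 0"
  then obtain M where M: "(1/2)^M < e / 8" using real_arch_pow_inv[of "e / 8" "1/2"] by auto
  have "dist (approx t u (Suc k)) (approx t u (Suc l)) < e" if "M \<le> k" "M \<le> l" for k l
    using approx_dist[OF that(1), of t u] approx_dist[OF that(2), of t u] M
      dist_triangle3[of "approx t u (Suc k)" "approx t u (Suc l)" "approx t u (Suc M)"] by linarith
  then show "\<exists>M. \<forall>k\<ge>M. \<forall>l\<ge>M. dist (approx t u (Suc k)) (approx t u (Suc l)) < e" by blast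
qed

definition param :: "'c \<Rightarrow> real \<Rightarrow> 'b" where
  "param t u = lim (\<lambda>k. approx t u (Suc k))"

lemma approx_tendsto: "(\<lambda>k. approx t u (Suc k)) \<longlonglongrightarrow> param t u"
  using Cauchy_approx[of t u] unfolding param_def Cauchy_convergent_iff convergent_LIMSEQ_iff .

lemma param_dist: "dist (approx t u (Suc k)) (param t u) \<le> 4 * (1/2)^k"
proof (rule LIMSEQ_le_const2)
  show "(\<lambda>l. dist (approx t u (Suc k)) (approx t u (Suc l))) \<longlonglongrightarrow> dist (approx t u (Suc k)) (param t u)"
    by (intro tendsto_intros approx_tendsto)
  show "\<exists>M. \<forall>l\<ge>M. dist (approx t u (Suc k)) (approx t u (Suc l)) \<le> 4 * (1/2)^k"
    using approx_dist by blast
qed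

lemma approx_measurable: "(\<lambda>u. approx t u k) \<in> borel_measurable borel"
proof (induction k)
  case (Suc k)
  show ?case
  proof (rule borel_measurableI)
    fix S :: "'b set" assume "open S"
    \<comment> \<open>A possibly uncountable union, Borel because each interval is open.\<close>
    let ?A = "\<Union>w\<in>{w. length w = Suc k \<and> ctr (hd w) \<in> S}. J t w"
    have "(\<lambda>u. approx t u (Suc k)) -` S = ?A \<union> ((- lev t (Suc k)) \<inter> (\<lambda>u. approx t u k) -` S)"
    proof (intro equalityI subsetI)
      fix u assume u: "u \<in> (\<lambda>u. approx t u (Suc k)) -` S"
      show "u \<in> ?A \<union> ((- lev t (Suc k)) \<inter> (\<lambda>u. approx t u k) -` S)"
      proof (cases "u \<in> lev t (Suc k)")
        case True
        then obtain w where w: "length w = Suc k" "u \<in> J t w" by (auto simp: lev_def)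
        then have "ctr (hd w) \<in> S" using u approx_J[of u t w k] by simp
        with w show ?thesis by blast
      qed (use u in auto)
    next
      fix u assume "u \<in> ?A \<union> ((- lev t (Suc k)) \<inter> (\<lambda>u. approx t u k) -` S)"
      then show "u \<in> (\<lambda>u. approx t u (Suc k)) -` S"
      proof
        assume "u \<in> ?A"
        then obtain w where "length w = Suc k" "u \<in> J t w" "ctr (hd w) \<in> S" by blast
        then show ?thesis using approx_J[of u t w k] by simp
      qed simp
    qed
    moreover have "?A \<in> sets borel" by (intro borel_open open_UN ballI J_open)
    moreover have "(\<lambda>u. approx t u k) -` S \<in> sets borel"
      using measurable_sets[OF Suc, of S] \<open>open S\<close> by simp
    ultimately show "(\<lambda>u. approx t u (Suc k)) -` S \<inter> space borel \<in> sets borel"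
      by simp
  qed
qed simp

lemma param_measurable[measurable]: "param t \<in> borel_measurable borel"
  by (rule borel_measurable_LIMSEQ_metric[OF approx_measurable approx_tendsto])

text \<open>All pairs near \<open>(t, u)\<close> share the word of level \<open>Suc k\<close> and
  hence the approximation of that level, from which each of the two limits differs by at most
  \<open>4 * (1/2)^k\<close>.\<close>

lemma param_isCont:
  assumes "\<And>k. u \<in> lev t k"
  shows "isCont (\<lambda>(s, v). param s v) (t, u)"
  unfolding isCont_def tendsto_at_iff_tendsto_nhds
proof (rule tendstoI)
  fix e :: real assume "e > 0"
  then obtain k where k: "(1/2)^k < e / 8" using real_arch_pow_inv[of "e / 8" "1/2"] by auto
  obtain w where w: "length w = Suc k" "u \<in> J t w" using assms[of "Suc k"] by (auto simp: lev_def)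
  from J_stable[OF w(2)]
  show "\<forall>\<^sub>F p in nhds (t, u). dist (case p of (s, v) \<Rightarrow> param s v) (case (t, u) of (s, v) \<Rightarrow> param s v) < e"
  proof eventually_elim
    case (elim p)
    obtain s v where p: "p = (s, v)" by (cases p)
    have "approx s v (Suc k) = approx t u (Suc k)"
      using approx_J[of v s w k] approx_J[of u t w k] w elim p by simp
    then show ?case
      using param_dist[of t u k] param_dist[of s v k] k
        dist_triangle3[of "param s v" "param t u" "approx t u (Suc k)"]
      unfolding p by (auto simp: dist_commute simp del: approx.simps)
  qed
qed

text \<open>A word with some weight on \<open>K\<close> sends its interval close to
  \<open>K\<close>. The remaining words have weight 0 on \<open>K\<close> and total weight at most 1
  elsewhere, so their intervals have at most the mass that \<open>n t\<close> gives to the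
  complement of \<open>K\<close>.\<close>

lemma measure_param_ge:
  assumes K: "compact K"
  shows "measure (n t) K \<le> measure (N t) (param t -` K)"
proof (cases "K = {}")
  case False
  interpret N: finite_measure "N t" by (rule N_finite)
  interpret n: finite_measure "n t" by (rule n_finite)
  have Kb[measurable]: "K \<in> sets borel" using K by (simp add: borel_closed compact_imp_closed)
  \<comment> \<open>The 5 is 4 + 1: the limit is within \<open>4 * (1/2)^k\<close> of a centre, and
    the centre within \<open>(1/2)^k\<close> of a point of \<open>K\<close>.\<close>
  define A where "A k = {v. infdist (param t v) K \<le> 5 * (1/2)^k}" for k :: nat
  have A_meas: "A k \<in> sets borel" for k
  proof -
    have "A k = param t -` {y. infdist y K \<le> 5 * (1/2)^k} \<inter> space borel" by (auto simp: A_def)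
    moreover have "{y. infdist y K \<le> 5 * (1/2)^k} \<in> sets borel"
      by (intro borel_closed closed_Collect_le continuous_intros)
    ultimately show ?thesis using measurable_sets[OF param_measurable] by metis
  qed
  have le: "measure (n t) K \<le> measure (N t) (A k)" for k
  proof -
    define W where "W = {w. length w = Suc k \<and> (\<forall>y\<in>K. Q w y = 0)}"
    define U where "U = (\<Union>w\<in>W. J t w)"
    have U_meas: "U \<in> sets borel" unfolding U_def by (intro borel_open open_UN ballI J_open)
    \<comment> \<open>\<open>W\<close> may be uncountable, so the sum of weights is estimated over
      the finitely many intervals covering a compact subset; inner regularity of \<open>N t\<close>
      then gives the bound for \<open>U\<close>.\<close>
    have C_le: "emeasure (N t) C \<le> ennreal (measure (n t) (UNIV - K))" if C: "C \<subseteq> U" "compact C" for C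
    proof -
      obtain F where F: "F \<subseteq> W" "finite F" "C \<subseteq> (\<Union>w\<in>F. J t w)"
        using compactE_image[OF C(2), of W "J t"] C(1) J_open unfolding U_def by metis
      have FW: "F \<subseteq> {w. length w = Suc k}" using F by (auto simp: W_def)
      have "measure (N t) C \<le> measure (N t) (\<Union>w\<in>F. J t w)"
        using F by (intro N.finite_measure_mono) auto
      also have "\<dots> = (\<integral>y. (\<Sum>w\<in>F. Q w y) \<partial>n t)" by (rule measure_N_UN[OF F(2) FW])
      also have "\<dots> \<le> (\<integral>y. indicator (UNIV - K) y \<partial>n t)"
      proof (rule integral_mono)
        show "integrable (n t) (indicator (UNIV - K) :: _ \<Rightarrow> real)"
        proof (rule integrable_real_indicator)
          show "UNIV - K \<in> sets (n t)" unfolding n_sets by measurable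
          show "emeasure (n t) (UNIV - K) < \<infinity>" by (simp add: n.emeasure_eq_measure)
        qed
        show "(\<Sum>w\<in>F. Q w y) \<le> indicator (UNIV - K) y" for y
        proof (cases "y \<in> K")
          case True
          then have "(\<Sum>w\<in>F. Q w y) = 0" using F(1) by (intro sum.neutral) (auto simp: W_def)
          then show ?thesis by simp
        next
          case False
          then show ?thesis using sum_Q_le_1[OF F(2) FW, of y] by simp
        qed
      qed (intro Bochner_Integration.integrable_sum integrable_Q)
      also have "\<dots> = measure (n t) (UNIV - K)" by (simp add: n_space)
      finally show ?thesis by (simp add: N.emeasure_eq_measure)
    qed
    have "emeasure (N t) U = (SUP C\<in>{C. C \<subseteq> U \<and> compact C}. emeasure (N t) C)"
      using N.emeasure_finite by (intro inner_regular U_meas) auto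
    also have "\<dots> \<le> ennreal (measure (n t) (UNIV - K))"
      using C_le by (intro SUP_least) auto
    finally have U_le: "measure (N t) U \<le> measure (n t) (UNIV - K)"
      by (simp add: N.emeasure_eq_measure)
    have "measure (n t) K = m t [] - measure (n t) (UNIV - K)"
      using n.finite_measure_compl[of K] by (simp add: n_sets n_space m_Nil)
    also have "\<dots> \<le> measure (N t) (lev t (Suc k)) - measure (N t) U"
      using U_le by (simp add: measure_lev)
    also have "\<dots> = measure (N t) (lev t (Suc k) - U)"
    proof (rule N.finite_measure_Diff[symmetric])
      show "U \<subseteq> lev t (Suc k)" by (auto simp: U_def W_def lev_def)
    qed (use U_meas in simp_all)
    also have "\<dots> \<le> measure (N t) (A k)"
    proof (intro N.finite_measure_mono subsetI)
      fix u assume u: "u \<in> lev t (Suc k) - U"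
      then obtain w where w: "length w = Suc k" "u \<in> J t w" by (auto simp: lev_def)
      with u have "w \<notin> W" by (auto simp: U_def)
      then obtain y where y: "y \<in> K" "Q w y \<noteq> 0" using w by (auto simp: W_def)
      obtain i v where v: "w = i # v" "length v = k" using w by (auto simp: length_Suc_conv)
      have "dist y (ctr i) < (1/2)^k" using y v by (intro small) auto
      moreover have "approx t u (Suc k) = ctr i" using approx_J[OF w(2,1)] v by simp
      ultimately have "dist (param t u) y \<le> 5 * (1/2)^k"
        using param_dist[of t u k] dist_triangle3[of "param t u" y "ctr i"] by (simp add: dist_commute)
      then show "u \<in> A k" using infdist_le[OF y(1), of "param t u"] by (simp add: A_def)
    qed (use A_meas in auto)
    finally show ?thesis .
  qed
  have "decseq A"
  proof (rule decseq_SucI, rule subsetI)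
    fix k u assume "u \<in> A (Suc k)"
    moreover have "(1/2::real)^Suc k \<le> (1/2)^k" by simp
    ultimately show "u \<in> A k" unfolding A_def mem_Collect_eq by linarith
  qed
  then have "(\<lambda>k. measure (N t) (A k)) \<longlonglongrightarrow> measure (N t) (\<Inter>k. A k)"
    using A_meas by (intro N.finite_Lim_measure_decseq) auto
  moreover have "(\<Inter>k. A k) = param t -` K"
  proof (intro equalityI subsetI)
    fix u assume u: "u \<in> (\<Inter>k. A k)"
    have "(\<lambda>k. 5 * (1/2::real)^k) \<longlonglongrightarrow> 5 * 0" by (intro tendsto_intros LIMSEQ_realpow_zero) auto
    then have "infdist (param t u) K \<le> 5 * 0"
      by (rule LIMSEQ_le_const) (use u in \<open>auto simp: A_def\<close>)
    then have "infdist (param t u) K = 0" using infdist_nonneg[of "param t u" K] by simp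
    then show "u \<in> param t -` K"
      using in_closed_iff_infdist_zero[OF compact_imp_closed[OF K] False] by simp
  qed (auto simp: A_def)
  ultimately show ?thesis using LIMSEQ_le_const le by metis
qed simp

text \<open>The inequality on compact sets extends to Borel sets by the Radon property of
  \<open>n t\<close>; since the total masses agree, passing to complements turns it into
  equality.\<close>

lemma distr_param: "distr (N t) borel (param t) = n t"
proof (rule measure_eqI)
  show "sets (distr (N t) borel (param t)) = sets (n t)" by (simp add: n_sets)
  interpret N: finite_measure "N t" by (rule N_finite)
  interpret n: finite_measure "n t" by (rule n_finite)
  have meas: "param t \<in> measurable (N t) borel" using param_measurable by (simp cong: measurable_cong_sets)
  interpret D: finite_measure "distr (N t) borel (param t)" by (rule N.finite_measure_distr[OF meas])
  have D_eq: "measure (distr (N t) borel (param t)) B = measure (N t) (param t -` B)" if "B \<in> sets borel" for B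
    using measure_distr[OF meas that] by simp
  have le: "measure (n t) B \<le> measure (distr (N t) borel (param t)) B" if B: "B \<in> sets borel" for B
  proof (rule field_le_epsilon)
    fix e :: real assume "e > 0"
    from radon_measureD(4)[OF radon B this] obtain K
      where K: "compact K" "K \<subseteq> B" "measure (n t) (B - K) < e" by blast
    have Kb: "K \<in> sets borel" using K by (simp add: borel_closed compact_imp_closed)
    have "measure (n t) B = measure (n t) (B - K) + measure (n t) K"
      using B Kb K n.finite_measure_Diff[of B K] by (simp add: n_sets)
    also have "\<dots> \<le> e + measure (distr (N t) borel (param t)) K"
      using K(3) measure_param_ge[OF K(1), of t] Kb by (simp add: D_eq)
    also have "\<dots> \<le> e + measure (distr (N t) borel (param t)) B"
      using K B by (intro add_left_mono D.finite_measure_mono) auto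
    finally show "measure (n t) B \<le> measure (distr (N t) borel (param t)) B + e" by simp
  qed
  fix B assume "B \<in> sets (distr (N t) borel (param t))"
  then have B: "B \<in> sets borel" by simp
  have tot: "measure (distr (N t) borel (param t)) UNIV = measure (n t) UNIV"
    by (simp add: D_eq measure_N_UNIV m_Nil)
  have "measure (n t) (UNIV - B) \<le> measure (distr (N t) borel (param t)) (UNIV - B)"
    using B by (intro le) auto
  then have "measure (distr (N t) borel (param t)) B \<le> measure (n t) B"
    using D.finite_measure_compl[of B] n.finite_measure_compl[of B] B tot by (simp add: n_sets n_space)
  with le[OF B] show "emeasure (distr (N t) borel (param t)) B = emeasure (n t) B"
    by (simp add: D.emeasure_eq_measure n.emeasure_eq_measure)
qed

end

text \<open>A Skorokhod representation for finite Radon measures on a possibly nonseparable space.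
  Continuity is joint in \<open>(t, u)\<close> because later the second argument is itself a
  function of the parameter.\<close>

theorem skorokhod_parametrization:
  fixes n :: "'c::metric_space \<Rightarrow> 'b::complete_space measure"
  assumes radon: "\<And>t. radon_measure (n t)"
    and weak: "\<And>f c. continuous_on UNIV f \<Longrightarrow> (\<And>y. \<bar>f y :: real\<bar> \<le> c) \<Longrightarrow>
      continuous_on UNIV (\<lambda>t. \<integral>y. f y \<partial>n t)"
  shows "\<exists>x :: 'c \<Rightarrow> real \<Rightarrow> 'b. (\<forall>t. x t \<in> borel_measurable borel) \<and>
    (\<forall>t. distr (density lborel (indicator {0<..<measure (n t) UNIV})) borel (x t) = n t) \<and>
    (\<forall>t. AE u in density lborel (indicator {0<..<measure (n t) UNIV}). isCont (\<lambda>(s, v). x s v) (t, u))"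
proof -
  have "\<exists>P :: nat \<times> 'b \<Rightarrow> 'b \<Rightarrow> real. partition_of_unity P \<and>
      (\<forall>i x. P i x \<noteq> 0 \<longrightarrow> dist x (snd i) < (1/2)^k)" for k :: nat
    using partition_of_unity_exists[of "\<lambda>_. (1/2)^k"] by (metis zero_less_power half_gt_zero_iff zero_less_one)
  then obtain P :: "nat \<Rightarrow> nat \<times> 'b \<Rightarrow> 'b \<Rightarrow> real" where P: "\<And>k. partition_of_unity (P k)"
      "\<And>k i x. P k i x \<noteq> 0 \<Longrightarrow> dist x (snd i) < (1/2)^k" by metis
  obtain R :: "(nat \<times> 'b) rel" where R: "well_order_on UNIV R" using card_of_well_order_on by blast
  define less where "less i j \<longleftrightarrow> (i, j) \<in> R \<and> i \<noteq> j" for i j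
  interpret interval_tree n P less snd
  proof
    show "less i j \<or> i = j \<or> less j i" for i j
      using R unfolding less_def well_order_on_def linear_order_on_def total_on_def by blast
    show "less i j \<Longrightarrow> less j k \<Longrightarrow> less i k" for i j k
      using R unfolding less_def well_order_on_def linear_order_on_def partial_order_on_def preorder_on_def
      by (metis antisymD transD)
  qed (use radon weak P in \<open>auto simp: less_def\<close>)
  have N: "density lborel (indicator {0<..<measure (n t) UNIV}) = N t" for t
    by (simp add: N_def J_def m_Nil)
  have "AE u in N t. isCont (\<lambda>(s, v). param s v) (t, u)" for t
    using AE_lev[of t] by eventually_elim (blast intro: param_isCont)
  then show ?thesis unfolding N using param_measurable distr_param by blast
qed

section \<open>Total variation, distribution functions and couplings\<close>

text \<open>An open set is the union of \<open>U \<times> V U\<close>, where \<open>U\<close> runs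
  through a countable base of the first factor and \<open>V U\<close> is the largest open set that
  fits. Countability is asked of the first factor alone, since Y need not be separable.\<close>

lemma sets_borel_prod_second_countable:
  "sets (borel :: ('a::second_countable_topology \<times> 'b::topological_space) measure) = sets (borel \<Otimes>\<^sub>M borel)"
proof -
  obtain B :: "'a set set" where B: "countable B" "topological_basis B"
    using ex_countable_basis by blast
  have op: "S \<in> sets (borel \<Otimes>\<^sub>M borel)" if S: "open S" for S :: "('a \<times> 'b) set"
  proof -
    define V where "V U = \<Union>{V. open V \<and> U \<times> V \<subseteq> S}" for U
    have V: "open (V U)" "U \<times> V U \<subseteq> S" for U by (auto simp: V_def)
    have "S = (\<Union>U\<in>B. U \<times> V U)"
    proof (intro equalityI subsetI)
      fix p assume p: "p \<in> S"
      then obtain A C where AC: "open A" "open C" "p \<in> A \<times> C" "A \<times> C \<subseteq> S"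
        using S by (blast elim: open_prod_elim)
      then have "fst p \<in> A" by auto
      then obtain U where U: "U \<in> B" "fst p \<in> U" "U \<subseteq> A"
        using topological_basisE[OF B(2) AC(1)] by metis
      then have "U \<times> C \<subseteq> S" using AC by blast
      then have "snd p \<in> V U" using AC by (auto simp: V_def)
      with U show "p \<in> (\<Union>U\<in>B. U \<times> V U)" by (cases p) auto
    qed (use V(2) in blast)
    also have "\<dots> \<in> sets (borel \<Otimes>\<^sub>M borel)"
      using B V topological_basis_open[OF B(2)] by (intro sets.countable_UN') auto
    finally show ?thesis .
  qed
  have "(\<lambda>p. p) \<in> borel_measurable (borel \<Otimes>\<^sub>M borel :: ('a \<times> 'b) measure)"
    by (rule borel_measurableI) (use op in \<open>simp add: space_pair_measure\<close>)
  moreover have "(\<lambda>p. p) \<in> (borel :: ('a \<times> 'b) measure) \<rightarrow>\<^sub>M borel \<Otimes>\<^sub>M borel"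
  proof -
    have "fst \<in> borel_measurable (borel :: ('a \<times> 'b) measure)" "snd \<in> borel_measurable (borel :: ('a \<times> 'b) measure)"
      by (auto intro!: borel_measurable_continuous_onI continuous_intros)
    from measurable_Pair[OF this] show ?thesis by simp
  qed
  ultimately show ?thesis
    by (intro equalityI subsetI) (auto dest!: measurable_sets simp: space_pair_measure)
qed

lemma measure_singleton_eq_0:
  fixes M :: "'a::t1_space measure"
  assumes "nonatomic M" "sets M = sets borel"
  shows "emeasure M {x} = 0"
proof (rule ccontr)
  assume "emeasure M {x} \<noteq> 0"
  then have "atom M {x}"
    using assms(2) by (auto simp: atom_def subset_singleton_iff zero_less_iff_neq_zero)
  then show False using assms(1) by (auto simp: nonatomic_def)
qed

section \<open>Borel probability measures and the total variation distance\<close>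

definition prob_borel :: "'a::topological_space measure \<Rightarrow> bool" where
  "prob_borel M \<longleftrightarrow> prob_space M \<and> sets M = sets borel"

lemma prob_borelD: "prob_borel M \<Longrightarrow> prob_space M" "prob_borel M \<Longrightarrow> sets M = sets borel"
    "prob_borel M \<Longrightarrow> space M = UNIV" "prob_borel M \<Longrightarrow> finite_measure M"
  using sets_eq_imp_space_eq[of M borel] by (auto simp: prob_borel_def prob_space.finite_measure)

lemma radon_prob_prob_borel: "M \<in> radon_prob \<Longrightarrow> prob_borel M"
  by (auto simp: radon_prob_def radon_measure_def prob_borel_def)

lemma sum_measure_disjoint_le_1:
  assumes "prob_borel M" "finite P" "P \<subseteq> sets borel" "disjoint P"
  shows "(\<Sum>A\<in>P. measure M A) \<le> 1"
proof -
  interpret prob_space M using assms(1) by (rule prob_borelD)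
  have "disjoint_family_on (\<lambda>A. A) P"
    using assms(4) by (auto simp: disjoint_family_on_def pairwise_def disjnt_def)
  then have "(\<Sum>A\<in>P. measure M A) = measure M (\<Union>A\<in>P. A)"
    using assms by (intro finite_measure_finite_Union[symmetric]) (auto simp: prob_borelD)
  then show ?thesis by simp
qed

lemma tv_dist_ge:
  assumes "prob_borel M" "prob_borel N" "A \<in> sets borel"
  shows "\<bar>measure M A - measure N A\<bar> \<le> tv_dist M N"
proof -
  have "bdd_above ((\<lambda>P. \<Sum>A\<in>P. \<bar>measure M A - measure N A\<bar>) ` {P. finite P \<and> P \<subseteq> sets borel \<and> disjoint P})"
  proof (rule bdd_aboveI2)
    fix P :: "'a set set" assume P: "P \<in> {P. finite P \<and> P \<subseteq> sets borel \<and> disjoint P}"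
    have "(\<Sum>A\<in>P. \<bar>measure M A - measure N A\<bar>) \<le> (\<Sum>A\<in>P. measure M A + measure N A)"
      by (intro sum_mono) (simp add: abs_le_iff)
    also have "\<dots> \<le> 2"
      using sum_measure_disjoint_le_1[OF assms(1), of P] sum_measure_disjoint_le_1[OF assms(2), of P] P
      by (simp add: sum.distrib)
    finally show "(\<Sum>A\<in>P. \<bar>measure M A - measure N A\<bar>) \<le> 2" .
  qed
  from cSUP_upper[OF _ this, of "{A}"] show ?thesis using assms(3) by (simp add: tv_dist_def)
qed

lemma tv_dist_self: "tv_dist M M = 0"
proof -
  have ne: "{P :: 'a set set. finite P \<and> P \<subseteq> sets borel \<and> disjoint P} \<noteq> {}" by (auto intro!: exI[of _ "{}"])
  show ?thesis by (simp add: tv_dist_def cSUP_const[OF ne])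
qed

text \<open>Up to \<open>1 / n\<close>, \<open>f\<close> is the average of the indicators of the
  sets where \<open>f\<close> is at least \<open>i / n\<close>, and on each of these
  \<open>n\<close> sets the measures differ by at most \<open>tv_dist M N\<close>.\<close>

lemma tv_dist_integral_01:
  assumes M: "prob_borel M" and N: "prob_borel N" and f: "f \<in> borel_measurable borel"
    and f01: "\<And>x. 0 \<le> f x" "\<And>x. f x \<le> (1::real)"
  shows "(\<integral>x. f x \<partial>M) - (\<integral>x. f x \<partial>N) \<le> tv_dist M N"
proof (rule field_le_epsilon)
  fix e :: real assume "e > 0"
  then obtain k where k: "inverse (real (Suc k)) < e" using reals_Archimedean by blast
  define n where "n = Suc k"
  define A where "A i = {x. real i \<le> real n * f x}" for i
  have A: "A i \<in> sets borel" for i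
    using f by (simp add: A_def)
  define g where "g x = (\<Sum>i\<in>{1..n}. indicator (A i) x) / real n" for x
  have g: "g x \<le> f x" "f x \<le> g x + 1 / real n" for x
  proof -
    have fl: "0 \<le> real n * f x" "real n * f x \<le> real n" using f01 by (auto simp: mult_left_le)
    have "(\<Sum>i\<in>{1..n}. indicator (A i) x :: real) = real (card {i\<in>{1..n}. x \<in> A i})"
      by (simp add: indicator_def if_distrib sum.If_cases Int_def)
    also have "{i\<in>{1..n}. x \<in> A i} = {1..nat \<lfloor>real n * f x\<rfloor>}"
      using fl by (auto simp: A_def le_nat_iff le_floor_iff intro: order_trans)
    finally have "(\<Sum>i\<in>{1..n}. indicator (A i) x :: real) = real_of_int \<lfloor>real n * f x\<rfloor>"
      using fl by simp
    then have "real n * g x = real_of_int \<lfloor>real n * f x\<rfloor>" by (simp add: g_def n_def)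
    then have "real n * g x \<le> real n * f x" "real n * f x \<le> real n * g x + 1" by linarith+
    moreover have "real n > 0" by (simp add: n_def)
    ultimately show "g x \<le> f x" "f x \<le> g x + 1 / real n" by (auto simp: field_simps)
  qed
  have g_meas: "g \<in> borel_measurable borel" using A by (simp add: g_def[abs_def])
  have g01: "\<bar>g x\<bar> \<le> 1" for x
  proof -
    have "0 \<le> g x" by (simp add: g_def sum_nonneg)
    then show ?thesis using g(1)[of x] f01(2)[of x] by linarith
  qed
  have int: "integrable M f" "integrable N f" "integrable M g" "integrable N g"
    using M N f f01 g_meas g01 by (auto intro!: integrable_bounded[where c = 1] simp: prob_borelD)
  have int_g: "(\<integral>x. g x \<partial>K) = (\<Sum>i\<in>{1..n}. measure K (A i)) / real n" if K: "prob_borel K" for K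
  proof -
    interpret prob_space K using K by (rule prob_borelD)
    have "integrable K (indicator (A i) :: _ \<Rightarrow> real)" for i
      using K A by (intro integrable_real_indicator) (auto simp: prob_borelD emeasure_eq_measure)
    then show ?thesis using K A by (simp add: g_def prob_borelD)
  qed
  interpret N: prob_space N using N by (rule prob_borelD)
  have "(\<integral>x. f x \<partial>M) - (\<integral>x. g x \<partial>M) \<le> 1 / real n"
  proof -
    interpret prob_space M using M by (rule prob_borelD)
    have "(\<integral>x. f x \<partial>M) \<le> (\<integral>x. g x + 1 / real n \<partial>M)"
      using g(2) int by (intro integral_mono) auto
    then show ?thesis using int by (simp add: prob_space)
  qed
  moreover have "(\<integral>x. g x \<partial>N) \<le> (\<integral>x. f x \<partial>N)"
    using g(1) int by (intro integral_mono) auto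
  moreover have "(\<integral>x. g x \<partial>M) - (\<integral>x. g x \<partial>N) \<le> tv_dist M N"
  proof -
    have "(\<Sum>i\<in>{1..n}. measure M (A i)) - (\<Sum>i\<in>{1..n}. measure N (A i)) \<le> (\<Sum>i\<in>{1..n}. tv_dist M N)"
      unfolding sum_subtractf[symmetric] using tv_dist_ge[OF M N A] by (intro sum_mono) (simp add: abs_le_iff)
    then show ?thesis unfolding int_g[OF M] int_g[OF N] diff_divide_distrib[symmetric]
      by (simp add: n_def field_simps)
  qed
  moreover have "1 / real n < e" using k by (simp add: n_def inverse_eq_divide)
  ultimately show "(\<integral>x. f x \<partial>M) - (\<integral>x. f x \<partial>N) \<le> tv_dist M N + e" by linarith
qed

text \<open>The factor \<open>2 * c\<close> is the length of the interval from \<open>-c\<close> to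
  \<open>c\<close>, which is rescaled to the unit interval.\<close>

lemma tv_dist_integral:
  assumes M: "prob_borel M" and N: "prob_borel N" and f: "f \<in> borel_measurable borel"
    and fc: "\<And>x. \<bar>f x :: real\<bar> \<le> c" and c: "c > 0"
  shows "\<bar>(\<integral>x. f x \<partial>M) - (\<integral>x. f x \<partial>N)\<bar> \<le> 2 * c * tv_dist M N"
proof -
  have le: "(\<integral>x. f x \<partial>M) - (\<integral>x. f x \<partial>N) \<le> 2 * c * tv_dist M N"
    if f: "f \<in> borel_measurable borel" and fc: "\<And>x. \<bar>f x\<bar> \<le> c" for f
  proof -
    define g where "g x = (f x + c) / (2 * c)" for x
    have g: "g \<in> borel_measurable borel" "0 \<le> g x" "g x \<le> 1" for x
      using f fc[of x] c by (auto simp: g_def[abs_def] abs_le_iff field_simps)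
    have f_eq: "f x = 2 * c * g x - c" for x using c by (simp add: g_def)
    have "(\<integral>x. f x \<partial>K) = 2 * c * (\<integral>x. g x \<partial>K) - c" if K: "prob_borel K" for K
    proof -
      interpret prob_space K using K by (rule prob_borelD)
      have "integrable K g"
        using K g by (intro integrable_bounded[where c = 1]) (auto simp: prob_borelD)
      then show ?thesis unfolding f_eq by (simp add: prob_space)
    qed
    then show ?thesis
      using tv_dist_integral_01[OF M N g] c M N by (simp add: right_diff_distrib[symmetric])
  qed
  have "(\<integral>x. - f x \<partial>M) - (\<integral>x. - f x \<partial>N) \<le> 2 * c * tv_dist M N"
    using f fc by (intro le) auto
  with le[OF f fc] show ?thesis by (simp add: abs_le_iff)
qed

section \<open>The uniform distribution and integrals over product measures\<close>

definition unif :: "real measure" where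
  "unif = density lborel (indicator {0<..<1})"

lemma emeasure_density_Ioo:
  assumes [measurable]: "B \<in> sets borel"
  shows "emeasure (density lborel (indicator {0<..<m::real})) B = emeasure lborel ({0<..<m} \<inter> B)"
  by (simp add: emeasure_density indicator_inter_arith[symmetric])

lemma prob_borel_unif: "prob_borel unif"
proof -
  have "emeasure unif UNIV = 1" by (simp add: unif_def emeasure_density_Ioo)
  then show ?thesis by (simp add: prob_borel_def unif_def prob_spaceI)
qed

lemmas unif_simps[simp] = prob_borelD(2,3)[OF prob_borel_unif]

lemma sets_pair_borel:
  "sets M = sets borel \<Longrightarrow> sets N = sets borel \<Longrightarrow> sets (M \<Otimes>\<^sub>M N) = sets (borel \<Otimes>\<^sub>M borel)"
  by (rule sets_pair_measure_cong)

lemma pair_prob_space_borel: "prob_borel M \<Longrightarrow> prob_borel N \<Longrightarrow> pair_prob_space M N"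
  by (simp add: prob_borelD pair_prob_space.intro pair_sigma_finite.intro prob_space_imp_sigma_finite)

lemma prob_space_pair_borel: "prob_borel M \<Longrightarrow> prob_borel N \<Longrightarrow> prob_space (M \<Otimes>\<^sub>M N)"
  by (simp add: prob_borelD prob_space_pair)

lemma integrable_pair_bounded:
  assumes "prob_borel M" "prob_borel N" "f \<in> borel_measurable (borel \<Otimes>\<^sub>M borel)" "\<And>p. \<bar>f p :: real\<bar> \<le> c"
  shows "integrable (M \<Otimes>\<^sub>M N) f"
proof -
  interpret prob_space "M \<Otimes>\<^sub>M N" using assms by (simp add: prob_space_pair_borel)
  show ?thesis
    using assms(3,4) by (intro integrable_const_bound[where B = c])
      (auto simp: measurable_cong_sets[OF sets_pair_borel[OF prob_borelD(2)[OF assms(1)] prob_borelD(2)[OF assms(2)]] refl])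
qed

lemma integral_pair_iterated:
  assumes "prob_borel M" "prob_borel N" "f \<in> borel_measurable (borel \<Otimes>\<^sub>M borel)" "\<And>p. \<bar>f p :: real\<bar> \<le> c"
  shows "(\<integral>p. f p \<partial>(M \<Otimes>\<^sub>M N)) = (\<integral>x. \<integral>y. f (x, y) \<partial>N \<partial>M)"
    and "(\<integral>p. f p \<partial>(M \<Otimes>\<^sub>M N)) = (\<integral>y. \<integral>x. f (x, y) \<partial>M \<partial>N)"
proof -
  interpret pair_prob_space M N using assms by (simp add: pair_prob_space_borel)
  note int = integrable_pair_bounded[OF assms]
  show "(\<integral>p. f p \<partial>(M \<Otimes>\<^sub>M N)) = (\<integral>x. \<integral>y. f (x, y) \<partial>N \<partial>M)" using integral_fst'[OF int] by simp
  show "(\<integral>p. f p \<partial>(M \<Otimes>\<^sub>M N)) = (\<integral>y. \<integral>x. f (x, y) \<partial>M \<partial>N)"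
    using integral_snd[of "\<lambda>x y. f (x, y)"] int by simp
qed

lemma integral_measurable_fst:
  assumes "prob_borel N" "f \<in> borel_measurable (borel \<Otimes>\<^sub>M borel)"
  shows "(\<lambda>x. \<integral>y. f (x, y) \<partial>N :: real) \<in> borel_measurable borel"
proof -
  interpret prob_space N using assms by (simp add: prob_borelD)
  have "(\<lambda>(x, y). f (x, y)) \<in> borel_measurable (borel \<Otimes>\<^sub>M N)"
    using assms(2) by (simp add: measurable_cong_sets[OF sets_pair_borel[OF refl prob_borelD(2)[OF assms(1)]] refl])
  then show ?thesis by (rule borel_measurable_lebesgue_integral)
qed

lemma integral_measurable_snd:
  assumes "prob_borel M" "f \<in> borel_measurable (borel \<Otimes>\<^sub>M borel)"
  shows "(\<lambda>y. \<integral>x. f (x, y) \<partial>M :: real) \<in> borel_measurable borel"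
  using integral_measurable_fst[OF assms(1), of "\<lambda>(y, x). f (x, y)"] measurable_pair_swap[OF assms(2)] by simp

text \<open>Holds for every bounded \<open>f\<close>, as a nonintegrable function has integral 0 by
  convention.\<close>

lemma abs_integral_le:
  assumes "prob_space M" "\<And>x. \<bar>f x :: real\<bar> \<le> c"
  shows "\<bar>\<integral>x. f x \<partial>M\<bar> \<le> c"
proof -
  interpret prob_space M by fact
  have c: "0 \<le> c" using assms(2) order_trans[OF abs_ge_zero] by blast
  show ?thesis
  proof (cases "integrable M f")
    case True
    have f: "f x \<le> c" "- c \<le> f x" for x using assms(2)[of x] by linarith+
    have "(\<integral>x. f x \<partial>M) \<le> (\<integral>x. c \<partial>M)" "(\<integral>x. - c \<partial>M) \<le> (\<integral>x. f x \<partial>M)"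
      using True f by (intro integral_mono; simp)+
    then show ?thesis by (simp add: prob_space)
  qed (use c in \<open>simp add: not_integrable_integral_eq\<close>)
qed

lemma tv_dist_integral_pair:
  assumes M: "prob_borel M" and N: "prob_borel N" and L: "prob_borel L"
    and f: "f \<in> borel_measurable (borel \<Otimes>\<^sub>M borel)"
    and fc: "\<And>x. \<bar>f x :: real\<bar> \<le> c" and c: "c > 0"
  shows "\<bar>(\<integral>p. f p \<partial>(M \<Otimes>\<^sub>M L)) - (\<integral>p. f p \<partial>(N \<Otimes>\<^sub>M L))\<bar> \<le> 2 * c * tv_dist M N"
  unfolding integral_pair_iterated(1)[OF M L f fc] integral_pair_iterated(1)[OF N L f fc]
  by (intro tv_dist_integral M N c integral_measurable_fst L f abs_integral_le prob_borelD(1)) (rule fc)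

text \<open>Integrand and measure vary together. Closeness in total variation replaces
  \<open>M n\<close> by \<open>N\<close> with an error uniform over integrands bounded by
  \<open>c\<close>, after which ordinary dominated convergence applies; weak convergence would not
  allow discontinuous integrands.\<close>

lemma tv_dominated_convergence_pair:
  assumes M: "\<And>n. prob_borel (M n)" and N: "prob_borel N" and L: "prob_borel L"
    and tv: "(\<lambda>n. tv_dist (M n) N) \<longlonglongrightarrow> 0"
    and f: "\<And>n. f n \<in> borel_measurable (borel \<Otimes>\<^sub>M borel)" "g \<in> borel_measurable (borel \<Otimes>\<^sub>M borel)"
    and c: "\<And>n p. \<bar>f n p :: real\<bar> \<le> c" "c > 0"
    and lim: "AE p in N \<Otimes>\<^sub>M L. (\<lambda>n. f n p) \<longlonglongrightarrow> g p"
  shows "(\<lambda>n. \<integral>p. f n p \<partial>(M n \<Otimes>\<^sub>M L)) \<longlonglongrightarrow> (\<integral>p. g p \<partial>(N \<Otimes>\<^sub>M L))"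
proof -
  interpret prob_space "N \<Otimes>\<^sub>M L" using N L by (rule prob_space_pair_borel)
  note cong = measurable_cong_sets[OF sets_pair_borel[OF prob_borelD(2)[OF N] prob_borelD(2)[OF L]] refl]
  have 1: "(\<lambda>n. \<integral>p. f n p \<partial>(N \<Otimes>\<^sub>M L)) \<longlonglongrightarrow> (\<integral>p. g p \<partial>(N \<Otimes>\<^sub>M L))"
    using f lim c by (intro integral_dominated_convergence[where w = "\<lambda>_. c"]) (auto simp: cong)
  have "(\<lambda>n. (\<integral>p. f n p \<partial>(M n \<Otimes>\<^sub>M L)) - (\<integral>p. f n p \<partial>(N \<Otimes>\<^sub>M L))) \<longlonglongrightarrow> 0"
  proof (rule Lim_null_comparison)
    show "\<forall>\<^sub>F n in sequentially. norm ((\<integral>p. f n p \<partial>(M n \<Otimes>\<^sub>M L)) - (\<integral>p. f n p \<partial>(N \<Otimes>\<^sub>M L))) \<le> 2 * c * tv_dist (M n) N"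
      unfolding real_norm_def using tv_dist_integral_pair[OF M N L f(1) c] by (intro always_eventually allI)
    show "(\<lambda>n. 2 * c * tv_dist (M n) N) \<longlonglongrightarrow> 0" using tendsto_mult_left[OF tv, of "2 * c"] by simp
  qed
  from tendsto_add[OF this 1] show ?thesis by simp
qed

lemma tv_dominated_convergence:
  assumes M: "\<And>n. prob_borel (M n)" and N: "prob_borel N"
    and tv: "(\<lambda>n. tv_dist (M n) N) \<longlonglongrightarrow> 0"
    and f: "\<And>n. f n \<in> borel_measurable borel" "g \<in> borel_measurable borel"
    and c: "\<And>n p. \<bar>f n p :: real\<bar> \<le> c" "c > 0"
    and lim: "AE x in N. (\<lambda>n. f n x) \<longlonglongrightarrow> g x"
  shows "(\<lambda>n. \<integral>x. f n x \<partial>M n) \<longlonglongrightarrow> (\<integral>x. g x \<partial>N)"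
proof -
  interpret prob_space N using N by (rule prob_borelD)
  note cong = measurable_cong_sets[OF prob_borelD(2)[OF N] refl]
  have 1: "(\<lambda>n. \<integral>x. f n x \<partial>N) \<longlonglongrightarrow> (\<integral>x. g x \<partial>N)"
    using f lim c by (intro integral_dominated_convergence[where w = "\<lambda>_. c"]) (auto simp: cong)
  have "(\<lambda>n. (\<integral>x. f n x \<partial>M n) - (\<integral>x. f n x \<partial>N)) \<longlonglongrightarrow> 0"
  proof (rule Lim_null_comparison)
    show "\<forall>\<^sub>F n in sequentially. norm ((\<integral>x. f n x \<partial>M n) - (\<integral>x. f n x \<partial>N)) \<le> 2 * c * tv_dist (M n) N"
      unfolding real_norm_def using tv_dist_integral[OF M N f(1) c] by (intro always_eventually allI)
    show "(\<lambda>n. 2 * c * tv_dist (M n) N) \<longlonglongrightarrow> 0" using tendsto_mult_left[OF tv, of "2 * c"] by simp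
  qed
  from tendsto_add[OF this 1] show ?thesis by simp
qed

lemma AE_pair_fst:
  assumes M: "prob_borel M" and L: "prob_borel L" and ae: "AE x in M. P x"
  shows "AE p in M \<Otimes>\<^sub>M L. P (fst p)"
proof -
  interpret L: prob_space L using L by (rule prob_borelD)
  from ae obtain N where N: "{x\<in>space M. \<not> P x} \<subseteq> N" "emeasure M N = 0" "N \<in> sets M"
    by (rule AE_E)
  have "N \<times> space L \<in> null_sets (M \<Otimes>\<^sub>M L)"
    using N by (auto simp: null_sets_def L.emeasure_pair_measure_Times)
  then show ?thesis by (rule AE_I') (use N in \<open>auto simp: space_pair_measure\<close>)
qed

text \<open>The probability integral transform for a finite measure. Without atoms the distribution
  function is continuous, so for \<open>a\<close> between 0 and the total mass the set where it is
  at most \<open>a\<close> is either empty, which forces \<open>a = 0\<close>, or a closed half-line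
  of mass exactly \<open>a\<close>.\<close>

lemma distr_cdf:
  fixes M :: "real measure"
  assumes M: "finite_measure M" "sets M = sets borel" and no_atoms: "\<And>x. measure M {x} = 0"
  shows "distr M borel (cdf M) = density lborel (indicator {0<..<measure M UNIV})"
proof -
  interpret finite_borel_measure M
    using M by (intro finite_borel_measure.intro finite_borel_measure_axioms.intro) auto
  have sp: "space M = UNIV" by (rule borel_UNIV)
  define m where "m = measure M UNIV"
  have cont: "isCont (cdf M) x" for x using isCont_cdf no_atoms by simp
  have meas: "cdf M \<in> borel_measurable M"
    using borel_measurable_mono[of "cdf M"] cdf_nondecreasing by (simp add: mono_def M(2) cong: measurable_cong_sets)
  have le_m: "cdf M x \<le> m" for x using cdf_bounded[of x] by (simp add: m_def sp)
  show ?thesis unfolding m_def[symmetric]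
  proof (rule measure_eqI_lessThan)
    interpret D: finite_measure "distr M borel (cdf M)" by (rule finite_measure_distr[OF meas])
    show "emeasure (distr M borel (cdf M)) {a<..} < \<infinity>" for a by (simp add: D.emeasure_eq_measure)
    fix a
    have "emeasure (distr M borel (cdf M)) {a<..} = emeasure M {x. a < cdf M x}"
      using meas by (subst emeasure_distr) (auto simp: sp vimage_def)
    also have "\<dots> = emeasure lborel ({0<..<m} \<inter> {a<..})"
    proof -
      consider "m \<le> a" | "a < 0" | "0 \<le> a" "a < m" by linarith
      then show ?thesis
      proof cases
        case 1
        then have "{x. a < cdf M x} = {}" "{0<..<m} \<inter> {a<..} = {}" using le_m by (auto simp: not_less intro: order_trans)
        then show ?thesis by simp
      next
        case 2
        then have "{x. a < cdf M x} = UNIV" "{0<..<m} \<inter> {a<..} = {0<..<m}" using cdf_nonneg by (auto intro: less_le_trans)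
        moreover have "emeasure M UNIV = ennreal m" by (simp add: m_def emeasure_eq_measure)
        moreover have "0 \<le> m" by (simp add: m_def)
        ultimately show ?thesis by simp
      next
        case 3
        define A where "A = {x. cdf M x \<le> a}"
        have A_cl: "closed A" unfolding A_def
          using cont by (intro closed_Collect_le continuous_at_imp_continuous_on) auto
        have "measure M A = a"
        proof (cases "A = {}")
          case True
          have "((\<lambda>x. cdf M x) \<longlongrightarrow> 0) at_bot" by (rule cdf_lim_at_bot)
          moreover have "\<forall>\<^sub>F x in at_bot. a \<le> cdf M x"
            using True by (intro always_eventually) (auto simp: A_def not_le intro: less_imp_le)
          ultimately have "a \<le> 0" by (intro tendsto_lowerbound[of "cdf M" 0 at_bot a]) auto
          then show ?thesis using 3 True by simp
        next
          case False
          have "\<exists>b. a < cdf M b"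
          proof (rule ccontr)
            assume "\<not> ?thesis"
            then have "\<forall>\<^sub>F x in at_top. cdf M x \<le> a" by (auto simp: not_less)
            from tendsto_upperbound[OF cdf_lim_at_top this] 3 show False by (simp add: m_def sp)
          qed
          then obtain b where b: "a < cdf M b" by blast
          have "x \<le> b" if "x \<in> A" for x
            using that b cdf_nondecreasing[of b x] by (force simp: A_def)
          then have bdd: "bdd_above A" by (rule bdd_aboveI)
          define s where "s = Sup A"
          have sA: "s \<in> A" unfolding s_def by (rule closed_contains_Sup[OF False bdd A_cl])
          have "A = {..s}"
            using sA cdf_nondecreasing cSup_upper[OF _ bdd] unfolding s_def[symmetric]
            by (auto simp: A_def intro: order_trans)
          have "cdf M s = a"
          proof (rule antisym)
            show "cdf M s \<le> a" using sA by (simp add: A_def)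
            have "a \<le> cdf M x" if "s < x" for x
              using cSup_upper[OF _ bdd, of x] that by (force simp: A_def s_def)
            then have "\<forall>\<^sub>F x in at_right s. a \<le> cdf M x" by (auto simp: eventually_at_filter)
            moreover have "(cdf M \<longlongrightarrow> cdf M s) (at_right s)"
              using cont[of s] by (auto simp: isCont_def intro: filterlim_at_split[THEN iffD1, THEN conjunct2])
            ultimately show "a \<le> cdf M s" by (intro tendsto_lowerbound[of "cdf M" _ "at_right s"]) auto
          qed
          then show ?thesis unfolding \<open>A = {..s}\<close> by (simp add: cdf_def)
        qed
        then have "measure M (UNIV - A) = m - a"
          using finite_measure_compl[of A] A_cl by (simp add: sp m_def M(2))
        moreover have "{x. a < cdf M x} = UNIV - A" by (auto simp: A_def)
        moreover have "{0<..<m} \<inter> {a<..} = {a<..<m}" using 3 by auto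
        ultimately show ?thesis using 3 by (simp add: emeasure_eq_measure)
      qed
    qed
    also have "\<dots> = emeasure (density lborel (indicator {0<..<m})) {a<..}"
      by (simp add: emeasure_density_Ioo)
    finally show "emeasure (distr M borel (cdf M)) {a<..} = emeasure (density lborel (indicator {0<..<m})) {a<..}" .
  qed auto
qed

text \<open>Membership in the sets of a countable base is read as a ternary expansion with digits 0
  and 1. In base 3 everything after the first differing digit amounts to at most half of that digit,
  so the expansions differ. Injectivity carries the absence of atoms over to the image on the
  line.\<close>

lemma borel_injection_real:
  "\<exists>f :: 'a::{second_countable_topology, t0_space} \<Rightarrow> real. f \<in> borel_measurable borel \<and> inj f"
proof -
  obtain B :: "'a set set" where B: "countable B" "topological_basis B"
    using ex_countable_basis by blast
  have ne: "B \<noteq> {}" using topological_basisE[OF B(2) open_UNIV, of undefined] by auto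
  define U where "U = from_nat_into B"
  have U_open: "open (U n)" for n
    using topological_basis_open[OF B(2)] from_nat_into[OF ne] by (simp add: U_def)
  have sep: "\<exists>n. (x \<in> U n) \<noteq> (y \<in> U n)" if "x \<noteq> y" for x y :: 'a
  proof -
    obtain V where V: "open V" "(x \<in> V) \<noteq> (y \<in> V)" using \<open>x \<noteq> y\<close> separation_t0[of x y] by auto
    have *: "\<exists>n. (x \<in> U n) \<noteq> (y \<in> U n)" if V: "open V" "x \<in> V" "y \<notin> V" for x y :: 'a and V
    proof -
      obtain C where C: "C \<in> B" "x \<in> C" "C \<subseteq> V" using topological_basisE[OF B(2) V(1,2)] by metis
      then obtain n where "U n = C" unfolding U_def using from_nat_into_surj[OF B(1)] by blast
      with C V show ?thesis by blast
    qed
    show ?thesis using V *[of V x y] *[of V y x] by blast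
  qed
  define f where "f x = (\<Sum>n. (1/3)^n * indicator (U n) x :: real)" for x
  have geo: "summable (\<lambda>n. (1/3::real)^n)" by (simp add: summable_geometric)
  have summ: "summable (\<lambda>n. (1/3)^n * indicator (U n) x :: real)" for x
    by (rule summable_comparison_test'[OF geo, of 0]) (auto simp: indicator_def)
  have "inj f"
  proof (rule injI, rule ccontr)
    fix x y assume eq: "f x = f y" and "x \<noteq> y"
    define d where "d n = (indicator (U n) x - indicator (U n) y :: real)" for n
    define n where "n = (LEAST n. d n \<noteq> 0)"
    obtain n' where "(x \<in> U n') \<noteq> (y \<in> U n')" using sep[OF \<open>x \<noteq> y\<close>] by blast
    then have "d n' \<noteq> 0" by (cases "x \<in> U n'") (auto simp: d_def)
    then have dn: "d n \<noteq> 0" unfolding n_def by (rule LeastI)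
    have dl: "d i = 0" if "i < n" for i using not_less_Least that unfolding n_def by blast
    have d1: "\<bar>d i\<bar> \<le> 1" for i by (auto simp: d_def indicator_def)
    have dn1: "\<bar>d n\<bar> = 1" using dn by (auto simp: d_def indicator_def split: if_splits)
    have s: "summable (\<lambda>n. (1/3)^n * d n)"
      using summable_diff[OF summ[of x] summ[of y]] by (simp add: d_def right_diff_distrib)
    have "0 = (\<Sum>n. (1/3)^n * d n)"
      using suminf_diff[OF summ[of x] summ[of y]] eq by (simp add: f_def d_def right_diff_distrib)
    also have "\<dots> = (\<Sum>i. (1/3)^(i + Suc n) * d (i + Suc n)) + (\<Sum>i<Suc n. (1/3)^i * d i)"
      by (rule suminf_split_initial_segment[OF s])
    also have "(\<Sum>i<Suc n. (1/3)^i * d i) = (1/3)^n * d n" by (simp add: dl)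
    finally have "\<bar>(1/3)^n * d n\<bar> = \<bar>\<Sum>i. (1/3)^(i + Suc n) * d (i + Suc n)\<bar>"
      by linarith
    then have 1: "(1/3)^n * \<bar>d n\<bar> = \<bar>\<Sum>i. (1/3)^(i + Suc n) * d (i + Suc n)\<bar>"
      by (simp add: abs_mult)
    have tail: "summable (\<lambda>i. (1/3::real)^(i + Suc n))" using geo by (subst summable_iff_shift)
    have d_le: "norm ((1/3)^j * d j) \<le> (1/3::real)^j" for j
      using mult_left_le[OF d1[of j], of "(1/3)^j"] by (simp add: abs_mult)
    have "\<bar>\<Sum>i. (1/3)^(i + Suc n) * d (i + Suc n)\<bar> \<le> (\<Sum>i. (1/3::real)^(i + Suc n))"
      unfolding real_norm_def[symmetric] by (rule norm_suminf_le[OF d_le tail])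
    also have "\<dots> = (1/3)^Suc n * (\<Sum>i. (1/3::real)^i)"
      using suminf_mult[OF geo, of "(1/3)^Suc n"] by (simp add: power_add mult.commute)
    also have "(\<Sum>i. (1/3::real)^i) = 3/2" by (subst suminf_geometric) auto
    finally show False using 1 dn1 by simp
  qed
  moreover have "f \<in> borel_measurable borel"
    unfolding f_def[abs_def] using U_open by (intro borel_measurable_suminf borel_measurable_times) auto
  ultimately show ?thesis by blast
qed

text \<open>A point is sent to the number of the first member of a dense sequence at distance less
  than half the mesh, so two points of one cell are less than the mesh apart.\<close>

lemma small_cells_exist:
  "\<exists>cell :: nat \<Rightarrow> 'a::{second_countable_topology, metric_space} \<Rightarrow> nat.
    (\<forall>m. cell m \<in> borel \<rightarrow>\<^sub>M count_space UNIV) \<and> (\<forall>m x y. cell m x = cell m y \<longrightarrow> dist x y < (1/2)^m)"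
proof -
  obtain D :: "'a set" where D: "countable D" "\<And>X. open X \<Longrightarrow> X \<noteq> {} \<Longrightarrow> \<exists>d\<in>D. d \<in> X"
    using countable_dense_setE by blast
  have "D \<noteq> {}" using D(2)[of UNIV] by auto
  define q where "q = from_nat_into D"
  define cell where "cell m x = (LEAST l. dist x (q l) < (1/2)^m / 2)" for m x
  have near: "dist x (q (cell m x)) < (1/2)^m / 2" for m x
  proof -
    have "ball x ((1/2)^m / 2) \<noteq> {}" by (simp add: ball_eq_empty not_le)
    from D(2)[OF open_ball this] obtain d where "d \<in> D" "d \<in> ball x ((1/2)^m / 2)" by blast
    moreover obtain l where "q l = d"
      using from_nat_into_surj[OF D(1) \<open>d \<in> D\<close>] by (auto simp: q_def)
    ultimately have "dist x (q l) < (1/2)^m / 2" by simp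
    then show ?thesis unfolding cell_def by (rule LeastI)
  qed
  have "dist x y < (1/2)^m" if "cell m x = cell m y" for m x y
    using near[of x m] near[of y m] dist_triangle2[of x y "q (cell m y)"] unfolding that by linarith
  moreover have "cell m \<in> borel \<rightarrow>\<^sub>M count_space UNIV" for m
    unfolding cell_def[abs_def] by measurable
  ultimately show ?thesis by blast
qed

lemma radon_measure_polish:
  fixes M :: "'a::{second_countable_topology, complete_space} measure"
  assumes "sets M = sets borel" "finite_measure M"
  shows "radon_measure M"
  unfolding radon_measure_def
proof (intro conjI assms ballI allI impI)
  interpret finite_measure M by fact
  fix B :: "'a set" and e :: real assume B: "B \<in> sets borel" and e: "e > 0"
  show "\<exists>K. compact K \<and> K \<subseteq> B \<and> measure M (B - K) < e"
  proof (cases "measure M B < e")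
    case False
    have "ennreal (measure M B - e) < emeasure M B"
      using e False by (simp add: emeasure_eq_measure ennreal_less_iff)
    also have "emeasure M B = (SUP K\<in>{K. K \<subseteq> B \<and> compact K}. emeasure M K)"
      using inner_regular[OF assms(1) _ B] by simp
    finally obtain K where K: "K \<subseteq> B" "compact K" "ennreal (measure M B - e) < emeasure M K"
      by (auto simp: less_SUP_iff)
    then have "measure M B - e < measure M K" using False by (simp add: emeasure_eq_measure ennreal_less_iff)
    moreover have "measure M (B - K) = measure M B - measure M K"
      using K B assms by (intro finite_measure_Diff) (auto simp: borel_closed compact_imp_closed)
    ultimately show ?thesis using K by auto
  qed (auto intro!: exI[of _ "{}"])
qed

section \<open>Comparing the costs of couplings that agree on the cells of a partition\<close>

definition slice :: "('a \<Rightarrow> nat) \<Rightarrow> nat \<Rightarrow> ('a::topological_space \<times> 'b::topological_space) measure \<Rightarrow> 'b measure" where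
  "slice k i \<sigma> = distr (density \<sigma> (indicator (k -` {i} \<times> UNIV))) borel snd"

lemma sets_slice[simp]: "sets (slice k i \<sigma>) = sets borel" by (simp add: slice_def)

lemma times_borel:
  assumes "A \<in> sets borel" "B \<in> sets borel"
  shows "A \<times> B \<in> sets (borel :: ('a::topological_space \<times> 'b::topological_space) measure)"
proof -
  have "fst \<in> borel_measurable (borel :: ('a \<times> 'b) measure)" "snd \<in> borel_measurable (borel :: ('a \<times> 'b) measure)"
    by (auto intro!: borel_measurable_continuous_onI continuous_intros)
  from this[THEN measurable_sets] assms have "fst -` A \<inter> snd -` B \<in> sets (borel :: ('a \<times> 'b) measure)"
    by auto
  also have "fst -` A \<inter> snd -` B = A \<times> B" by auto
  finally show ?thesis .
qed

lemma count_space_vimage: "k \<in> borel \<rightarrow>\<^sub>M count_space UNIV \<Longrightarrow> k -` {i} \<in> sets borel"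
  using measurable_sets[of k borel "count_space UNIV" "{i}"] by simp

lemma borel_measurable_fst_snd:
  "fst \<in> borel_measurable (borel :: ('a::topological_space \<times> 'b::topological_space) measure)"
  "snd \<in> borel_measurable (borel :: ('a::topological_space \<times> 'b::topological_space) measure)"
  by (auto intro!: borel_measurable_continuous_onI continuous_intros)

lemma nn_integral_slice:
  assumes s: "sets \<sigma> = sets borel" and k: "k \<in> borel \<rightarrow>\<^sub>M count_space UNIV" and f: "f \<in> borel_measurable borel"
  shows "(\<integral>\<^sup>+y. f y \<partial>slice k i \<sigma>) = (\<integral>\<^sup>+p. indicator (k -` {i} \<times> UNIV) p * f (snd p) \<partial>\<sigma>)"
proof -
  have sn: "snd \<in> borel_measurable \<sigma>" using borel_measurable_fst_snd(2) by (simp add: measurable_cong_sets[OF s refl])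
  have A: "k -` {i} \<times> UNIV \<in> sets \<sigma>" unfolding s using k by (intro times_borel count_space_vimage) auto
  have "(\<integral>\<^sup>+y. f y \<partial>slice k i \<sigma>) = (\<integral>\<^sup>+p. f (snd p) \<partial>density \<sigma> (indicator (k -` {i} \<times> UNIV)))"
    unfolding slice_def using sn f by (subst nn_integral_distr) (auto)
  also have "\<dots> = (\<integral>\<^sup>+p. indicator (k -` {i} \<times> UNIV) p * f (snd p) \<partial>\<sigma>)"
    using sn f A by (subst nn_integral_density) (auto intro: measurable_compose)
  finally show ?thesis .
qed

lemma emeasure_slice:
  assumes s: "sets \<sigma> = sets borel" and k: "k \<in> borel \<rightarrow>\<^sub>M count_space UNIV" and E: "E \<in> sets borel"
  shows "emeasure (slice k i \<sigma>) E = emeasure \<sigma> (k -` {i} \<times> E)"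
proof -
  have "emeasure (slice k i \<sigma>) E = (\<integral>\<^sup>+y. indicator E y \<partial>slice k i \<sigma>)" using E by simp
  also have "\<dots> = (\<integral>\<^sup>+p. indicator (k -` {i} \<times> E) p \<partial>\<sigma>)"
    unfolding nn_integral_slice[OF s k borel_measurable_indicator[OF E]]
    by (intro nn_integral_cong) (auto simp: indicator_def)
  also have "\<dots> = emeasure \<sigma> (k -` {i} \<times> E)"
    using E k by (intro nn_integral_indicator) (auto simp: s intro!: times_borel count_space_vimage)
  finally show ?thesis .
qed

text \<open>Both costs are compared with that of the function obtained from \<open>g\<close> by freezing the first
  variable in each cell, for which they coincide.\<close>

lemma coupling_cost_le:
  fixes \<sigma> \<sigma>' :: "('a::topological_space \<times> 'b::topological_space) measure"
  assumes s: "sets \<sigma> = sets borel" "sets \<sigma>' = sets borel"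
    and mass: "emeasure \<sigma> UNIV \<le> 1" "emeasure \<sigma>' UNIV \<le> 1"
    and k: "k \<in> borel \<rightarrow>\<^sub>M count_space (UNIV :: nat set)"
    and agree: "\<And>i E. E \<in> sets borel \<Longrightarrow> emeasure \<sigma> (k -` {i} \<times> E) = emeasure \<sigma>' (k -` {i} \<times> E)"
    and A: "A \<in> sets borel" "emeasure \<sigma> (A \<times> UNIV) \<le> ennreal \<alpha>" "emeasure \<sigma>' (A \<times> UNIV) \<le> ennreal \<alpha>"
    and S: "S \<in> sets borel" "emeasure \<sigma> (UNIV \<times> S) \<le> ennreal \<beta>" "emeasure \<sigma>' (UNIV \<times> S) \<le> ennreal \<beta>"
    and g: "g \<in> borel_measurable borel" "\<And>p. 0 \<le> g p" "\<And>p. g p \<le> B"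
    and osc: "\<And>x x' y. x \<notin> A \<Longrightarrow> y \<notin> S \<Longrightarrow> k x = k x' \<Longrightarrow> \<bar>g (x, y) - g (x', y)\<bar> \<le> \<eta>"
    and nonneg: "0 \<le> \<alpha>" "0 \<le> \<beta>" "0 \<le> \<eta>"
  shows "(\<integral>\<^sup>+p. ennreal (g p) \<partial>\<sigma>') \<le> (\<integral>\<^sup>+p. ennreal (g p) \<partial>\<sigma>) + ennreal (2 * (\<eta> + B * (\<alpha> + \<beta>)))"
proof -
  have B: "0 \<le> B" using g(2,3) order_trans by blast
  \<comment> \<open>The representative avoids \<open>A\<close> whenever the cell is not contained in
    \<open>A\<close>; thus \<open>osc\<close> applies to it against every point of the cell outside
    \<open>A\<close>. In the other cells any value will do, the error being absorbed by
    \<open>B\<close> times the indicator of \<open>A\<close>.\<close>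
  define rep where "rep i = (if \<exists>x. k x = i \<and> x \<notin> A then SOME x. k x = i \<and> x \<notin> A else SOME x. True)" for i
  define gh where "gh p = g (rep (k (fst p)), snd p)" for p
  define err where "err p = \<eta> + B * indicator (A \<times> UNIV) p + B * indicator (UNIV \<times> S) p" for p :: "'a \<times> 'b"
  have err0: "0 \<le> err p" for p using B nonneg by (auto simp: err_def)
  have close: "\<bar>g p - gh p\<bar> \<le> err p" for p
  proof (cases "fst p \<in> A \<or> snd p \<in> S")
    case True
    have "\<bar>g p - gh p\<bar> \<le> B"
      using g(2)[of p] g(3)[of p] g(2)[of "(rep (k (fst p)), snd p)"] g(3)[of "(rep (k (fst p)), snd p)"]
      unfolding gh_def by linarith
    then show ?thesis using True B nonneg by (cases p) (auto simp: err_def indicator_def)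
  next
    case False
    then have ex: "\<exists>x. k x = k (fst p) \<and> x \<notin> A" by blast
    have "k (rep (k (fst p))) = k (fst p)" "rep (k (fst p)) \<notin> A"
      using someI_ex[OF ex] ex by (auto simp: rep_def)
    then have "\<bar>g (rep (k (fst p)), snd p) - g (fst p, snd p)\<bar> \<le> \<eta>" using False by (intro osc) auto
    then show ?thesis using False by (cases p) (auto simp: err_def gh_def abs_minus_commute)
  qed
  have g_y: "(\<lambda>y. g (x, y)) \<in> borel_measurable borel" for x
    by (rule measurable_compose[OF _ g(1)]) (auto intro!: borel_measurable_continuous_onI continuous_intros)
  have gh_sum: "(\<integral>\<^sup>+p. ennreal (gh p) \<partial>\<rho>) = (\<Sum>i. \<integral>\<^sup>+y. ennreal (g (rep i, y)) \<partial>slice k i \<rho>)"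
    if s: "sets \<rho> = sets borel" for \<rho>
  proof -
    have A: "k -` {i} \<times> UNIV \<in> sets \<rho>" for i unfolding s using k by (intro times_borel count_space_vimage) auto
    have sn: "snd \<in> borel_measurable \<rho>" using borel_measurable_fst_snd(2) by (simp add: measurable_cong_sets[OF s refl])
    have "ennreal (gh p) = (\<Sum>i. indicator (k -` {i} \<times> UNIV) p * ennreal (g (rep i, snd p)))" for p
    proof -
      have "(\<lambda>i. indicator (k -` {i} \<times> UNIV) p * ennreal (g (rep i, snd p))) sums
          (\<Sum>i\<in>{k (fst p)}. indicator (k -` {i} \<times> UNIV) p * ennreal (g (rep i, snd p)))"
        by (rule sums_finite) (auto simp: indicator_def split: prod.splits)
      then show ?thesis by (simp add: sums_iff gh_def indicator_def mem_Times_iff)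
    qed
    then have "(\<integral>\<^sup>+p. ennreal (gh p) \<partial>\<rho>) =
        (\<Sum>i. \<integral>\<^sup>+p. indicator (k -` {i} \<times> UNIV) p * ennreal (g (rep i, snd p)) \<partial>\<rho>)"
      using A sn g_y by (simp add: nn_integral_suminf measurable_compose[OF sn])
    then show ?thesis using g_y by (simp add: nn_integral_slice[OF s k])
  qed
  have "slice k i \<sigma> = slice k i \<sigma>'" for i
    by (rule measure_eqI) (simp_all add: emeasure_slice s k agree)
  then have gh_eq: "(\<integral>\<^sup>+p. ennreal (gh p) \<partial>\<sigma>) = (\<integral>\<^sup>+p. ennreal (gh p) \<partial>\<sigma>')"
    by (simp add: gh_sum s)
  have gh_meas: "gh \<in> borel_measurable borel"
  proof -
    have "(\<lambda>p. (\<lambda>i p. g (rep i, snd p)) (k (fst p)) p) \<in> borel_measurable borel"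
    proof (rule measurable_compose_countable)
      show "(\<lambda>p. g (rep i, snd p)) \<in> borel_measurable borel" for i
        by (rule measurable_compose[OF borel_measurable_fst_snd(2) g_y])
      show "(\<lambda>p. k (fst p)) \<in> borel \<rightarrow>\<^sub>M count_space UNIV"
        by (rule measurable_compose[OF borel_measurable_fst_snd(1) k])
    qed
    then show ?thesis by (simp add: gh_def[abs_def])
  qed
  have AS: "A \<times> UNIV \<in> sets borel" "UNIV \<times> S \<in> sets borel"
    using A(1) S(1) by (auto intro!: times_borel)
  have err_meas: "err \<in> borel_measurable borel"
    unfolding err_def[abs_def] using AS by measurable
  have err_le: "(\<integral>\<^sup>+p. ennreal (err p) \<partial>\<rho>) \<le> ennreal (\<eta> + B * (\<alpha> + \<beta>))"
    if "sets \<rho> = sets borel" "emeasure \<rho> UNIV \<le> 1" "emeasure \<rho> (A \<times> UNIV) \<le> ennreal \<alpha>"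
      "emeasure \<rho> (UNIV \<times> S) \<le> ennreal \<beta>" for \<rho> :: "('a \<times> 'b) measure"
  proof -
    have sp: "space \<rho> = UNIV" using sets_eq_imp_space_eq[OF that(1)] by simp
    have "(\<integral>\<^sup>+p. ennreal (err p) \<partial>\<rho>) =
        (\<integral>\<^sup>+p. ennreal \<eta> + ennreal B * indicator (A \<times> UNIV) p + ennreal B * indicator (UNIV \<times> S) p \<partial>\<rho>)"
      using B nonneg by (intro nn_integral_cong) (auto simp: err_def indicator_def)
    also have "\<dots> = ennreal \<eta> * emeasure \<rho> UNIV + ennreal B * emeasure \<rho> (A \<times> UNIV) + ennreal B * emeasure \<rho> (UNIV \<times> S)"
    proof -
      have [measurable]: "A \<times> UNIV \<in> sets \<rho>" "UNIV \<times> S \<in> sets \<rho>" using AS that(1) by simp_all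
      show ?thesis by (simp add: nn_integral_add nn_integral_cmult_indicator sp)
    qed
    also have "\<dots> \<le> ennreal \<eta> * 1 + ennreal B * ennreal \<alpha> + ennreal B * ennreal \<beta>"
      using that by (intro add_mono mult_left_mono) auto
    also have "\<dots> = ennreal (\<eta> + B * (\<alpha> + \<beta>))"
      using B nonneg by (simp add: ennreal_mult[symmetric] ennreal_plus[symmetric] distrib_left del: ennreal_plus)
    finally show ?thesis .
  qed
  have meas: "(\<lambda>p. ennreal (f p)) \<in> borel_measurable \<rho>" if "sets \<rho> = sets borel" "f \<in> borel_measurable borel" for f \<rho>
    using that by (simp add: measurable_cong_sets[OF that(1) refl])
  have "(\<integral>\<^sup>+p. ennreal (g p) \<partial>\<sigma>') \<le> (\<integral>\<^sup>+p. ennreal (gh p) + ennreal (err p) \<partial>\<sigma>')"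
  proof (rule nn_integral_mono)
    fix p
    have "g p \<le> gh p + err p" using close[of p] by linarith
    then have "ennreal (g p) \<le> ennreal (gh p + err p)" by (rule ennreal_leI)
    also have "\<dots> = ennreal (gh p) + ennreal (err p)"
      using err0 g(2) by (intro ennreal_plus) (auto simp: gh_def)
    finally show "ennreal (g p) \<le> ennreal (gh p) + ennreal (err p)" .
  qed
  also have "\<dots> = (\<integral>\<^sup>+p. ennreal (gh p) \<partial>\<sigma>) + (\<integral>\<^sup>+p. ennreal (err p) \<partial>\<sigma>')"
    unfolding gh_eq using meas s(2) gh_meas err_meas by (intro nn_integral_add) auto
  also have "(\<integral>\<^sup>+p. ennreal (gh p) \<partial>\<sigma>) \<le> (\<integral>\<^sup>+p. ennreal (g p) + ennreal (err p) \<partial>\<sigma>)"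
  proof (rule nn_integral_mono)
    fix p
    have "gh p \<le> g p + err p" using close[of p] by linarith
    then have "ennreal (gh p) \<le> ennreal (g p + err p)" by (rule ennreal_leI)
    also have "\<dots> = ennreal (g p) + ennreal (err p)"
      using err0 g(2) by (intro ennreal_plus) (auto simp: gh_def)
    finally show "ennreal (gh p) \<le> ennreal (g p) + ennreal (err p)" .
  qed
  also have "\<dots> = (\<integral>\<^sup>+p. ennreal (g p) \<partial>\<sigma>) + (\<integral>\<^sup>+p. ennreal (err p) \<partial>\<sigma>)"
    using meas s(1) g(1) err_meas by (intro nn_integral_add) auto
  finally have "(\<integral>\<^sup>+p. ennreal (g p) \<partial>\<sigma>') \<le>
      (\<integral>\<^sup>+p. ennreal (g p) \<partial>\<sigma>) + ((\<integral>\<^sup>+p. ennreal (err p) \<partial>\<sigma>) + (\<integral>\<^sup>+p. ennreal (err p) \<partial>\<sigma>'))"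
    by (simp add: add.assoc)
  also have "\<dots> \<le> (\<integral>\<^sup>+p. ennreal (g p) \<partial>\<sigma>) + (ennreal (\<eta> + B * (\<alpha> + \<beta>)) + ennreal (\<eta> + B * (\<alpha> + \<beta>)))"
    using err_le[OF s(1) mass(1) A(2) S(2)] err_le[OF s(2) mass(2) A(3) S(3)] by (intro add_mono) auto
  also have "ennreal (\<eta> + B * (\<alpha> + \<beta>)) + ennreal (\<eta> + B * (\<alpha> + \<beta>)) = ennreal (2 * (\<eta> + B * (\<alpha> + \<beta>)))"
    using B nonneg by (subst ennreal_plus[symmetric]) auto
  finally show ?thesis .
qed

text \<open>The Radon-Nikodym derivatives sum to at most 1 almost everywhere, since on the set where
  they exceed 1 their integrals would violate \<open>le\<close>. They are replaced by 0 on the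
  exceptional null set, so that the bound holds at every point.\<close>

lemma subprobability_densities:
  assumes N: "prob_borel N" and s: "\<And>i. i < K \<Longrightarrow> sets (n i) = sets borel"
    and le: "\<And>E. E \<in> sets borel \<Longrightarrow> (\<Sum>i<K. emeasure (n i) E) \<le> emeasure N E"
  obtains v :: "nat \<Rightarrow> 'a::topological_space \<Rightarrow> real" where
    "\<And>i. v i \<in> borel_measurable borel" "\<And>i y. 0 \<le> v i y" "\<And>y. (\<Sum>i<K. v i y) \<le> 1"
    "\<And>i. i < K \<Longrightarrow> n i = density N (\<lambda>y. ennreal (v i y))"
proof -
  interpret N: prob_space N using N by (rule prob_borelD)
  note sN = prob_borelD(2)[OF N]
  define f where "f i = RN_deriv N (n i)" for i
  have f_meas[measurable]: "f i \<in> borel_measurable borel" for i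
    using borel_measurable_RN_deriv[of N "n i"] by (simp add: f_def measurable_cong_sets[OF sN refl])
  have n_le: "emeasure (n i) E \<le> emeasure N E" if "i < K" "E \<in> sets borel" for i E
    using le[OF that(2)] member_le_sum[of i "{..<K}" "\<lambda>i. emeasure (n i) E"] that by (auto intro: order_trans)
  have f_dens: "density N (f i) = n i" if i: "i < K" for i
    unfolding f_def
  proof (rule N.density_RN_deriv)
    show "absolutely_continuous N (n i)"
      unfolding absolutely_continuous_def
    proof
      fix E assume "E \<in> null_sets N"
      then show "E \<in> null_sets (n i)" using n_le[OF i, of E] s[OF i] sN by (auto simp: null_sets_def)
    qed
    show "sets (n i) = sets N" using s[OF i] sN by simp
  qed
  define g where "g y = (\<Sum>i<K. f i y)" for y
  have g_meas[measurable]: "g \<in> borel_measurable borel" unfolding g_def[abs_def] by measurable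
  have g_meas_N: "g \<in> borel_measurable N" using g_meas by (simp add: measurable_cong_sets[OF sN refl])
  have AE_g: "AE y in N. g y \<le> 1"
  proof (rule ccontr)
    assume not: "\<not> (AE y in N. g y \<le> 1)"
    define E where "E = {y. 1 < g y}"
    have E: "E \<in> sets borel" unfolding E_def by measurable
    have "(\<integral>\<^sup>+y. indicator E y \<partial>N) < (\<integral>\<^sup>+y. g y * indicator E y \<partial>N)"
    proof (rule nn_integral_less)
      show "indicator E \<in> borel_measurable N" "(\<lambda>y. g y * indicator E y) \<in> borel_measurable N"
      proof -
        have [measurable]: "E \<in> sets N" using E sN by simp
        note [measurable] = g_meas_N
        show "indicator E \<in> borel_measurable N" "(\<lambda>y. g y * indicator E y) \<in> borel_measurable N"
          by measurable
      qed
      show "integral\<^sup>N N (indicator E) \<noteq> \<infinity>" using E by (simp add: sN N.emeasure_eq_measure)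
      show "AE y in N. indicator E y \<le> g y * indicator E y"
        by (auto simp: E_def indicator_def less_imp_le)
      show "\<not> (AE y in N. g y * indicator E y \<le> indicator E y)"
      proof
        assume "AE y in N. g y * indicator E y \<le> indicator E y"
        then have "AE y in N. g y \<le> 1" 
        proof eventually_elim
          case (elim y)
          then show ?case by (cases "1 < g y") (auto simp: E_def)
        qed
        with not show False by blast
      qed
    qed
    also have "(\<integral>\<^sup>+y. g y * indicator E y \<partial>N) = (\<Sum>i<K. \<integral>\<^sup>+y. f i y * indicator E y \<partial>N)"
      unfolding g_def sum_distrib_right
    proof (rule nn_integral_sum)
      have [measurable]: "E \<in> sets N" using E sN by simp
      have [measurable]: "f i \<in> borel_measurable N" for i using f_meas by (simp add: measurable_cong_sets[OF sN refl])
      show "(\<lambda>y. f i y * indicator E y) \<in> borel_measurable N" for i by measurable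
    qed
    also have "\<dots> = (\<Sum>i<K. emeasure (n i) E)"
    proof (intro sum.cong refl)
      fix i assume "i \<in> {..<K}"
      then show "(\<integral>\<^sup>+y. f i y * indicator E y \<partial>N) = emeasure (n i) E"
        using emeasure_density[of "f i" N E] E f_dens[of i] by (simp add: sN measurable_cong_sets[OF sN refl])
    qed
    also have "\<dots> \<le> emeasure N E" by (rule le[OF E])
    also have "\<dots> = (\<integral>\<^sup>+y. indicator E y \<partial>N)" using E by (simp add: sN)
    finally show False by simp
  qed
  define v where "v i y = (if i < K \<and> g y \<le> 1 then enn2real (f i y) else 0)" for i y
  have v_f: "ennreal (v i y) = f i y" if "g y \<le> 1" "i < K" for i y
  proof -
    have "f i y \<le> g y" unfolding g_def using that by (intro member_le_sum) auto
    then have "f i y < \<infinity>" using that by (auto intro: le_less_trans[OF order_trans])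
    then show ?thesis using that by (simp add: v_def)
  qed
  show thesis
  proof (rule that)
    show "v i \<in> borel_measurable borel" for i unfolding v_def[abs_def] by measurable
    show "0 \<le> v i y" for i y by (simp add: v_def)
    show "(\<Sum>i<K. v i y) \<le> 1" for y
    proof (cases "g y \<le> 1")
      case True
      have "ennreal (\<Sum>i<K. v i y) = (\<Sum>i<K. f i y)"
        using v_f[OF True] by (subst sum_ennreal[symmetric]) (auto simp: v_def)
      also have "\<dots> \<le> ennreal 1" using True by (simp add: g_def)
      finally show ?thesis by (simp add: ennreal_le_iff2)
    qed (simp add: v_def)
    fix i assume i: "i < K"
    have "density N (f i) = density N (\<lambda>y. ennreal (v i y))"
    proof (rule density_cong)
      show "AE y in N. f i y = ennreal (v i y)" using AE_g by eventually_elim (simp add: v_f i)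
      have "v i \<in> borel_measurable borel" unfolding v_def[abs_def] by measurable
      then show "(\<lambda>y. ennreal (v i y)) \<in> borel_measurable N" by (simp add: measurable_cong_sets[OF sN refl])
    qed (simp add: measurable_cong_sets[OF sN refl])
    then show "n i = density N (\<lambda>y. ennreal (v i y))" using f_dens[OF i] by simp
  qed
qed

lemma compact_uniform_nbhd:
  fixes F :: "'a::metric_space \<Rightarrow> real"
  assumes F: "continuous_on UNIV F" and C: "compact C" and e: "e > 0"
  shows "\<exists>r>0. \<forall>z\<in>C. \<forall>z'. dist z z' < r \<longrightarrow> \<bar>F z' - F z\<bar> < e"
proof -
  define G where "G z = {z'. \<bar>F z' - F z\<bar> < e / 2}" for z
  have "open (G z)" for z
    unfolding G_def by (intro open_Collect_less continuous_intros F)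
  moreover have "z \<in> G z" for z using e by (simp add: G_def)
  then have "C \<subseteq> \<Union>(range G)" by blast
  ultimately obtain r where r: "0 < r" "\<And>z. z \<in> C \<Longrightarrow> \<exists>g\<in>range G. ball z r \<subseteq> g"
    using Heine_Borel_lemma[OF C, of "range G"] by (metis (no_types, lifting) rangeE)
  have "\<bar>F z' - F z\<bar> < e" if z: "z \<in> C" "dist z z' < r" for z z'
  proof -
    obtain w where "ball z r \<subseteq> G w" using r(2)[OF z(1)] by auto
    moreover have "z \<in> ball z r" "z' \<in> ball z r" using z r(1) by auto
    ultimately have "z \<in> G w" "z' \<in> G w" by blast+
    then have "\<bar>F z - F w\<bar> < e / 2" "\<bar>F z' - F w\<bar> < e / 2" by (auto simp: G_def)
    then show ?thesis by linarith
  qed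
  with r(1) show ?thesis by blast
qed

lemma tendsto_nhds_sequentially:
  fixes f :: "'a::metric_space \<Rightarrow> real"
  assumes "\<And>s. s \<longlonglongrightarrow> t \<Longrightarrow> (\<lambda>n. f (s n)) \<longlonglongrightarrow> f t"
  shows "(f \<longlongrightarrow> f t) (nhds t)"
proof -
  have "isCont f t" using assms by (simp add: continuous_at_sequentially o_def)
  then show ?thesis by (simp add: isCont_def tendsto_nhds_iff)
qed

text \<open>This is \<open>distr_cdf\<close> for the image on the line of the restriction of
  \<open>M\<close> to \<open>D\<close>. By injectivity each fibre of \<open>f\<close> has at most
  one point, and points have mass 0.\<close>

lemma distr_cdf_comp:
  fixes f :: "'a::t1_space \<Rightarrow> real"
  assumes M: "prob_borel M" "nonatomic M" and f[measurable]: "f \<in> borel_measurable borel" and inj: "inj f"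
    and D[measurable]: "D \<in> sets borel"
  shows "(\<lambda>x. measure M (D \<inter> f -` {..f x})) \<in> borel_measurable borel"
    "distr (density M (indicator D)) borel (\<lambda>x. measure M (D \<inter> f -` {..f x})) =
      density lborel (indicator {0<..<measure M D})"
proof -
  interpret M: prob_space M using M(1) by (rule prob_borelD)
  note sM = prob_borelD(2)[OF M(1)]
  have fM: "f \<in> borel_measurable (density M (indicator D))" using f by (simp add: measurable_cong_sets[OF sM refl])
  define N where "N = distr (density M (indicator D)) borel f"
  have vim: "f -` A \<in> sets borel" if "A \<in> sets borel" for A using measurable_sets[OF f that] by simp
  have em: "emeasure N A = emeasure M (D \<inter> f -` A)" if A: "A \<in> sets borel" for A
  proof -
    have DM: "D \<in> sets M" "f -` A \<in> sets M" using D vim[OF A] sM by simp_all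
    have "emeasure N A = emeasure (density M (indicator D)) (f -` A)"
      unfolding N_def using A by (subst emeasure_distr[OF fM]) (auto simp: prob_borelD(3)[OF M(1)])
    also have "\<dots> = (\<integral>\<^sup>+x. indicator D x * indicator (f -` A) x \<partial>M)"
      using DM by (intro emeasure_density) auto
    also have "\<dots> = (\<integral>\<^sup>+x. indicator (D \<inter> f -` A) x \<partial>M)" by (simp only: indicator_inter_arith)
    also have "\<dots> = emeasure M (D \<inter> f -` A)" using DM by (intro nn_integral_indicator) auto
    finally show ?thesis .
  qed
  have me: "measure N A = measure M (D \<inter> f -` A)" if "A \<in> sets borel" for A
    using em[OF that] by (simp add: measure_def)
  have sN: "sets N = sets borel" by (simp add: N_def)
  have fin: "finite_measure N"
    using em[of UNIV] by (intro finite_measureI) (simp add: sets_eq_imp_space_eq[OF sN] M.emeasure_eq_measure)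
  have na: "measure N {c} = 0" for c
  proof (cases "\<exists>x. f x = c")
    case True
    then obtain x where "f x = c" by blast
    then have "f -` {c} = {x}" using inj by (auto simp: inj_def)
    then have "measure M (D \<inter> f -` {c}) \<le> measure M {x}"
      using sM by (intro M.finite_measure_mono) auto
    also have "\<dots> = 0" using measure_singleton_eq_0[OF M(2) sM, of x] by (simp add: measure_def)
    finally show ?thesis by (simp add: me measure_le_0_iff)
  next
    case False
    then have "f -` {c} = {}" by auto
    then show ?thesis by (simp add: me)
  qed
  have cdf: "cdf N (f x) = measure M (D \<inter> f -` {..f x})" for x by (simp add: cdf_def me)
  have cdf_meas: "cdf N \<in> borel_measurable borel"
  proof -
    interpret finite_borel_measure N
      using fin sN by (intro finite_borel_measure.intro finite_borel_measure_axioms.intro) auto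
    show ?thesis using cdf_nondecreasing by (intro borel_measurable_mono) (simp add: mono_def)
  qed
  have "(\<lambda>x. cdf N (f x)) \<in> borel_measurable borel" using cdf_meas by measurable
  then show "(\<lambda>x. measure M (D \<inter> f -` {..f x})) \<in> borel_measurable borel" by (simp add: cdf)
  have "(\<lambda>x. measure M (D \<inter> f -` {..f x})) = cdf N \<circ> f" by (simp add: fun_eq_iff cdf)
  moreover have "distr N borel (cdf N) = distr (density M (indicator D)) borel (cdf N \<circ> f)"
    by (subst (1) N_def) (rule distr_distr[OF cdf_meas fM])
  ultimately have "distr (density M (indicator D)) borel (\<lambda>x. measure M (D \<inter> f -` {..f x})) = distr N borel (cdf N)"
    by simp
  also have "\<dots> = density lborel (indicator {0<..<measure M D})"
    using distr_cdf[OF fin sN na] by (simp add: me)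
  finally show "distr (density M (indicator D)) borel (\<lambda>x. measure M (D \<inter> f -` {..f x})) =
      density lborel (indicator {0<..<measure M D})" .
qed

lemma AE_density_indicator_iff:
  assumes "D \<in> sets M"
  shows "(AE x in density M (indicator D). P x) \<longleftrightarrow> (AE x in M. x \<in> D \<longrightarrow> P x)"
  using assms by (subst AE_density) (auto simp: indicator_def)

section \<open>Near-optimal plans depending continuously on the parameter\<close>

text \<open>The situation after truncation: \<open>B\<close> bounds the cost, and \<xi> is a fixed
  parametrization of \<nu> as delivered by \<open>skorokhod_parametrization\<close>.\<close>

locale monge_family =
  fixes \<mu> :: "'c::metric_space \<Rightarrow> 'a::polish_space measure"
    and \<nu> :: "'c \<Rightarrow> 'b::complete_space measure"
    and h :: "'a \<Rightarrow> 'b \<Rightarrow> 'c \<Rightarrow> real"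
    and B :: real
    and \<xi> :: "'c \<Rightarrow> real \<Rightarrow> 'b"
  assumes mu_radon: "\<And>t. \<mu> t \<in> radon_prob"
    and nu_radon: "\<And>t. \<nu> t \<in> radon_prob"
    and nu_weak: "\<And>f c. continuous_on UNIV f \<Longrightarrow> (\<And>y. \<bar>f y :: real\<bar> \<le> c) \<Longrightarrow>
      continuous_on UNIV (\<lambda>t. \<integral>y. f y \<partial>\<nu> t)"
    and mu_tv: "tv_continuous \<mu>"
    and mu_nonatomic: "\<And>t. nonatomic (\<mu> t)"
    and h_cont: "continuous_on UNIV (\<lambda>(x, y, t). h x y t)"
    and h0: "\<And>x y t. 0 \<le> h x y t"
    and hB: "\<And>x y t. h x y t \<le> B"
    and B1: "1 \<le> B"
    and xi_meas[measurable]: "\<And>t. \<xi> t \<in> borel_measurable borel"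
    and xi_law: "\<And>t. distr unif borel (\<xi> t) = \<nu> t"
    and xi_cont: "\<And>t. AE u in unif. isCont (\<lambda>(s, v). \<xi> s v) (t, u)"
begin

lemma mu: "prob_borel (\<mu> t)" and nu: "prob_borel (\<nu> t)"
  using mu_radon nu_radon by (auto intro: radon_prob_prob_borel)

lemma tv_nhds: "((\<lambda>s. tv_dist (\<mu> s) (\<mu> t)) \<longlongrightarrow> 0) (nhds t)"
proof -
  have "isCont (\<lambda>s. tv_dist (\<mu> s) (\<mu> t)) t"
    using mu_tv by (simp add: tv_continuous_def isCont_def tv_dist_self)
  then show ?thesis by (simp add: isCont_def tendsto_nhds_iff tv_dist_self)
qed

lemma tv_seq: "s \<longlonglongrightarrow> t \<Longrightarrow> (\<lambda>n. tv_dist (\<mu> (s n)) (\<mu> t)) \<longlonglongrightarrow> 0"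
  by (rule filterlim_compose[OF tv_nhds])

section \<open>Couplings encoded by densities\<close>

abbreviation PU :: "'c \<Rightarrow> ('a \<times> real) measure" where
  "PU t \<equiv> \<mu> t \<Otimes>\<^sub>M unif"

lemma sets_PU: "sets (PU t) = sets (borel \<Otimes>\<^sub>M borel)"
  by (intro sets_pair_borel prob_borelD(2) mu prob_borel_unif)

lemma measurable_PU: "f \<in> measurable (PU t) M \<longleftrightarrow> f \<in> measurable (borel \<Otimes>\<^sub>M borel) M"
  by (simp add: measurable_cong_sets[OF sets_PU refl])

lemma prob_space_PU: "prob_space (PU t)"
  by (intro prob_space_pair_borel mu prob_borel_unif)

definition H :: "'c \<Rightarrow> 'a \<times> real \<Rightarrow> real" where
  "H t p = h (fst p) (\<xi> t (snd p)) t"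

lemma h_meas: "(\<lambda>(x, y). h x y t) \<in> borel_measurable borel"
proof (rule borel_measurable_continuous_onI)
  have "continuous_on UNIV ((\<lambda>(x, y, t). h x y t) \<circ> (\<lambda>p. (fst p, snd p, t)))"
    by (intro continuous_on_compose continuous_intros continuous_on_subset[OF h_cont]) auto
  then show "continuous_on UNIV (\<lambda>(x, y). h x y t)" by (simp add: o_def case_prod_beta)
qed

lemma graph_meas: "(\<lambda>p :: 'a \<times> real. (fst p, \<xi> t (snd p))) \<in> borel_measurable (borel \<Otimes>\<^sub>M borel)"
proof -
  have "(\<lambda>p :: 'a \<times> real. (fst p, \<xi> t (snd p))) \<in> (borel \<Otimes>\<^sub>M borel) \<rightarrow>\<^sub>M (borel :: 'a measure) \<Otimes>\<^sub>M (borel :: 'b measure)"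
    by measurable
  moreover have "measurable M (borel :: ('a \<times> 'b) measure) = measurable M (borel \<Otimes>\<^sub>M borel)" for M :: "('a \<times> real) measure"
    by (rule measurable_cong_sets) (simp_all only: sets_borel_prod_second_countable)
  ultimately show ?thesis by simp
qed

lemma H_meas[measurable]: "H t \<in> borel_measurable (borel \<Otimes>\<^sub>M borel)"
  using measurable_compose[OF graph_meas h_meas] by (simp add: H_def[abs_def])

lemma H0: "0 \<le> H t p" and HB: "H t p \<le> B"
  by (simp_all add: H_def h0 hB)

lemma B0: "0 < B" using B1 by simp

lemma xi_tendsto:
  assumes "s \<longlonglongrightarrow> t" "isCont (\<lambda>(s, v). \<xi> s v) (t, u)" "v \<longlonglongrightarrow> u"
  shows "(\<lambda>n. \<xi> (s n) (v n)) \<longlonglongrightarrow> \<xi> t u"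
proof -
  have "(\<lambda>n. (s n, v n)) \<longlonglongrightarrow> (t, u)" using assms by (intro tendsto_Pair)
  from isCont_tendsto_compose[OF assms(2) this] show ?thesis by simp
qed

lemma h_tendsto:
  assumes "x \<longlonglongrightarrow> x0" "y \<longlonglongrightarrow> y0" "s \<longlonglongrightarrow> t"
  shows "(\<lambda>n. h (x n) (y n) (s n)) \<longlonglongrightarrow> h x0 y0 t"
proof -
  have "isCont (\<lambda>(x, y, t). h x y t) (x0, y0, t)" using h_cont by (simp add: continuous_on_eq_continuous_at)
  moreover have "(\<lambda>n. (x n, y n, s n)) \<longlonglongrightarrow> (x0, y0, t)" using assms by (intro tendsto_Pair)
  ultimately show ?thesis using isCont_tendsto_compose by fastforce
qed

text \<open>The exceptional set of \<open>u\<close> comes from \<xi> alone and so serves all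
  \<open>x\<close> at once. Hence \<open>u\<close> can be fixed while \<open>x\<close> is integrated
  against the moving measures \<open>\<mu> (s n)\<close>.\<close>

lemma AE_H_tendsto:
  assumes s: "s \<longlonglongrightarrow> t"
  shows "AE u in unif. \<forall>x. (\<lambda>n. H (s n) (x, u)) \<longlonglongrightarrow> H t (x, u)"
  using xi_cont[of t]
  by eventually_elim (auto simp: H_def intro!: h_tendsto xi_tendsto s)

text \<open>A coupling of \<open>\<mu> t\<close> and \<open>\<nu> t\<close> is encoded by a density \<open>W\<close> with respect to
  \<open>\<mu> t \<Otimes>\<^sub>M unif\<close>: its image under \<open>(x, u) \<mapsto> (x, \<xi> t u)\<close> is the coupling.\<close>

definition cost :: "'c \<Rightarrow> ('a \<times> real \<Rightarrow> real) \<Rightarrow> real" where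
  "cost t W = (\<integral>p. H t p * W p \<partial>PU t)"

definition dens :: "'c \<Rightarrow> ('a \<times> real \<Rightarrow> real) \<Rightarrow> real \<Rightarrow> real" where
  "dens t W u = (\<integral>x. W (x, u) \<partial>\<mu> t)"

definition coupling_of :: "'c \<Rightarrow> ('a \<times> real \<Rightarrow> real) \<Rightarrow> ('a \<times> 'b) measure" where
  "coupling_of t W = distr (density (PU t) (\<lambda>p. ennreal (W p))) borel (\<lambda>p. (fst p, \<xi> t (snd p)))"

text \<open>The bounds hold everywhere rather than almost everywhere: the reference measure moves
  with the parameter, and a null set of one \<open>PU t\<close> need not be null for
  another.\<close>

definition weight :: "('a \<times> real \<Rightarrow> real) \<Rightarrow> real \<Rightarrow> bool" where
  "weight W c \<longleftrightarrow> W \<in> borel_measurable (borel \<Otimes>\<^sub>M borel) \<and> (\<forall>p. 0 \<le> W p \<and> W p \<le> c)"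

lemma weightD:
  assumes "weight W c"
  shows "W \<in> borel_measurable (borel \<Otimes>\<^sub>M borel)" "0 \<le> W p" "W p \<le> c" "\<bar>W p\<bar> \<le> c" "0 \<le> c"
proof -
  have *: "W \<in> borel_measurable (borel \<Otimes>\<^sub>M borel)" "0 \<le> W p \<and> W p \<le> c" for p
    using assms unfolding weight_def by blast+
  show "W \<in> borel_measurable (borel \<Otimes>\<^sub>M borel)" "0 \<le> W p" "W p \<le> c" "\<bar>W p\<bar> \<le> c" "0 \<le> c"
    using * order_trans[of 0 "W p" c] by auto
qed

lemma sets_coupling_of[simp]: "sets (coupling_of t W) = sets borel" by (simp add: coupling_of_def)

lemma nn_integral_coupling_of:
  assumes W: "weight W c" and g: "g \<in> borel_measurable borel"
  shows "(\<integral>\<^sup>+p. g p \<partial>coupling_of t W) = (\<integral>\<^sup>+p. ennreal (W p) * g (fst p, \<xi> t (snd p)) \<partial>PU t)"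
proof -
  have Wm: "(\<lambda>p. ennreal (W p)) \<in> borel_measurable (PU t)"
    using weightD(1)[OF W] by (simp add: measurable_PU)
  have gr: "(\<lambda>p. (fst p, \<xi> t (snd p))) \<in> borel_measurable (density (PU t) (\<lambda>p. ennreal (W p)))"
    using graph_meas[of t] by (simp add: measurable_PU)
  have gg: "(\<lambda>p. g (fst p, \<xi> t (snd p))) \<in> borel_measurable (PU t)"
    using measurable_compose[OF graph_meas g] by (simp add: measurable_PU)
  show ?thesis
    unfolding coupling_of_def using g by (subst nn_integral_distr[OF gr]) (simp_all add: nn_integral_density[OF Wm gg])
qed

lemma integrable_PU: "f \<in> borel_measurable (borel \<Otimes>\<^sub>M borel) \<Longrightarrow> (\<And>p. \<bar>f p :: real\<bar> \<le> c) \<Longrightarrow> integrable (PU t) f"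
  by (rule integrable_pair_bounded[OF mu prob_borel_unif])

lemma HW_bound: "weight W c \<Longrightarrow> \<bar>H t p * W p\<bar> \<le> B * c"
  using H0[of t p] HB[of t p] weightD(2,3)[of W c p] by (auto simp: abs_mult intro!: mult_mono)

lemma HW_meas: "weight W c \<Longrightarrow> (\<lambda>p. H t p * W p) \<in> borel_measurable (borel \<Otimes>\<^sub>M borel)"
  using weightD(1) by auto

lemma nn_integral_cost_coupling_of:
  assumes W: "weight W c"
  shows "(\<integral>\<^sup>+(x, y). ennreal (h x y t) \<partial>coupling_of t W) = ennreal (cost t W)"
proof -
  have m: "(\<lambda>(x, y). ennreal (h x y t)) \<in> borel_measurable borel"
    using measurable_compose[OF h_meas measurable_ennreal] by (simp add: case_prod_beta)
  have "(\<integral>\<^sup>+(x, y). ennreal (h x y t) \<partial>coupling_of t W) = (\<integral>\<^sup>+p. ennreal (H t p * W p) \<partial>PU t)"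
    unfolding nn_integral_coupling_of[OF W m]
    by (intro nn_integral_cong) (simp add: H_def ennreal_mult h0 weightD(2)[OF W] mult.commute)
  also have "\<dots> = ennreal (cost t W)"
    unfolding cost_def using integrable_PU[OF HW_meas[OF W] HW_bound[OF W]]
    by (intro nn_integral_eq_integral) (auto simp: H0 weightD(2)[OF W])
  finally show ?thesis .
qed

lemma emeasure_coupling_of:
  assumes W: "weight W c" and A: "A \<in> sets borel" and E: "E \<in> sets borel"
  shows "emeasure (coupling_of t W) (A \<times> E) = ennreal (\<integral>p. indicator A (fst p) * indicator E (\<xi> t (snd p)) * W p \<partial>PU t)"
proof -
  note [measurable] = A E weightD(1)[OF W]
  have "A \<times> E \<in> sets (coupling_of t W)" using A E by (simp add: times_borel)
  then have "emeasure (coupling_of t W) (A \<times> E) = (\<integral>\<^sup>+p. indicator (A \<times> E) p \<partial>coupling_of t W)" by simp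
  also have "\<dots> = (\<integral>\<^sup>+p. ennreal (indicator A (fst p) * indicator E (\<xi> t (snd p)) * W p) \<partial>PU t)"
    unfolding nn_integral_coupling_of[OF W borel_measurable_indicator[OF times_borel[OF A E]]]
    by (intro nn_integral_cong) (auto simp: indicator_def)
  also have "\<dots> = ennreal (\<integral>p. indicator A (fst p) * indicator E (\<xi> t (snd p)) * W p \<partial>PU t)"
    using weightD(2,4,5)[OF W] by (intro nn_integral_eq_integral integrable_PU[where c = c]) (auto simp: indicator_def)
  finally show ?thesis .
qed

lemma integral_xi: "f \<in> borel_measurable borel \<Longrightarrow> (\<integral>u. f (\<xi> t u) \<partial>unif) = (\<integral>y. (f y :: real) \<partial>\<nu> t)"
  unfolding xi_law[of t, symmetric] by (subst integral_distr) (auto simp: measurable_cong_sets[OF unif_simps(1) refl])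

lemma integral_indicator_xi:
  assumes E: "E \<in> sets borel"
  shows "(\<integral>u. indicator E (\<xi> t u) \<partial>unif) = measure (\<nu> t) E"
  using integral_xi[of "indicator E" t] E by (simp add: prob_borelD[OF nu])

lemma integral_indicator_mu: "A \<in> sets borel \<Longrightarrow> (\<integral>x. indicator A x \<partial>\<mu> t) = measure (\<mu> t) A"
  by (simp add: prob_borelD[OF mu])

text \<open>The inequalities serve templates that carry only part of the mass, the equalities serve
  plans.\<close>

lemma emeasure_coupling_of_margins:
  assumes W: "weight W c" and A: "A \<in> sets borel" and E: "E \<in> sets borel"
  shows "(\<And>x. (\<integral>u. W (x, u) \<partial>unif) \<le> 1) \<Longrightarrow> emeasure (coupling_of t W) (A \<times> UNIV) \<le> ennreal (measure (\<mu> t) A)"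
    and "(\<And>u. dens t W u \<le> 1) \<Longrightarrow> emeasure (coupling_of t W) (UNIV \<times> E) \<le> ennreal (measure (\<nu> t) E)"
    and "(\<And>x. (\<integral>u. W (x, u) \<partial>unif) = 1) \<Longrightarrow> emeasure (coupling_of t W) (A \<times> UNIV) = ennreal (measure (\<mu> t) A)"
    and "(\<And>u. dens t W u = 1) \<Longrightarrow> emeasure (coupling_of t W) (UNIV \<times> E) = ennreal (measure (\<nu> t) E)"
proof -
  note [measurable] = A E weightD(1)[OF W]
  have 1: "(\<integral>p. indicator A (fst p) * W p \<partial>PU t) = (\<integral>x. indicator A x * (\<integral>u. W (x, u) \<partial>unif) \<partial>\<mu> t)"
    using weightD(4,5)[OF W] by (subst integral_pair_iterated(1)[OF mu prob_borel_unif, of _ c]) (auto simp: indicator_def)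
  have 2: "(\<integral>p. indicator E (\<xi> t (snd p)) * W p \<partial>PU t) = (\<integral>u. indicator E (\<xi> t u) * dens t W u \<partial>unif)"
    using weightD(4,5)[OF W] by (subst integral_pair_iterated(2)[OF mu prob_borel_unif, of _ c]) (auto simp: indicator_def dens_def)
  have e1: "emeasure (coupling_of t W) (A \<times> UNIV) = ennreal (\<integral>x. indicator A x * (\<integral>u. W (x, u) \<partial>unif) \<partial>\<mu> t)"
    using emeasure_coupling_of[OF W A, of UNIV t] 1 by simp
  have e2: "emeasure (coupling_of t W) (UNIV \<times> E) = ennreal (\<integral>u. indicator E (\<xi> t u) * dens t W u \<partial>unif)"
    using emeasure_coupling_of[OF W _ E, of UNIV t] 2 by simp
  show "emeasure (coupling_of t W) (A \<times> UNIV) = ennreal (measure (\<mu> t) A)" if "\<And>x. (\<integral>u. W (x, u) \<partial>unif) = 1"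
    unfolding e1 that mult_1_right integral_indicator_mu[OF A] ..
  show "emeasure (coupling_of t W) (UNIV \<times> E) = ennreal (measure (\<nu> t) E)" if "\<And>u. dens t W u = 1"
    unfolding e2 that mult_1_right integral_indicator_xi[OF E] ..
  have W_int: "\<bar>\<integral>u. W (x, u) \<partial>unif\<bar> \<le> c" for x
    by (rule abs_integral_le[OF prob_borelD(1)[OF prob_borel_unif] weightD(4)[OF W]])
  have dens_int: "\<bar>dens t W u\<bar> \<le> c" for u
    unfolding dens_def by (rule abs_integral_le[OF prob_borelD(1)[OF mu] weightD(4)[OF W]])
  have meas1: "(\<lambda>x. \<integral>u. W (x, u) \<partial>unif) \<in> borel_measurable borel"
    by (rule integral_measurable_fst[OF prob_borel_unif weightD(1)[OF W]])
  have meas2: "dens t W \<in> borel_measurable borel"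
    unfolding dens_def[abs_def] by (rule integral_measurable_snd[OF mu weightD(1)[OF W]])
  note [measurable] = meas1 meas2
  show "emeasure (coupling_of t W) (A \<times> UNIV) \<le> ennreal (measure (\<mu> t) A)" if le: "\<And>x. (\<integral>u. W (x, u) \<partial>unif) \<le> 1"
  proof -
    have "(\<integral>x. indicator A x * (\<integral>u. W (x, u) \<partial>unif) \<partial>\<mu> t) \<le> (\<integral>x. indicator A x \<partial>\<mu> t)"
      using le order_trans[OF W_int max.cobounded2[of c 1]] weightD(5)[OF W]
      by (intro integral_mono integrable_bounded[OF prob_borelD(2,4)[OF mu], where c = "max 1 c"])
        (auto simp: indicator_def)
    then show ?thesis unfolding e1 integral_indicator_mu[OF A] by (rule ennreal_leI)
  qed
  show "emeasure (coupling_of t W) (UNIV \<times> E) \<le> ennreal (measure (\<nu> t) E)" if le: "\<And>u. dens t W u \<le> 1"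
  proof -
    have "(\<integral>u. indicator E (\<xi> t u) * dens t W u \<partial>unif) \<le> (\<integral>u. indicator E (\<xi> t u) \<partial>unif)"
      using le order_trans[OF dens_int max.cobounded2[of c 1]] weightD(5)[OF W]
      by (intro integral_mono integrable_bounded[OF prob_borelD(2,4)[OF prob_borel_unif], where c = "max 1 c"])
        (auto simp: indicator_def)
    then show ?thesis unfolding e2 integral_indicator_xi[OF E] by (rule ennreal_leI)
  qed
qed

definition plan :: "'c \<Rightarrow> ('a \<times> real \<Rightarrow> real) \<Rightarrow> bool" where
  "plan t W \<longleftrightarrow> (\<forall>x. (\<integral>u. W (x, u) \<partial>unif) = 1) \<and> (\<forall>u. dens t W u = 1)"

lemma coupling_of_couplings:
  assumes W: "weight W c" and "plan t W"
  shows "coupling_of t W \<in> couplings (\<mu> t) (\<nu> t)"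
proof -
  have p: "\<And>x. (\<integral>u. W (x, u) \<partial>unif) = 1" "\<And>u. dens t W u = 1" using assms by (auto simp: plan_def)
  interpret m: prob_space "\<mu> t" using mu by (rule prob_borelD)
  interpret n: prob_space "\<nu> t" using nu by (rule prob_borelD)
  have m: "emeasure (coupling_of t W) (A \<times> UNIV) = emeasure (\<mu> t) A" if "A \<in> sets borel" for A
    using emeasure_coupling_of_margins(3)[OF W that sets.empty_sets p(1)]
    by (simp add: m.emeasure_eq_measure)
  have n: "emeasure (coupling_of t W) (UNIV \<times> E) = emeasure (\<nu> t) E" if "E \<in> sets borel" for E
    using emeasure_coupling_of_margins(4)[OF W sets.empty_sets that p(2)] by (simp add: n.emeasure_eq_measure)
  have "prob_space (coupling_of t W)"
    using m[of UNIV] m.emeasure_space_1 prob_borelD(3)[OF mu, of t]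
    by (intro prob_spaceI) (simp add: sets_eq_imp_space_eq[OF sets_coupling_of])
  with m n show ?thesis by (simp add: couplings_def)
qed

abbreviation K :: "'c \<Rightarrow> ennreal" where
  "K t \<equiv> kantorovich_cost (\<lambda>x y. h x y t) (\<mu> t) (\<nu> t)"

lemma cost_nonneg:
  assumes W: "weight W c"
  shows "0 \<le> cost t W"
  unfolding cost_def by (rule Bochner_Integration.integral_nonneg) (auto simp: H0 weightD(2)[OF W])

lemma couplings_nonempty: "couplings (\<mu> t) (\<nu> t) \<noteq> {}"
proof -
  \<comment> \<open>The constant density encodes the product coupling.\<close>
  have "weight (\<lambda>_. 1) 1" "plan t (\<lambda>_. 1)"
    using prob_space.prob_space[OF prob_borelD(1)[OF mu, of t]] prob_space.prob_space[OF prob_borelD(1)[OF prob_borel_unif]]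
    by (auto simp: weight_def plan_def dens_def)
  from coupling_of_couplings[OF this] show ?thesis by blast
qed

lemma K_le_B: "K t \<le> ennreal B"
proof -
  obtain \<sigma> where s: "\<sigma> \<in> couplings (\<mu> t) (\<nu> t)" using couplings_nonempty by blast
  then interpret prob_space \<sigma> by (simp add: couplings_def)
  have "K t \<le> (\<integral>\<^sup>+(x, y). ennreal (h x y t) \<partial>\<sigma>)" unfolding kantorovich_cost_def using s by (rule INF_lower)
  also have "\<dots> \<le> (\<integral>\<^sup>+_. ennreal B \<partial>\<sigma>)" by (intro nn_integral_mono) (auto intro!: ennreal_leI hB)
  finally show ?thesis by (simp add: emeasure_space_1)
qed

text \<open>If \<open>W\<close> has the right first marginal and \<open>dens t W \<le> 1 + e\<close>, then \<open>W / (1 + e)\<close> is below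
  both marginals, and the product of the two remainders, normalized, has a density which does
  not depend on \<open>x\<close>.\<close>

definition transfer :: "'c \<Rightarrow> real \<Rightarrow> ('a \<times> real \<Rightarrow> real) \<Rightarrow> 'a \<times> real \<Rightarrow> real" where
  "transfer t e W p = W p / (1 + e) + (1 - dens t W (snd p) / (1 + e))"

lemma dens_meas: "weight W c \<Longrightarrow> dens t W \<in> borel_measurable borel"
  unfolding dens_def[abs_def] by (rule integral_measurable_snd[OF mu weightD(1)])

lemma dens_bounds: assumes W: "weight W c" shows "\<bar>dens t W u\<bar> \<le> c" "0 \<le> dens t W u"
proof -
  show "\<bar>dens t W u\<bar> \<le> c"
    unfolding dens_def by (rule abs_integral_le[OF prob_borelD(1)[OF mu] weightD(4)[OF W]])
  show "0 \<le> dens t W u"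
    unfolding dens_def by (rule Bochner_Integration.integral_nonneg) (rule weightD(2)[OF W])
qed

lemma section_meas:
  assumes "weight W c"
  shows "(\<lambda>u. W (x, u)) \<in> borel_measurable borel" "(\<lambda>x. W (x, u)) \<in> borel_measurable borel"
  using weightD(1)[OF assms] by (auto intro: measurable_compose[rotated])

context
  fixes t e W c
  assumes e: "0 \<le> e" and W: "weight W c" and one: "\<And>x. (\<integral>u. W (x, u) \<partial>unif) = 1"
    and dens_le: "\<And>u. dens t W u \<le> 1 + e"
begin

lemma transfer_weight: "weight (transfer t e W) (c + 1)"
proof -
  have m: "transfer t e W \<in> borel_measurable (borel \<Otimes>\<^sub>M borel)"
    unfolding transfer_def[abs_def] using weightD(1)[OF W] dens_meas[OF W, of t] by measurable
  have b: "0 \<le> transfer t e W p \<and> transfer t e W p \<le> c + 1" for p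
  proof -
    have "dens t W (snd p) / (1 + e) \<le> 1" using dens_le[of "snd p"] e by (simp add: divide_le_eq)
    moreover have "0 \<le> dens t W (snd p) / (1 + e)" "0 \<le> W p / (1 + e)" using dens_bounds[OF W] weightD(2)[OF W] e by auto
    moreover have "W p / (1 + e) \<le> W p" using mult_nonneg_nonneg[OF weightD(2)[OF W, of p] e] e by (simp add: divide_le_eq distrib_left)
    ultimately show ?thesis using weightD(3)[OF W, of p] unfolding transfer_def by linarith
  qed
  from m b show ?thesis by (simp add: weight_def)
qed

lemma integral_dens: "(\<integral>u. dens t W u \<partial>unif) = 1"
  unfolding dens_def integral_pair_iterated(2)[OF mu prob_borel_unif weightD(1,4)[OF W], symmetric]
    integral_pair_iterated(1)[OF mu prob_borel_unif weightD(1,4)[OF W]]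
  using one prob_space.prob_space[OF prob_borelD(1)[OF mu, of t]] by simp

lemma transfer_plan: "plan t (transfer t e W)"
proof -
  interpret m: prob_space "\<mu> t" using mu by (rule prob_borelD)
  interpret u: prob_space unif using prob_borel_unif by (rule prob_borelD)
  have i1: "integrable unif (\<lambda>u. W (x, u))" for x
    by (rule integrable_bounded[OF prob_borelD(2,4)[OF prob_borel_unif] section_meas(1)[OF W] weightD(4)[OF W]])
  have i2: "integrable unif (dens t W)"
    by (rule integrable_bounded[OF prob_borelD(2,4)[OF prob_borel_unif] dens_meas[OF W] dens_bounds(1)[OF W]])
  have i3: "integrable (\<mu> t) (\<lambda>x. W (x, u))" for u
    by (rule integrable_bounded[OF prob_borelD(2,4)[OF mu] section_meas(2)[OF W] weightD(4)[OF W]])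
  have "(\<integral>u. transfer t e W (x, u) \<partial>unif) = 1" for x
    using i1 i2 one integral_dens u.prob_space by (simp add: transfer_def)
  moreover have "dens t (transfer t e W) u = 1" for u
  proof -
    have "dens t (transfer t e W) u = (\<integral>x. W (x, u) / (1 + e) + (1 - dens t W u / (1 + e)) \<partial>\<mu> t)"
      by (simp add: dens_def[of t "transfer t e W"] transfer_def)
    also have "\<dots> = (\<integral>x. W (x, u) \<partial>\<mu> t) / (1 + e) + (1 - dens t W u / (1 + e))"
      using i3 m.prob_space by (subst Bochner_Integration.integral_add) auto
    finally show ?thesis by (simp add: dens_def)
  qed
  ultimately show ?thesis by (simp add: plan_def)
qed

text \<open>The added remainder has total mass \<open>1 - 1 / (1 + e)\<close>, which is at most
  \<open>e\<close>, and costs at most \<open>B\<close> per unit of mass; dividing by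
  \<open>1 + e\<close> only lowers the rest.\<close>

lemma transfer_cost: "cost t (transfer t e W) \<le> cost t W + B * e"
proof -
  interpret p: prob_space "PU t" by (rule prob_space_PU)
  have Wm: "W \<in> borel_measurable (borel \<Otimes>\<^sub>M borel)" by (rule weightD(1)[OF W])
  have dm: "(\<lambda>p. dens t W (snd p)) \<in> borel_measurable (borel \<Otimes>\<^sub>M borel)"
    using dens_meas[OF W, of t] by measurable
  have i2: "integrable unif (dens t W)"
    by (rule integrable_bounded[OF prob_borelD(2,4)[OF prob_borel_unif] dens_meas[OF W] dens_bounds(1)[OF W]])
  have intd: "integrable (PU t) (\<lambda>p. dens t W (snd p))"
    by (rule integrable_PU[OF dm dens_bounds(1)[OF W]])
  have "cost t (transfer t e W) \<le> (\<integral>p. H t p * W p + B * (1 - dens t W (snd p) / (1 + e)) \<partial>PU t)"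
    unfolding cost_def
  proof (rule integral_mono)
    show "integrable (PU t) (\<lambda>p. H t p * transfer t e W p)"
      by (rule integrable_PU[OF HW_meas[OF transfer_weight] HW_bound[OF transfer_weight]])
    show "integrable (PU t) (\<lambda>p. H t p * W p + B * (1 - dens t W (snd p) / (1 + e)))"
      using integrable_PU[OF HW_meas[OF W] HW_bound[OF W]] intd by auto
    fix p
    have "W p / (1 + e) \<le> W p" using mult_nonneg_nonneg[OF weightD(2)[OF W, of p] e] e by (simp add: divide_le_eq distrib_left)
    then have 1: "H t p * (W p / (1 + e)) \<le> H t p * W p" by (intro mult_left_mono H0)
    have "0 \<le> 1 - dens t W (snd p) / (1 + e)" using dens_le[of "snd p"] e by (simp add: divide_le_eq)
    then have "H t p * (1 - dens t W (snd p) / (1 + e)) \<le> B * (1 - dens t W (snd p) / (1 + e))"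
      by (intro mult_right_mono HB)
    with 1 show "H t p * transfer t e W p \<le> H t p * W p + B * (1 - dens t W (snd p) / (1 + e))"
      by (simp add: transfer_def distrib_left)
  qed
  also have "\<dots> = cost t W + B * (1 - (\<integral>p. dens t W (snd p) \<partial>PU t) / (1 + e))"
    using integrable_PU[OF HW_meas[OF W] HW_bound[OF W]] intd p.prob_space by (simp add: cost_def)
  also have "(\<integral>p. dens t W (snd p) \<partial>PU t) = 1"
    using integral_pair_iterated(1)[OF mu prob_borel_unif dm dens_bounds(1)[OF W], of t]
      integral_dens prob_space.prob_space[OF prob_borelD(1)[OF mu, of t]] by simp
  also have "1 - 1 / (1 + e) \<le> e" using e by (simp add: field_simps)
  then have "cost t W + B * (1 - 1 / (1 + e)) \<le> cost t W + B * e"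
    using B0 by (intro add_left_mono mult_left_mono) auto
  finally show ?thesis .
qed

end

text \<open>The mesh \<open>(1/2)^m\<close> is fine enough for the cost at \<open>t\<close>, up to
  exceptional sets that are small for the two marginals. Only one of the two points of X has to
  avoid \<open>A\<close>, which matches the oscillation hypothesis of
  \<open>coupling_cost_le\<close>.\<close>

definition good :: "real \<Rightarrow> nat \<Rightarrow> 'c \<Rightarrow> bool" where
  "good \<eta> m t \<longleftrightarrow> (\<exists>A\<in>sets borel. \<exists>S\<in>sets borel. measure (\<mu> t) A \<le> \<eta> \<and> measure (\<nu> t) S \<le> \<eta> \<and>
    (\<forall>x x' y. x \<notin> A \<longrightarrow> y \<notin> S \<longrightarrow> dist x x' < (1/2)^m \<longrightarrow> \<bar>h x y t - h x' y t\<bar> \<le> \<eta>))"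

lemma good_mono:
  assumes "good \<eta> m t" "m \<le> m'"
  shows "good \<eta> m' t"
proof -
  have "(1/2::real)^m' \<le> (1/2)^m" using assms(2) by (intro power_decreasing) auto
  then show ?thesis using assms(1) unfolding good_def by (meson order_less_le_trans)
qed

text \<open>Near compact sets carrying most of \<open>\<mu> t\<close> and \<open>\<nu> t\<close> the
  cost is close to its values on them. For nearby \<open>s\<close> the bound on X persists in total
  variation. On Y the measures converge only weakly, so the compact set is replaced by a
  neighbourhood and the mass outside is estimated by a continuous function.\<close>

lemma good_near:
  assumes \<eta>: "\<eta> > 0"
  shows "\<exists>m. \<forall>\<^sub>F s in nhds t. good \<eta> m s"
proof -
  have rad: "radon_measure (\<mu> t)" "radon_measure (\<nu> t)" using mu_radon nu_radon by (auto simp: radon_prob_def)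
  interpret n: prob_space "\<nu> t" using nu by (rule prob_borelD)
  obtain C where C: "compact C" "measure (\<mu> t) (UNIV - C) < \<eta> / 2"
    using radon_measureD(4)[OF rad(1), of UNIV "\<eta> / 2"] \<eta> by auto
  \<comment> \<open>The bound by 1 forces \<open>L\<close> to be nonempty, as \<open>infdist\<close>
    requires below.\<close>
  obtain L where L: "compact L" "measure (\<nu> t) (UNIV - L) < min (\<eta> / 2) 1"
    using radon_measureD(4)[OF rad(2), of UNIV "min (\<eta> / 2) 1"] \<eta> by auto
  have Cb[measurable]: "C \<in> sets borel" and [measurable]: "L \<in> sets borel"
    using C L by (simp_all add: borel_closed compact_imp_closed)
  have Lne: "L \<noteq> {}" using L(2) n.prob_space prob_borelD(3)[OF nu, of t] by auto
  have "compact (C \<times> L \<times> {t})" using C L by (intro compact_Times) auto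
  from compact_uniform_nbhd[OF h_cont this, of "\<eta> / 2"] \<eta> obtain r where r: "r > 0"
    "\<And>z z'. z \<in> C \<times> L \<times> {t} \<Longrightarrow> dist z z' < r \<Longrightarrow> \<bar>(\<lambda>(x, y, t). h x y t) z' - (\<lambda>(x, y, t). h x y t) z\<bar> < \<eta> / 2"
    by auto
  have dist3: "dist (x, y, s) (x', y', s') \<le> dist x x' + dist y y' + dist s s'" for x x' :: 'a and y y' :: 'b and s s' :: 'c
    using sqrt_sum_squares_le_sum[of "dist x x'" "dist (y, s) (y', s')"] sqrt_sum_squares_le_sum[of "dist y y'" "dist s s'"]
    by (simp add: dist_Pair_Pair)
  have close: "\<bar>h x' y s - h x y' t\<bar> < \<eta> / 2"
    if "x \<in> C" "y' \<in> L" "dist x x' < r / 3" "dist y' y < r / 3" "dist t s < r / 3" for x x' y y' s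
    using r(2)[of "(x, y', t)" "(x', y, s)"] that dist3[of x y' t x' y s] by auto
  obtain m where m: "(1/2)^m < r / 3" using r(1) real_arch_pow_inv[of "r / 3" "1/2"] by auto
  define S where "S = {y. r / 3 \<le> infdist y L}"
  have Sb[measurable]: "S \<in> sets borel"
    unfolding S_def by (intro borel_closed closed_Collect_le continuous_intros)
  \<comment> \<open>A continuous function that vanishes on \<open>L\<close> and equals 1 on
    \<open>S\<close>, so its integrals dominate the mass of \<open>S\<close> and depend continuously
    on the parameter.\<close>
  define \<phi> where "\<phi> y = min 1 (infdist y L / (r / 3))" for y
  have phi01: "\<bar>\<phi> y\<bar> \<le> 1" "0 \<le> \<phi> y" for y using r(1) infdist_nonneg[of y L] by (auto simp: \<phi>_def)
  have phi_cont: "continuous_on UNIV \<phi>"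
    unfolding \<phi>_def by (intro continuous_intros) (use r(1) in auto)
  have phi_int: "integrable (\<nu> s) \<phi>" for s
    using phi_cont phi01 by (intro integrable_bounded[where c = 1] prob_borelD(2,4)[OF nu] borel_measurable_continuous_onI)
  have ind_int: "integrable (\<nu> s) (indicator E :: _ \<Rightarrow> real)" if "E \<in> sets borel" for s E
    using that by (intro integrable_bounded[where c = 1] prob_borelD(2,4)[OF nu]) (auto simp: indicator_def)
  have nuE: "(\<integral>y. indicator E y \<partial>\<nu> s) = measure (\<nu> s) E" if "E \<in> sets borel" for s E
    using that by (simp add: prob_borelD[OF nu])
  have "(\<integral>y. \<phi> y \<partial>\<nu> t) \<le> (\<integral>y. indicator (UNIV - L) y \<partial>\<nu> t)"
  proof (rule integral_mono[OF phi_int ind_int])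
    show "\<phi> y \<le> indicator (UNIV - L) y" for y by (cases "y \<in> L") (simp_all add: \<phi>_def)
  qed simp
  also have "\<dots> = measure (\<nu> t) (UNIV - L)" by (rule nuE) measurable
  also have "\<dots> < \<eta> / 2" using L(2) by linarith
  finally have phi_t: "(\<integral>y. \<phi> y \<partial>\<nu> t) < \<eta> / 2" .
  have "isCont (\<lambda>s. \<integral>y. \<phi> y \<partial>\<nu> s) t"
    using nu_weak[OF phi_cont phi01(1)] by (simp add: continuous_on_eq_continuous_at)
  then have "((\<lambda>s. \<integral>y. \<phi> y \<partial>\<nu> s) \<longlongrightarrow> (\<integral>y. \<phi> y \<partial>\<nu> t)) (nhds t)"
    by (simp add: isCont_def tendsto_nhds_iff)
  then have "\<forall>\<^sub>F s in nhds t. (\<integral>y. \<phi> y \<partial>\<nu> s) < \<eta> / 2" using phi_t by (rule order_tendstoD)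
  moreover have "\<forall>\<^sub>F s in nhds t. tv_dist (\<mu> s) (\<mu> t) < \<eta> / 2"
    using tv_nhds \<eta> by (intro order_tendstoD(2)) auto
  moreover have "\<forall>\<^sub>F s in nhds t. dist t s < r / 3"
    using r(1) by (auto simp: eventually_nhds_metric dist_commute intro!: exI[of _ "r / 3"])
  ultimately have "\<forall>\<^sub>F s in nhds t. good \<eta> m s"
  proof eventually_elim
    case (elim s)
    have "measure (\<nu> s) S \<le> (\<integral>y. \<phi> y \<partial>\<nu> s)"
      unfolding nuE[OF Sb, symmetric]
    proof (rule integral_mono[OF ind_int[OF Sb] phi_int])
      fix y
      show "indicator S y \<le> \<phi> y"
      proof (cases "y \<in> S")
        case True
        then have "1 \<le> infdist y L / (r / 3)" using r(1) by (simp add: S_def le_divide_eq)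
        with True show ?thesis by (simp add: \<phi>_def)
      qed (simp add: phi01)
    qed
    then have S_le: "measure (\<nu> s) S \<le> \<eta>" using elim(1) \<eta> by linarith
    have "\<bar>measure (\<mu> s) (UNIV - C) - measure (\<mu> t) (UNIV - C)\<bar> \<le> tv_dist (\<mu> s) (\<mu> t)"
      by (intro tv_dist_ge mu) measurable
    then have C_le: "measure (\<mu> s) (UNIV - C) \<le> \<eta>" using elim(2) C(2) by linarith
    have osc: "\<bar>h x y s - h x' y s\<bar> \<le> \<eta>" if "x \<notin> UNIV - C" "y \<notin> S" "dist x x' < (1/2)^m" for x x' y
    proof -
      have "infdist y L < r / 3" using that by (simp add: S_def)
      then have "(INF a\<in>L. dist y a) < r / 3" by (simp only: infdist_notempty[OF Lne])
      moreover have "bdd_below (dist y ` L)" by (rule bdd_belowI[of _ 0]) auto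
      ultimately obtain y' where y': "y' \<in> L" "dist y y' < r / 3"
        using cINF_less_iff[OF Lne] by blast
      have "\<bar>h x y s - h x y' t\<bar> < \<eta> / 2" "\<bar>h x' y s - h x y' t\<bar> < \<eta> / 2"
        by (rule close[of x y']; use that y' m r(1) elim(3) in \<open>simp add: dist_commute\<close>)+
      then show ?thesis by linarith
    qed
    show ?case
      unfolding good_def using S_le C_le osc Sb Cb by (intro bexI[of _ "UNIV - C"] bexI[of _ S]) auto
  qed
  then show ?thesis by blast
qed

text \<open>\<open>G s u\<close> is the cost accumulated over the cell \<open>D\<close> at a fixed
  \<open>u\<close>. Convergence in L1 of \<open>u\<close> can afterwards be tested against any
  bounded density in \<open>u\<close>, hence controls the costs of all templates built on the cell
  simultaneously.\<close>

lemma integral_D_H_tendsto: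
  fixes D :: "'a set" and G :: "'c \<Rightarrow> real \<Rightarrow> real"
  assumes D[measurable]: "D \<in> sets borel" and G: "G = (\<lambda>s u. \<integral>x. indicator D x * H s (x, u) \<partial>\<mu> s)"
  shows "G s \<in> borel_measurable borel" "\<bar>G s u\<bar> \<le> B"
    "((\<lambda>s. \<integral>u. \<bar>G s u - G t u\<bar> \<partial>unif) \<longlongrightarrow> 0) (nhds t)"
proof -
  have m: "(\<lambda>p. indicator D (fst p) * H s p) \<in> borel_measurable (borel \<Otimes>\<^sub>M borel)" for s
    by measurable
  have b: "\<bar>indicator D x * H s p\<bar> \<le> B" for x s p
    using H0[of s p] HB[of s p] B0 by (auto simp: indicator_def)
  have meas: "G s \<in> borel_measurable borel" for s
    using integral_measurable_snd[OF mu m[of s], of s] by (simp add: G)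
  show "G s \<in> borel_measurable borel" by (rule meas)
  have bound: "\<bar>G s u\<bar> \<le> B" for s u
    unfolding G by (rule abs_integral_le[OF prob_borelD(1)[OF mu] b])
  show "\<bar>G s u\<bar> \<le> B" by (rule bound)
  have "(\<lambda>n. \<integral>u. \<bar>G (s n) u - G t u\<bar> \<partial>unif) \<longlonglongrightarrow> (\<integral>u. \<bar>G t u - G t u\<bar> \<partial>unif)" if s: "s \<longlonglongrightarrow> t" for s
  proof (rule integral_dominated_convergence[where w = "\<lambda>_. 2 * B"])
    show "AE u in unif. (\<lambda>n. \<bar>G (s n) u - G t u\<bar>) \<longlonglongrightarrow> \<bar>G t u - G t u\<bar>"
      using AE_H_tendsto[OF s]
    proof eventually_elim
      case (elim u)
      have "(\<lambda>n. G (s n) u) \<longlonglongrightarrow> G t u"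
        unfolding G
      proof (rule tv_dominated_convergence[OF mu mu tv_seq[OF s] _ _ b B0])
        show "(\<lambda>x. indicator D x * H r (x, u)) \<in> borel_measurable borel" for r by measurable
        show "(\<lambda>x. indicator D x * H t (x, u)) \<in> borel_measurable borel" by measurable
        show "AE x in \<mu> t. (\<lambda>n. indicator D x * H (s n) (x, u)) \<longlonglongrightarrow> indicator D x * H t (x, u)"
          using elim by (intro always_eventually allI tendsto_mult_left) auto
      qed
      then show ?case by (intro tendsto_intros)
    qed
    show "AE u in unif. norm \<bar>G (s n) u - G t u\<bar> \<le> 2 * B" for n
    proof (intro always_eventually allI)
      fix u show "norm \<bar>G (s n) u - G t u\<bar> \<le> 2 * B" using bound[of "s n" u] bound[of t u] by simp
    qed
    show "(\<lambda>u. \<bar>G (s n) u - G t u\<bar>) \<in> borel_measurable unif" for n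
      using meas[of "s n"] meas[of t] by (simp add: measurable_cong_sets[OF unif_simps(1) refl])
    show "integrable unif (\<lambda>_. 2 * B)"
      using prob_borelD(4)[OF prob_borel_unif] by (simp add: finite_measure.integrable_const)
  qed simp
  then show "((\<lambda>s. \<integral>u. \<bar>G s u - G t u\<bar> \<partial>unif) \<longlongrightarrow> 0) (nhds t)"
    using tendsto_nhds_sequentially[of t "\<lambda>s. \<integral>u. \<bar>G s u - G t u\<bar> \<partial>unif"] by simp
qed

lemma near_minimal_exists:
  assumes ev: "P t" and \<eta>: "\<eta> > 0"
  shows "\<exists>s1. P s1 \<and> (\<forall>s. P s \<longrightarrow> K s1 \<le> K s + ennreal \<eta>)"
proof -
  define v where "v = (INF s\<in>{s. P s}. K s)"
  have "v \<le> K t" unfolding v_def using ev by (intro INF_lower) auto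
  then have "v < \<infinity>" using K_le_B[of t] by (auto intro: le_less_trans order_trans)
  then have "v < v + ennreal \<eta>" using \<eta> by (simp add: ennreal_add_left_cancel_less)
  then obtain s1 where "P s1" "K s1 < v + ennreal \<eta>"
    unfolding v_def[symmetric] by (subst (asm) (1) v_def) (auto simp: INF_less_iff)
  moreover have "v \<le> K s" if "P s" for s unfolding v_def using that by (intro INF_lower) auto
  ultimately show ?thesis by (meson add_right_mono less_imp_le order_trans)
qed

lemma near_optimal_coupling_exists:
  assumes "\<eta> > 0"
  shows "\<exists>\<sigma>\<in>couplings (\<mu> t) (\<nu> t). (\<integral>\<^sup>+(x, y). ennreal (h x y t) \<partial>\<sigma>) \<le> K t + ennreal \<eta>"
proof -
  have "K t < \<infinity>" using K_le_B[of t] by (auto intro: le_less_trans)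
  then have "K t < K t + ennreal \<eta>" using assms by (simp add: ennreal_add_left_cancel_less)
  then show ?thesis
    by (subst (asm) (1) kantorovich_cost_def) (auto simp: INF_less_iff intro: less_imp_le)
qed

text \<open>Taking the template from a coupling at a parameter \<open>s1\<close> where \<open>K\<close> is almost minimal near
  \<open>t0\<close> makes it near-optimal at all nearby \<open>s\<close>; no lower semicontinuity of \<open>K\<close> is needed.\<close>

lemma weight_template_exists:
  assumes \<eta>: "0 < \<eta>" "\<eta> \<le> 1"
  shows "\<exists>W c m. weight W c \<and> (\<forall>x. (\<integral>u. W (x, u) \<partial>unif) = 1) \<and>
    (\<forall>\<^sub>F s in nhds t0. good \<eta> m s \<and> (\<forall>u. dens s W u \<le> 1 + 3 * \<eta>) \<and>
      ennreal (cost s W) \<le> K s + ennreal (\<eta> * (6 + 10 * B)))"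
proof -
  interpret m: prob_space "\<mu> t" for t using mu by (rule prob_borelD)
  interpret un: prob_space unif using prob_borel_unif by (rule prob_borelD)
  obtain m where good_m: "\<forall>\<^sub>F s in nhds t0. good \<eta> m s" using good_near[OF \<eta>(1)] by blast
  obtain k :: "'a \<Rightarrow> nat" where k[measurable]: "k \<in> borel \<rightarrow>\<^sub>M count_space UNIV"
    and k_dist: "\<And>x y. k x = k y \<Longrightarrow> dist x y < (1/2)^m"
    using small_cells_exist by metis
  define D where "D i = k -` {i}" for i
  have D[measurable]: "D i \<in> sets borel" for i unfolding D_def by (rule count_space_vimage[OF k])
  have k_set: "k -` A \<in> sets borel" for A using measurable_sets[OF k, of A] by simp
  define r where "r i = measure (\<mu> t0) (D i)" for i
  have "\<exists>N. measure (\<mu> t0) (k -` {N..}) < \<eta>"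
  proof -
    have "decseq (\<lambda>N. k -` {N..})" by (auto simp: decseq_def)
    then have "(\<lambda>N. measure (\<mu> t0) (k -` {N..})) \<longlonglongrightarrow> measure (\<mu> t0) (\<Inter>N. k -` {N..})"
      using k_set by (intro m.finite_Lim_measure_decseq) (auto simp: prob_borelD[OF mu])
    moreover have "x \<notin> (\<Inter>N. k -` {N..})" for x by (auto intro!: exI[of _ "Suc (k x)"])
    then have "(\<Inter>N. k -` {N..}) = {}" by blast
    ultimately have "(\<lambda>N. measure (\<mu> t0) (k -` {N..})) \<longlonglongrightarrow> 0" by simp
    from order_tendstoD(2)[OF this \<eta>(1)] show ?thesis by (auto simp: eventually_sequentially)
  qed
  then obtain N where N: "measure (\<mu> t0) (k -` {N..}) < \<eta>" by blast
  \<comment> \<open>Cells that are far out or have no mass at \<open>t0\<close> are lumped into the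
    small set \<open>R\<close>; the finitely many cells left have masses bounded away from 0, so one
    may divide by them.\<close>
  define I where "I = {i. i < N \<and> 0 < r i}"
  have I: "finite I" "\<And>i. i \<in> I \<Longrightarrow> i < N" "\<And>i. i \<in> I \<Longrightarrow> 0 < r i" by (auto simp: I_def)
  define R where "R = k -` (- I)"
  have R[measurable]: "R \<in> sets borel" unfolding R_def by (rule k_set)
  have R_t0: "measure (\<mu> t0) R < \<eta>"
  proof -
    have "measure (\<mu> t0) (\<Union>i\<in>{..<N} - I. D i) \<le> (\<Sum>i\<in>{..<N} - I. measure (\<mu> t0) (D i))"
      by (intro m.finite_measure_subadditive_finite) (auto simp: prob_borelD[OF mu])
    also have "\<dots> = 0" by (intro sum.neutral) (auto simp: I_def r_def not_less zero_less_measure_iff)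
    finally have 0: "measure (\<mu> t0) (\<Union>i\<in>{..<N} - I. D i) \<le> 0" .
    have "measure (\<mu> t0) R \<le> measure (\<mu> t0) (k -` {N..} \<union> (\<Union>i\<in>{..<N} - I. D i))"
      using k_set by (intro m.finite_measure_mono) (auto simp: R_def D_def prob_borelD[OF mu])
    also have "\<dots> \<le> measure (\<mu> t0) (k -` {N..}) + measure (\<mu> t0) (\<Union>i\<in>{..<N} - I. D i)"
      using k_set by (intro measure_Un_le) (auto simp: prob_borelD[OF mu])
    finally show ?thesis using 0 N by linarith
  qed
  define G where "G i s u = (\<integral>x. indicator (D i) x * H s (x, u) \<partial>\<mu> s)" for i s u
  have G_fun: "G i = (\<lambda>s u. \<integral>x. indicator (D i) x * H s (x, u) \<partial>\<mu> s)" for i by (simp add: G_def fun_eq_iff)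
  note G_props = integral_D_H_tendsto[OF D G_fun]
  \<comment> \<open>The template constructed below has coefficients \<open>v i / q i\<close>, which
    are at most \<open>2 / r i\<close>, so \<open>E\<close> bounds the change of its cost. No
    template occurs in \<open>E\<close>: the neighbourhood has to be fixed before \<open>s1\<close>
    and the template are chosen.\<close>
  define E where "E s = (\<Sum>i\<in>I. 2 / r i * (\<integral>u. \<bar>G i s u - G i t0 u\<bar> \<partial>unif))" for s
  have "(E \<longlongrightarrow> (\<Sum>i\<in>I. 2 / r i * 0)) (nhds t0)"
    unfolding E_def by (intro tendsto_sum tendsto_mult_left G_props(3))
  then have E_lim: "(E \<longlongrightarrow> 0) (nhds t0)" by simp
  \<comment> \<open>A total variation distance below \<delta> keeps the mass of each cell in
    \<open>I\<close> within the factors \<open>1 - \<eta> / 4\<close> and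
    \<open>1 + \<eta> / 4\<close> of \<open>r i\<close>, and that of \<open>R\<close> below
    \<open>2 * \<eta>\<close>.\<close>
  define \<delta> where "\<delta> = \<eta> / 4 * Min (insert 1 (r ` I))"
  have \<delta>: "0 < \<delta>" "\<delta> \<le> \<eta>" "\<And>i. i \<in> I \<Longrightarrow> \<delta> \<le> \<eta> / 4 * r i"
  proof -
    have "0 < Min (insert 1 (r ` I))" using I by (subst Min_gr_iff) auto
    then show "0 < \<delta>" using \<eta> by (simp add: \<delta>_def)
    have "Min (insert 1 (r ` I)) \<le> 1" using I by (intro Min_le) auto
    then show "\<delta> \<le> \<eta>" using \<eta> mult_left_mono[of "Min (insert 1 (r ` I))" 1 "\<eta> / 4"] by (simp add: \<delta>_def)
    show "\<delta> \<le> \<eta> / 4 * r i" if "i \<in> I" for i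
      unfolding \<delta>_def using I \<eta> that by (intro mult_left_mono Min_le) auto
  qed
  define P where "P s \<longleftrightarrow> good \<eta> m s \<and> tv_dist (\<mu> s) (\<mu> t0) < \<delta> \<and> E s < \<eta>" for s
  have ev: "\<forall>\<^sub>F s in nhds t0. P s"
    unfolding P_def using good_m order_tendstoD(2)[OF tv_nhds \<delta>(1)] order_tendstoD(2)[OF E_lim \<eta>(1)]
    by eventually_elim simp
  have "P t0" using ev by (rule eventually_nhds_x_imp_x)
  from near_minimal_exists[of P t0, OF this \<eta>(1)] obtain s1
    where s1: "P s1" "\<And>s. P s \<Longrightarrow> K s1 \<le> K s + ennreal \<eta>" by blast
  obtain \<sigma> where \<sigma>: "\<sigma> \<in> couplings (\<mu> s1) (\<nu> s1)" "(\<integral>\<^sup>+(x, y). ennreal (h x y s1) \<partial>\<sigma>) \<le> K s1 + ennreal \<eta>"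
    using near_optimal_coupling_exists[OF \<eta>(1)] by blast
  have s\<sigma>: "sets \<sigma> = sets borel" and \<sigma>_mu: "\<And>A. A \<in> sets borel \<Longrightarrow> emeasure \<sigma> (A \<times> UNIV) = emeasure (\<mu> s1) A"
    and \<sigma>_nu: "\<And>E. E \<in> sets borel \<Longrightarrow> emeasure \<sigma> (UNIV \<times> E) = emeasure (\<nu> s1) E"
    and p\<sigma>: "prob_space \<sigma>" using \<sigma>(1) by (auto simp: couplings_def)
  have sum_slice_le: "(\<Sum>i<N. emeasure (slice k i \<sigma>) E) \<le> emeasure (\<nu> s1) E" if E: "E \<in> sets borel" for E
  proof -
    have "(\<Sum>i<N. emeasure (slice k i \<sigma>) E) = (\<Sum>i<N. emeasure \<sigma> (D i \<times> E))"
      by (simp add: emeasure_slice[OF s\<sigma> k E] D_def)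
    also have "\<dots> = emeasure \<sigma> (\<Union>i\<in>{..<N}. D i \<times> E)"
      using E by (intro sum_emeasure) (auto simp: s\<sigma> disjoint_family_on_def D_def[of _, abs_def] intro!: times_borel count_space_vimage[OF k])
    also have "\<dots> \<le> emeasure \<sigma> (UNIV \<times> E)"
      using E by (intro emeasure_mono) (auto simp: s\<sigma> intro!: times_borel)
    finally show ?thesis using \<sigma>_nu[OF E] by simp
  qed
  \<comment> \<open>Each slice of \<sigma> becomes a density relative to \<open>\<nu> s1\<close>.
    The pointwise bound on their sum yields the pointwise bound on \<open>dens\<close>.\<close>
  obtain v where v_meas[measurable]: "\<And>i. v i \<in> borel_measurable borel" and v0: "\<And>i y. 0 \<le> v i y"
    and v_sum: "\<And>y. (\<Sum>i<N. v i y) \<le> 1"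
    and v_dens: "\<And>i. i < N \<Longrightarrow> slice k i \<sigma> = density (\<nu> s1) (\<lambda>y. ennreal (v i y))"
    using subprobability_densities[OF nu, of N "\<lambda>i. slice k i \<sigma>", OF _ sum_slice_le] by auto
  have v_I: "(\<Sum>i\<in>I. v i y) \<le> 1" for y
    using sum_mono2[of "{..<N}" I "\<lambda>i. v i y"] v_sum[of y] v0 I by fastforce
  have v1: "v i y \<le> 1" if "i \<in> I" for i y
    using member_le_sum[of i I "\<lambda>i. v i y"] v_I[of y] v0 I that by fastforce
  have v_int: "emeasure \<sigma> (D i \<times> E) = ennreal (\<integral>y. indicator E y * v i y \<partial>\<nu> s1)" if i: "i \<in> I" and E: "E \<in> sets borel" for i E
  proof -
    have "emeasure \<sigma> (D i \<times> E) = emeasure (density (\<nu> s1) (\<lambda>y. ennreal (v i y))) E"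
      using v_dens[OF I(2)[OF i]] emeasure_slice[OF s\<sigma> k E, of i] by (simp add: D_def)
    also have "\<dots> = (\<integral>\<^sup>+y. ennreal (v i y) * indicator E y \<partial>\<nu> s1)"
      using E by (subst emeasure_density) (auto simp: prob_borelD[OF nu] measurable_cong_sets[OF prob_borelD(2)[OF nu] refl])
    also have "\<dots> = (\<integral>\<^sup>+y. ennreal (indicator E y * v i y) \<partial>\<nu> s1)"
      by (intro nn_integral_cong) (auto simp: indicator_def)
    also have "\<dots> = ennreal (\<integral>y. indicator E y * v i y \<partial>\<nu> s1)"
    proof (rule nn_integral_eq_integral)
      show "integrable (\<nu> s1) (\<lambda>y. indicator E y * v i y)"
        using E v0 v1[OF i] by (intro integrable_bounded[OF prob_borelD(2,4)[OF nu], where c = 1]) (auto simp: indicator_def)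
    qed (auto simp: v0)
    finally show ?thesis .
  qed
  define q where "q i = measure (\<mu> s1) (D i)" for i
  have mu_D: "measure (\<mu> s) (D i) \<le> (1 + \<eta> / 4) * r i" "(1 - \<eta> / 4) * r i \<le> measure (\<mu> s) (D i)"
    if "P s" "i \<in> I" for s i
  proof -
    have "\<bar>measure (\<mu> s) (D i) - r i\<bar> \<le> \<eta> / 4 * r i"
      using tv_dist_ge[OF mu mu D[of i], of s t0] \<delta>(3)[OF that(2)] that(1) by (simp add: P_def r_def)
    moreover have "x \<le> y + e \<and> y - e \<le> x" if "\<bar>x - y\<bar> \<le> e" for x y e :: real
      using that by linarith
    ultimately have "measure (\<mu> s) (D i) \<le> r i + \<eta> / 4 * r i \<and> r i - \<eta> / 4 * r i \<le> measure (\<mu> s) (D i)"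
      by blast
    then show "measure (\<mu> s) (D i) \<le> (1 + \<eta> / 4) * r i" "(1 - \<eta> / 4) * r i \<le> measure (\<mu> s) (D i)"
      by (simp_all only: distrib_right left_diff_distrib mult_1)
  qed
  have q: "r i / 2 \<le> q i" "0 < q i" if "i \<in> I" for i
  proof -
    have "r i / 2 \<le> (1 - \<eta> / 4) * r i" using mult_right_mono[of "1/2" "1 - \<eta> / 4" "r i"] \<eta> I(3)[OF that] by simp
    then show "r i / 2 \<le> q i" using mu_D(2)[OF s1(1) that] by (simp add: q_def)
    then show "0 < q i" using I(3)[OF that] by simp
  qed
  have mu_D_q: "measure (\<mu> s) (D i) \<le> (1 + \<eta>) * q i" if "P s" "i \<in> I" for s i
  proof -
    have "1 + \<eta> / 4 \<le> (1 + \<eta>) * (1 - \<eta> / 4)"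
    proof -
      have "\<eta> * \<eta> \<le> \<eta> * 1" using \<eta> by (intro mult_left_mono) auto
      moreover have "(1 + \<eta>) * (1 - \<eta> / 4) = 1 + 3 * \<eta> / 4 - \<eta> * \<eta> / 4" by (simp add: field_simps)
      ultimately show ?thesis using \<eta> by linarith
    qed
    then have "(1 + \<eta> / 4) * r i \<le> (1 + \<eta>) * (1 - \<eta> / 4) * r i"
      using I(3)[OF that(2)] by (intro mult_right_mono) auto
    also have "\<dots> \<le> (1 + \<eta>) * q i"
      using mu_D(2)[OF s1(1) that(2)] \<eta> unfolding q_def mult.assoc by (intro mult_left_mono) auto
    finally show ?thesis using mu_D(1)[OF that] by linarith
  qed
  have mu_R: "measure (\<mu> s) R \<le> 2 * \<eta>" if "P s" for s
    using tv_dist_ge[OF mu mu R, of s t0] that[unfolded P_def] \<delta>(2) R_t0 by linarith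
  have v_mass: "(\<integral>y. v i y \<partial>\<nu> s1) = q i" if "i \<in> I" for i
  proof -
    have "ennreal (\<integral>y. v i y \<partial>\<nu> s1) = emeasure (\<mu> s1) (D i)"
      using v_int[OF that, of UNIV] \<sigma>_mu[OF D] by simp
    then show ?thesis using v0 by (simp add: q_def m.emeasure_eq_measure)
  qed
  define c where "c = 1 + (\<Sum>i\<in>I. 1 / q i)"
  have c_ge: "1 / q i \<le> c" if "i \<in> I" for i
    using member_le_sum[of i I "\<lambda>i. 1 / q i"] q I that by (force simp: c_def less_imp_le)
  have c1: "1 \<le> c" unfolding c_def using q by (simp add: sum_nonneg less_imp_le)
  \<comment> \<open>On a cell in \<open>I\<close> the conditional law of \<sigma> given
    \<open>x\<close> is averaged over the cell, giving the density \<open>v i / q i\<close>.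
    \<open>W1\<close> drops the rest, while \<open>W\<close> uses the product coupling on
    \<open>R\<close>, which makes the first marginal exact at every parameter because the
    conditional densities integrate to 1.\<close>
  define W1 where "W1 p = (if k (fst p) \<in> I then v (k (fst p)) (\<xi> s1 (snd p)) / q (k (fst p)) else 0)" for p
  define W where "W p = (if k (fst p) \<in> I then v (k (fst p)) (\<xi> s1 (snd p)) / q (k (fst p)) else 1)" for p
  have W1_sum: "W1 (x, u) = (\<Sum>i\<in>I. indicator (D i) x * (v i (\<xi> s1 u) / q i))" for x u
  proof (cases "k x \<in> I")
    case True
    have "(\<Sum>i\<in>I. indicator (D i) x * (v i (\<xi> s1 u) / q i)) = (\<Sum>i\<in>{k x}. indicator (D i) x * (v i (\<xi> s1 u) / q i))"
      using True I by (intro sum.mono_neutral_right) (auto simp: D_def)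
    then show ?thesis using True by (simp add: W1_def D_def)
  next
    case False
    then have "(\<Sum>i\<in>I. indicator (D i) x * (v i (\<xi> s1 u) / q i)) = 0"
      by (intro sum.neutral) (auto simp: D_def indicator_def)
    then show ?thesis using False by (simp add: W1_def)
  qed
  have W_W1: "W p = W1 p + indicator R (fst p)" for p by (simp add: W_def W1_def R_def)
  have W1_meas[measurable]: "W1 \<in> borel_measurable (borel \<Otimes>\<^sub>M borel)"
  proof -
    have "(\<lambda>p. \<Sum>i\<in>I. indicator (D i) (fst p) * (v i (\<xi> s1 (snd p)) / q i)) \<in> borel_measurable (borel \<Otimes>\<^sub>M borel)"
      by measurable
    moreover have "W1 = (\<lambda>p. \<Sum>i\<in>I. indicator (D i) (fst p) * (v i (\<xi> s1 (snd p)) / q i))"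
      using W1_sum by (auto simp: fun_eq_iff)
    ultimately show ?thesis by simp
  qed
  have W_meas: "W \<in> borel_measurable (borel \<Otimes>\<^sub>M borel)"
    unfolding W_W1[abs_def] by measurable
  have vq: "0 \<le> v i y / q i \<and> v i y / q i \<le> c" if "i \<in> I" for i y
  proof -
    have "v i y / q i \<le> 1 / q i" using v1[OF that] q[OF that] by (intro divide_right_mono) auto
    then show ?thesis using c_ge[OF that] v0[of i y] q(2)[OF that] by auto
  qed
  have W1_w: "weight W1 c" using vq c1 W1_meas by (auto simp: weight_def W1_def)
  have W_w: "weight W c" using vq c1 W_meas by (auto simp: weight_def W_def)
  have W1_int: "(\<integral>u. W1 (x, u) \<partial>unif) = (if k x \<in> I then 1 else 0)" for x
  proof (cases "k x \<in> I")
    case True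
    have "(\<integral>u. W1 (x, u) \<partial>unif) = (\<integral>u. v (k x) (\<xi> s1 u) \<partial>unif) / q (k x)" using True by (simp add: W1_def)
    also have "\<dots> = 1"
      unfolding integral_xi[OF v_meas[of "k x"], of s1] v_mass[OF True] using q(2)[OF True] by simp
    finally show ?thesis using True by simp
  qed (simp add: W1_def)
  have W_int: "(\<integral>u. W (x, u) \<partial>unif) = 1" for x
  proof (cases "k x \<in> I")
    case True
    then have "W (x, u) = W1 (x, u)" for u by (simp add: W_def W1_def)
    then show ?thesis using W1_int[of x] True by simp
  qed (simp add: W_def un.prob_space[simplified])
  have ind_int: "integrable (\<mu> s) (indicator A :: _ \<Rightarrow> real)" if "A \<in> sets borel" for A s
    using that by (intro integrable_bounded[OF prob_borelD(2,4)[OF mu], where c = 1]) (auto simp: indicator_def)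
  have dens_W1: "dens s W1 u = (\<Sum>i\<in>I. measure (\<mu> s) (D i) * (v i (\<xi> s1 u) / q i))" for s u
    unfolding dens_def W1_sum using ind_int[OF D]
    by (simp add: integral_indicator_mu[OF D] del: Bochner_Integration.integral_indicator)
  have dens_W: "dens s W u = dens s W1 u + measure (\<mu> s) R" for s u
  proof -
    have "integrable (\<mu> s) (\<lambda>x. W1 (x, u))"
      by (rule integrable_bounded[OF prob_borelD(2,4)[OF mu] section_meas(2)[OF W1_w] weightD(4)[OF W1_w]])
    then show ?thesis unfolding dens_def W_W1 using ind_int[OF R]
      by (simp add: integral_indicator_mu[OF R] del: Bochner_Integration.integral_indicator)
  qed
  \<comment> \<open>The cells in \<open>I\<close> contribute at most \<open>1 + \<eta>\<close> and
    \<open>R\<close> at most \<open>2 * \<eta>\<close>.\<close>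
  have dens_le: "dens s W u \<le> 1 + 3 * \<eta>" if "P s" for s u
  proof -
    have "dens s W1 u \<le> (\<Sum>i\<in>I. (1 + \<eta>) * v i (\<xi> s1 u))"
      unfolding dens_W1
    proof (rule sum_mono)
      fix i assume i: "i \<in> I"
      have "measure (\<mu> s) (D i) * (v i (\<xi> s1 u) / q i) \<le> (1 + \<eta>) * q i * (v i (\<xi> s1 u) / q i)"
        using mu_D_q[OF that i] v0 q(2)[OF i] by (intro mult_right_mono) auto
      then show "measure (\<mu> s) (D i) * (v i (\<xi> s1 u) / q i) \<le> (1 + \<eta>) * v i (\<xi> s1 u)"
        using q(2)[OF i] by simp
    qed
    also have "\<dots> \<le> (1 + \<eta>) * 1"
      unfolding sum_distrib_left[symmetric] using v_I \<eta> by (intro mult_left_mono) auto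
    finally show ?thesis unfolding dens_W using mu_R[OF that] by simp
  qed
  have dens_W1_s1: "dens s1 W1 u \<le> 1" for u
  proof -
    have "dens s1 W1 u = (\<Sum>i\<in>I. v i (\<xi> s1 u))"
      unfolding dens_W1 q_def[symmetric] by (intro sum.cong refl) (simp add: less_imp_neq[OF q(2), symmetric])
    then show ?thesis using v_I by simp
  qed
  have cost_W: "cost s W \<le> cost s W1 + B * measure (\<mu> s) R" for s
  proof -
    have RU: "(\<lambda>p. indicator R (fst p) :: real) \<in> borel_measurable (borel \<Otimes>\<^sub>M borel)" by measurable
    have i: "integrable (PU s) (\<lambda>p. indicator R (fst p) :: real)"
      by (rule integrable_PU[OF RU, of 1]) (auto simp: indicator_def)
    have "cost s W \<le> (\<integral>p. H s p * W1 p + B * indicator R (fst p) \<partial>PU s)"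
      unfolding cost_def
    proof (rule integral_mono)
      show "H s p * W p \<le> H s p * W1 p + B * indicator R (fst p)" for p
        using HB[of s p] by (simp add: W_W1 distrib_left indicator_def)
    qed (use i integrable_PU[OF HW_meas[OF W1_w] HW_bound[OF W1_w]] integrable_PU[OF HW_meas[OF W_w] HW_bound[OF W_w]] in auto)
    also have "\<dots> = cost s W1 + B * (\<integral>p. indicator R (fst p) \<partial>PU s)"
      using i integrable_PU[OF HW_meas[OF W1_w] HW_bound[OF W1_w]] by (simp add: cost_def)
    also have "(\<integral>p. indicator R (fst p) \<partial>PU s) = measure (\<mu> s) R"
      using integral_pair_iterated(1)[OF mu prob_borel_unif RU, of 1 s] integral_indicator_mu[OF R] un.prob_space[simplified]
      by (simp add: indicator_def[of R] del: Bochner_Integration.integral_indicator)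
    finally show ?thesis .
  qed
  have cost_W1: "\<bar>cost s W1 - cost t0 W1\<bar> \<le> E s" if "P s" for s
  proof -
    have eq: "cost s W1 = (\<integral>u. (\<Sum>i\<in>I. v i (\<xi> s1 u) / q i * G i s u) \<partial>unif)" for s
    proof -
      have "cost s W1 = (\<integral>u. \<integral>x. H s (x, u) * W1 (x, u) \<partial>\<mu> s \<partial>unif)"
        unfolding cost_def by (rule integral_pair_iterated(2)[OF mu prob_borel_unif HW_meas[OF W1_w] HW_bound[OF W1_w]])
      also have "\<dots> = (\<integral>u. (\<Sum>i\<in>I. v i (\<xi> s1 u) / q i * G i s u) \<partial>unif)"
      proof (rule Bochner_Integration.integral_cong[OF refl])
        fix u
        have int: "integrable (\<mu> s) (\<lambda>x. indicator (D i) x * H s (x, u))" for i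
        proof (rule integrable_bounded[OF prob_borelD(2,4)[OF mu]])
          show "(\<lambda>x. indicator (D i) x * H s (x, u)) \<in> borel_measurable borel" by measurable
          show "\<bar>indicator (D i) x * H s (x, u)\<bar> \<le> B" for x
            using H0[of s "(x, u)"] HB[of s "(x, u)"] B0 by (auto simp: indicator_def)
        qed
        have "(\<integral>x. H s (x, u) * W1 (x, u) \<partial>\<mu> s) =
            (\<integral>x. (\<Sum>i\<in>I. v i (\<xi> s1 u) / q i * (indicator (D i) x * H s (x, u))) \<partial>\<mu> s)"
          unfolding W1_sum sum_distrib_left by (intro Bochner_Integration.integral_cong sum.cong refl) (simp add: mult.commute mult.left_commute)
        also have "\<dots> = (\<Sum>i\<in>I. v i (\<xi> s1 u) / q i * G i s u)"
          unfolding G_def using int by simp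
        finally show "(\<integral>x. H s (x, u) * W1 (x, u) \<partial>\<mu> s) = (\<Sum>i\<in>I. v i (\<xi> s1 u) / q i * G i s u)" .
      qed
      finally show ?thesis .
    qed
    note uint = integrable_bounded[OF prob_borelD(2,4)[OF prob_borel_unif]]
    note [measurable] = G_props(1)
    have i1: "integrable unif (\<lambda>u. v i (\<xi> s1 u) / q i * G i s u)" if "i \<in> I" for i s
    proof (rule uint[where c = "c * B"])
      show "\<bar>v i (\<xi> s1 u) / q i * G i s u\<bar> \<le> c * B" for u
      proof -
        have "\<bar>v i (\<xi> s1 u) / q i\<bar> \<le> c" using vq[OF that, of "\<xi> s1 u"] by linarith
        from mult_mono[OF this G_props(2)[of i s u]] show ?thesis unfolding abs_mult using c1 by linarith
      qed
    qed measurable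
    have i2: "integrable unif (\<lambda>u. 2 / r i * \<bar>G i s u - G i t0 u\<bar>)" for i
    proof (intro integrable_mult_right uint[where c = "2 * B"])
      show "\<bar>\<bar>G i s u - G i t0 u\<bar>\<bar> \<le> 2 * B" for u using G_props(2)[of i s u] G_props(2)[of i t0 u] by simp
    qed measurable
    have "cost s W1 - cost t0 W1 = (\<integral>u. (\<Sum>i\<in>I. v i (\<xi> s1 u) / q i * G i s u) - (\<Sum>i\<in>I. v i (\<xi> s1 u) / q i * G i t0 u) \<partial>unif)"
      unfolding eq using i1 by (intro Bochner_Integration.integral_diff[symmetric] Bochner_Integration.integrable_sum)
    also have "\<bar>\<dots>\<bar> \<le> (\<integral>u. (\<Sum>i\<in>I. 2 / r i * \<bar>G i s u - G i t0 u\<bar>) \<partial>unif)"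
    proof (rule order_trans[OF integral_abs_bound integral_mono])
      show "integrable unif (\<lambda>u. \<bar>(\<Sum>i\<in>I. v i (\<xi> s1 u) / q i * G i s u) - (\<Sum>i\<in>I. v i (\<xi> s1 u) / q i * G i t0 u)\<bar>)"
        using i1 by (intro integrable_abs Bochner_Integration.integrable_diff Bochner_Integration.integrable_sum)
      show "integrable unif (\<lambda>u. \<Sum>i\<in>I. 2 / r i * \<bar>G i s u - G i t0 u\<bar>)"
        using i2 by (intro Bochner_Integration.integrable_sum)
      fix u
      have "\<bar>(\<Sum>i\<in>I. v i (\<xi> s1 u) / q i * G i s u) - (\<Sum>i\<in>I. v i (\<xi> s1 u) / q i * G i t0 u)\<bar>
          = \<bar>\<Sum>i\<in>I. v i (\<xi> s1 u) / q i * (G i s u - G i t0 u)\<bar>"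
        by (simp add: sum_subtractf right_diff_distrib)
      also have "\<dots> \<le> (\<Sum>i\<in>I. \<bar>v i (\<xi> s1 u) / q i * (G i s u - G i t0 u)\<bar>)" by (rule sum_abs)
      also have "\<dots> \<le> (\<Sum>i\<in>I. 2 / r i * \<bar>G i s u - G i t0 u\<bar>)"
      proof (rule sum_mono)
        fix i assume i: "i \<in> I"
        have "v i (\<xi> s1 u) / q i \<le> 1 / q i" using v1[OF i] q[OF i] by (intro divide_right_mono) auto
        also have "\<dots> \<le> 2 / r i" using q[OF i] I(3)[OF i] by (simp add: field_simps)
        finally have "v i (\<xi> s1 u) / q i \<le> 2 / r i" .
        then show "\<bar>v i (\<xi> s1 u) / q i * (G i s u - G i t0 u)\<bar> \<le> 2 / r i * \<bar>G i s u - G i t0 u\<bar>"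
          unfolding abs_mult using vq[OF i, of "\<xi> s1 u"] by (intro mult_right_mono) auto
      qed
      finally show "\<bar>(\<Sum>i\<in>I. v i (\<xi> s1 u) / q i * G i s u) - (\<Sum>i\<in>I. v i (\<xi> s1 u) / q i * G i t0 u)\<bar>
          \<le> (\<Sum>i\<in>I. 2 / r i * \<bar>G i s u - G i t0 u\<bar>)" .
    qed
    also have "\<dots> = E s" unfolding E_def using i2 by (simp add: Bochner_Integration.integral_sum)
    finally show ?thesis .
  qed
  have cost_s1: "ennreal (cost s1 W1) \<le> K s1 + ennreal \<eta> + ennreal (2 * (\<eta> + B * (3 * \<eta> + \<eta>)))"
  proof -
    obtain A S where AS: "A \<in> sets borel" "S \<in> sets borel" "measure (\<mu> s1) A \<le> \<eta>" "measure (\<nu> s1) S \<le> \<eta>"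
      "\<And>x x' y. x \<notin> A \<Longrightarrow> y \<notin> S \<Longrightarrow> dist x x' < (1/2)^m \<Longrightarrow> \<bar>h x y s1 - h x' y s1\<bar> \<le> \<eta>"
      using s1(1) unfolding P_def good_def by blast
    \<comment> \<open>The part of \<sigma> over the cells in \<open>I\<close>: it agrees with the
      coupling of \<open>W1\<close> on all sets cell times \<open>E\<close>, as
      \<open>coupling_cost_le\<close> demands. The exceptional set \<open>A \<union> R\<close> has
      mass at most \<open>\<eta> + 2 * \<eta>\<close>.\<close>
    define \<sigma>1 where "\<sigma>1 = density \<sigma> (indicator (k -` I \<times> UNIV))"
    have Ib: "k -` I \<times> UNIV \<in> sets \<sigma>" unfolding s\<sigma> using k_set by (intro times_borel) auto
    have s\<sigma>1: "sets \<sigma>1 = sets borel" by (simp add: \<sigma>1_def s\<sigma>)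
    have \<sigma>1_eq: "emeasure \<sigma>1 X = emeasure \<sigma> ((k -` I \<times> UNIV) \<inter> X)" if "X \<in> sets borel" for X
    proof -
      have X: "X \<in> sets \<sigma>" using that by (simp add: s\<sigma>)
      have "emeasure \<sigma>1 X = (\<integral>\<^sup>+p. indicator (k -` I \<times> UNIV) p * indicator X p \<partial>\<sigma>)"
        unfolding \<sigma>1_def using Ib X by (intro emeasure_density) auto
      also have "\<dots> = (\<integral>\<^sup>+p. indicator ((k -` I \<times> UNIV) \<inter> X) p \<partial>\<sigma>)"
        by (simp only: indicator_inter_arith)
      also have "\<dots> = emeasure \<sigma> ((k -` I \<times> UNIV) \<inter> X)" using Ib X by (intro nn_integral_indicator) auto
      finally show ?thesis .
    qed
    have \<sigma>1_le: "emeasure \<sigma>1 X \<le> emeasure \<sigma> X" if "X \<in> sets borel" for X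
      unfolding \<sigma>1_eq[OF that] using that by (intro emeasure_mono) (auto simp: s\<sigma>)
    have AR: "measure (\<mu> s1) (A \<union> R) \<le> 3 * \<eta>"
      using measure_Un_le[of A "\<mu> s1" R] AS(1,3) mu_R[OF s1(1)] R by (simp add: prob_borelD[OF mu])
    have ARb: "A \<union> R \<in> sets borel" using AS(1) R by auto
    interpret n: prob_space "\<nu> s1" using nu by (rule prob_borelD)
    have int_le1: "(\<integral>u. W1 (x, u) \<partial>unif) \<le> 1" for x by (simp add: W1_int)
    have 1: "(\<integral>\<^sup>+p. ennreal ((\<lambda>(x, y). h x y s1) p) \<partial>coupling_of s1 W1) \<le>
        (\<integral>\<^sup>+p. ennreal ((\<lambda>(x, y). h x y s1) p) \<partial>\<sigma>1) + ennreal (2 * (\<eta> + B * (3 * \<eta> + \<eta>)))"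
    proof (rule coupling_cost_le[OF s\<sigma>1 sets_coupling_of _ _ k])
      have "UNIV \<in> sets (borel :: ('a \<times> 'b) measure)" by simp
      from \<sigma>1_le[OF this] show "emeasure \<sigma>1 UNIV \<le> 1"
        using \<sigma>_mu[of UNIV] m.emeasure_space_1[of s1] by (simp add: prob_borelD[OF mu])
      show "emeasure (coupling_of s1 W1) UNIV \<le> 1"
        using emeasure_coupling_of_margins(1)[OF W1_w _ sets.empty_sets int_le1, of UNIV s1] m.prob_le_1[of s1 UNIV]
        by (auto intro: order_trans simp: ennreal_le_1)
      show "emeasure \<sigma>1 (k -` {i} \<times> E) = emeasure (coupling_of s1 W1) (k -` {i} \<times> E)" if E: "E \<in> sets borel" for i E
      proof (cases "i \<in> I")
        case True
        have "(k -` I \<times> UNIV) \<inter> (k -` {i} \<times> E) = D i \<times> E" using True by (auto simp: D_def)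
        then have "emeasure \<sigma>1 (k -` {i} \<times> E) = ennreal (\<integral>y. indicator E y * v i y \<partial>\<nu> s1)"
          using \<sigma>1_eq[OF times_borel[OF D[of i] E]] v_int[OF True E] by (simp add: D_def)
        moreover have "(\<integral>p. indicator (D i) (fst p) * indicator E (\<xi> s1 (snd p)) * W1 p \<partial>PU s1) = (\<integral>y. indicator E y * v i y \<partial>\<nu> s1)"
        proof -
          note [measurable] = E
          have "(\<integral>p. indicator (D i) (fst p) * indicator E (\<xi> s1 (snd p)) * W1 p \<partial>PU s1) =
              (\<integral>x. \<integral>u. indicator (D i) x * indicator E (\<xi> s1 u) * W1 (x, u) \<partial>unif \<partial>\<mu> s1)"
            using weightD(4)[OF W1_w] weightD(5)[OF W1_w]
            by (subst integral_pair_iterated(1)[OF mu prob_borel_unif, of _ c]) (auto simp: indicator_def)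
          also have "\<dots> = (\<integral>x. indicator (D i) x * ((\<integral>y. indicator E y * v i y \<partial>\<nu> s1) / q i) \<partial>\<mu> s1)"
          proof (rule Bochner_Integration.integral_cong[OF refl])
            fix x
            show "(\<integral>u. indicator (D i) x * indicator E (\<xi> s1 u) * W1 (x, u) \<partial>unif) =
                indicator (D i) x * ((\<integral>y. indicator E y * v i y \<partial>\<nu> s1) / q i)"
            proof (cases "x \<in> D i")
              case xi: True
              then have "W1 (x, u) = v i (\<xi> s1 u) / q i" for u using True by (simp add: W1_def D_def)
              then show ?thesis
                using xi integral_xi[of "\<lambda>y. indicator E y * v i y" s1] by simp
            qed simp
          qed
          also have "\<dots> = (\<integral>y. indicator E y * v i y \<partial>\<nu> s1)"
            using q(2)[OF True] integral_indicator_mu[OF D[of i], of s1]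
            by (simp add: q_def[symmetric] del: Bochner_Integration.integral_indicator)
          finally show ?thesis .
        qed
        ultimately show ?thesis
          using emeasure_coupling_of[OF W1_w D[of i] E, of s1] by (simp add: D_def)
      next
        case False
        then have "(k -` I \<times> UNIV) \<inter> (k -` {i} \<times> E) = {}" by auto
        then have "emeasure \<sigma>1 (k -` {i} \<times> E) = 0"
          using \<sigma>1_eq[OF times_borel[OF D[of i] E]] by (simp add: D_def)
        moreover have "(\<lambda>p. indicator (D i) (fst p) * indicator E (\<xi> s1 (snd p)) * W1 p) = (\<lambda>p. 0)"
          using False by (intro ext) (auto simp: W1_def D_def indicator_def)
        then have "emeasure (coupling_of s1 W1) (D i \<times> E) = 0"
          using emeasure_coupling_of[OF W1_w D[of i] E, of s1] by simp
        ultimately show ?thesis by (simp add: D_def)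
      qed
      show "A \<union> R \<in> sets borel" "S \<in> sets borel" by (fact ARb AS(2))+
      have "emeasure \<sigma> ((A \<union> R) \<times> UNIV) \<le> ennreal (3 * \<eta>)"
        unfolding \<sigma>_mu[OF ARb] m.emeasure_eq_measure using AR by (rule ennreal_leI)
      then show "emeasure \<sigma>1 ((A \<union> R) \<times> UNIV) \<le> ennreal (3 * \<eta>)"
        using \<sigma>1_le[OF times_borel[OF ARb], of UNIV] by auto
      show "emeasure (coupling_of s1 W1) ((A \<union> R) \<times> UNIV) \<le> ennreal (3 * \<eta>)"
        using emeasure_coupling_of_margins(1)[OF W1_w ARb sets.empty_sets int_le1, of s1] ennreal_leI[OF AR] by (rule order_trans)
      have "emeasure \<sigma> (UNIV \<times> S) \<le> ennreal \<eta>"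
        unfolding \<sigma>_nu[OF AS(2)] n.emeasure_eq_measure using AS(4) by (rule ennreal_leI)
      then show "emeasure \<sigma>1 (UNIV \<times> S) \<le> ennreal \<eta>"
        using \<sigma>1_le[OF times_borel[OF _ AS(2)], of UNIV] by auto
      show "emeasure (coupling_of s1 W1) (UNIV \<times> S) \<le> ennreal \<eta>"
        using emeasure_coupling_of_margins(2)[OF W1_w sets.empty_sets AS(2) dens_W1_s1] ennreal_leI[OF AS(4)] by (rule order_trans)
      show "(\<lambda>(x, y). h x y s1) \<in> borel_measurable borel" by (rule h_meas)
      show "\<bar>(case (x, y) of (x, y) \<Rightarrow> h x y s1) - (case (x', y) of (x, y) \<Rightarrow> h x y s1)\<bar> \<le> \<eta>"
        if "x \<notin> A \<union> R" "y \<notin> S" "k x = k x'" for x x' y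
        using AS(5)[of x y x'] k_dist[OF that(3)] that by simp
    qed (use \<eta> h0 hB in auto)
    have 2: "(\<integral>\<^sup>+p. ennreal ((\<lambda>(x, y). h x y s1) p) \<partial>\<sigma>1) \<le> (\<integral>\<^sup>+p. ennreal ((\<lambda>(x, y). h x y s1) p) \<partial>\<sigma>)"
    proof -
      have hm: "(\<lambda>p. ennreal ((\<lambda>(x, y). h x y s1) p)) \<in> borel_measurable \<sigma>"
        using h_meas by (simp add: measurable_cong_sets[OF s\<sigma> refl])
      show ?thesis
        unfolding \<sigma>1_def using Ib hm
        by (subst nn_integral_density) (auto intro!: nn_integral_mono simp: indicator_def)
    qed
    have eq: "(\<lambda>p. ennreal ((\<lambda>(x, y). h x y s1) p)) = (\<lambda>(x, y). ennreal (h x y s1))"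
      by (simp add: fun_eq_iff)
    show ?thesis
      using order_trans[OF 1 add_right_mono[OF order_trans[OF 2 \<sigma>(2)[folded eq]]]]
      unfolding eq nn_integral_cost_coupling_of[OF W1_w] .
  qed
  \<comment> \<open>The errors: \<eta> each for the choices of \<open>s1\<close> and \<sigma>,
    \<open>2 * (\<eta> + B * (4 * \<eta>))\<close> for averaging over cells, \<eta> each for the
    moves from \<open>s1\<close> to \<open>t0\<close> and from \<open>t0\<close> to
    \<open>s\<close>, and \<open>2 * \<eta> * B\<close> for \<open>R\<close>.\<close>
  have "ennreal (cost s W) \<le> K s + ennreal (\<eta> * (6 + 10 * B))" if "P s" for s
  proof -
    have E_less: "E s < \<eta>" "E s1 < \<eta>" using that s1(1) by (auto simp: P_def)
    have "B * measure (\<mu> s) R \<le> B * (2 * \<eta>)" using mu_R[OF that] B0 by (intro mult_left_mono) auto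
    then have "cost s W \<le> cost s1 W1 + (2 * \<eta> + B * (2 * \<eta>))"
      using cost_W[of s] cost_W1[OF that] cost_W1[OF s1(1)] E_less by linarith
    then have "ennreal (cost s W) \<le> ennreal (cost s1 W1 + (2 * \<eta> + B * (2 * \<eta>)))" by (rule ennreal_leI)
    also have "\<dots> = ennreal (cost s1 W1) + ennreal (2 * \<eta> + B * (2 * \<eta>))"
      using \<eta> B0 cost_nonneg[OF W1_w] by (intro ennreal_plus) auto
    also have "\<dots> \<le> (K s1 + ennreal \<eta> + ennreal (2 * (\<eta> + B * (3 * \<eta> + \<eta>)))) + ennreal (2 * \<eta> + B * (2 * \<eta>))"
      using cost_s1 by (intro add_right_mono)
    also have "\<dots> \<le> ((K s + ennreal \<eta>) + ennreal \<eta> + ennreal (2 * (\<eta> + B * (3 * \<eta> + \<eta>)))) + ennreal (2 * \<eta> + B * (2 * \<eta>))"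
      using s1(2)[OF that] by (intro add_right_mono)
    also have "\<dots> = K s + ennreal (\<eta> + \<eta> + 2 * (\<eta> + B * (3 * \<eta> + \<eta>)) + (2 * \<eta> + B * (2 * \<eta>)))"
    proof -
      have "0 \<le> 2 * (\<eta> + B * (3 * \<eta> + \<eta>))" "0 \<le> 2 * \<eta> + B * (2 * \<eta>)" using \<eta> B0 by auto
      moreover have "x + ennreal a + ennreal a + ennreal b + ennreal d = x + ennreal (a + a + b + d)"
        if "0 \<le> a" "0 \<le> b" "0 \<le> d" for x and a b d :: real
        using that by (simp only: ennreal_plus add_nonneg_nonneg add.assoc)
      ultimately show ?thesis using \<eta>(1) by (metis less_imp_le)
    qed
    also have "\<eta> + \<eta> + 2 * (\<eta> + B * (3 * \<eta> + \<eta>)) + (2 * \<eta> + B * (2 * \<eta>)) = \<eta> * (6 + 10 * B)"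
      by (simp add: algebra_simps)
    finally show ?thesis .
  qed
  then have "\<forall>\<^sub>F s in nhds t0. good \<eta> m s \<and> (\<forall>u. dens s W u \<le> 1 + 3 * \<eta>) \<and>
      ennreal (cost s W) \<le> K s + ennreal (\<eta> * (6 + 10 * B))"
    using ev dens_le by (auto simp: P_def elim!: eventually_mono)
  with W_w W_int show ?thesis by blast
qed

lemma template_map_exists:
  assumes \<eta>: "0 < \<eta>" "\<eta> \<le> 1"
  obtains W :: "'c \<Rightarrow> 'a \<times> real \<Rightarrow> real" and c :: "'c \<Rightarrow> real" and m :: "'c \<Rightarrow> nat" and \<rho> :: "'c \<Rightarrow> real"
  where "\<And>t. weight (W t) (c t)" "\<And>t x. (\<integral>u. W t (x, u) \<partial>unif) = 1" "\<And>t. 0 < \<rho> t"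
    "\<And>s t. dist s t < \<rho> t \<Longrightarrow> good \<eta> (m t) s"
    "\<And>s t u. dist s t < \<rho> t \<Longrightarrow> dens s (W t) u \<le> 1 + 3 * \<eta>"
    "\<And>s t. dist s t < \<rho> t \<Longrightarrow> ennreal (cost s (W t)) \<le> K s + ennreal (\<eta> * (6 + 10 * B))"
proof -
  have "\<exists>W c m \<rho>. weight W c \<and> (\<forall>x. (\<integral>u. W (x, u) \<partial>unif) = 1) \<and> 0 < \<rho> \<and>
      (\<forall>s. dist s t < \<rho> \<longrightarrow> good \<eta> m s \<and> (\<forall>u. dens s W u \<le> 1 + 3 * \<eta>) \<and>
        ennreal (cost s W) \<le> K s + ennreal (\<eta> * (6 + 10 * B)))" for t
    using weight_template_exists[OF \<eta>, of t] unfolding eventually_nhds_metric by blast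
  then obtain W c m \<rho> where
    "\<And>t. weight (W t) (c t) \<and> (\<forall>x. (\<integral>u. W t (x, u) \<partial>unif) = 1) \<and> 0 < \<rho> t \<and>
      (\<forall>s. dist s t < \<rho> t \<longrightarrow> good \<eta> (m t) s \<and> (\<forall>u. dens s (W t) u \<le> 1 + 3 * \<eta>) \<and>
        ennreal (cost s (W t)) \<le> K s + ennreal (\<eta> * (6 + 10 * B)))" by metis
  then show thesis by (intro that) blast+
qed

text \<open>This covers parameters where \<open>dens\<close> exceeds \<open>1 + e\<close> and the
  transfer takes negative values. The continuity argument for the glued family follows each template
  over the whole parameter space, also where its coefficient vanishes.\<close>

lemma transfer_bound:
  assumes e: "0 \<le> e" and W: "weight W c"
  shows "transfer t e W \<in> borel_measurable (borel \<Otimes>\<^sub>M borel)" "\<bar>transfer t e W p\<bar> \<le> 2 * c + 1"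
proof -
  show "transfer t e W \<in> borel_measurable (borel \<Otimes>\<^sub>M borel)"
    unfolding transfer_def[abs_def] using weightD(1)[OF W] dens_meas[OF W, of t] by measurable
  have le: "0 \<le> a / (1 + e) \<and> a / (1 + e) \<le> a" if "0 \<le> a" for a :: real
    using mult_nonneg_nonneg[OF that e] that e by (simp add: divide_le_eq distrib_left)
  have "dens t W (snd p) \<le> c" using dens_bounds(1)[OF W, of t "snd p"] by linarith
  then show "\<bar>transfer t e W p\<bar> \<le> 2 * c + 1"
    using le[OF weightD(2)[OF W, of p]] le[OF dens_bounds(2)[OF W, of t "snd p"]] weightD(3)[OF W, of p] weightD(5)[OF W]
    unfolding transfer_def by linarith
qed

text \<open>Convergence at every point: \<open>dens\<close> integrates a fixed bounded function
  against measures converging in total variation.\<close>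

lemma transfer_tendsto:
  assumes e: "0 \<le> e" and W: "weight W c" and s: "s \<longlonglongrightarrow> t"
  shows "(\<lambda>n. transfer (s n) e W p) \<longlonglongrightarrow> transfer t e W p"
proof -
  have "(\<lambda>n. dens (s n) W (snd p)) \<longlonglongrightarrow> dens t W (snd p)"
    unfolding dens_def
  proof (rule tv_dominated_convergence[OF mu mu tv_seq[OF s], where c = "c + 1"])
    show "\<bar>W (x, snd p)\<bar> \<le> c + 1" for x using weightD(4)[OF W, of "(x, snd p)"] by linarith
    show "0 < c + 1" using weightD(5)[OF W] by linarith
  qed (use section_meas(2)[OF W] in auto)
  then show ?thesis unfolding transfer_def using e by (intro tendsto_intros) auto
qed

lemma K_real: obtains k where "0 \<le> k" "K t = ennreal k"
proof -
  have "K t < \<infinity>" using K_le_B[of t] by (auto intro: le_less_trans)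
  then show thesis using that[of "enn2real (K t)"] by simp
qed

lemma integral_plan_le:
  assumes W: "weight W c" and p: "plan t W" and f: "f \<in> borel_measurable (borel \<Otimes>\<^sub>M borel)" "\<And>p. \<bar>f p\<bar> \<le> 1"
  shows "\<bar>\<integral>p. f p * W p \<partial>PU t\<bar> \<le> 1"
proof -
  have bound: "\<bar>f p * W p\<bar> \<le> W p" for p
    using mult_right_mono[OF f(2)[of p] weightD(2)[OF W, of p]] weightD(2)[OF W, of p] by (simp add: abs_mult)
  have i1: "integrable (PU t) W" by (rule integrable_PU[OF weightD(1,4)[OF W]])
  have i2: "integrable (PU t) (\<lambda>p. f p * W p)"
    using f(1) weightD(1)[OF W] order_trans[OF bound weightD(3)[OF W]] by (intro integrable_PU[where c = c]) auto
  have "\<bar>\<integral>p. f p * W p \<partial>PU t\<bar> \<le> (\<integral>p. W p \<partial>PU t)"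
    using i1 i2 bound by (intro order_trans[OF integral_abs_bound integral_mono]) auto
  also have "\<dots> = 1"
    using integral_pair_iterated(1)[OF mu prob_borel_unif weightD(1,4)[OF W], of t] p
      prob_space.prob_space[OF prob_borelD(1)[OF mu, of t]] by (simp add: plan_def)
  finally show ?thesis .
qed

text \<open>Near-optimal plans are glued along the parameter space: couplings may be mixed convexly, and
  the transferred templates near each point are near-optimal there.\<close>

lemma plan_family_exists:
  assumes \<eta>: "0 < \<eta>" "\<eta> \<le> 1"
  shows "\<exists>(V :: 'c \<Rightarrow> 'a \<times> real \<Rightarrow> real) (C :: 'c \<Rightarrow> real) (\<tau> :: 'c \<Rightarrow> real).
    (\<forall>s. weight (V s) (C s)) \<and> (\<forall>s. plan s (V s)) \<and>
    (\<forall>s. ennreal (cost s (V s)) \<le> K s + ennreal (\<eta> * (6 + 13 * B))) \<and>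
    (\<forall>\<Phi> t. (\<forall>s. \<Phi> s \<in> borel_measurable (borel \<Otimes>\<^sub>M borel)) \<longrightarrow> (\<forall>s p. \<bar>\<Phi> s p\<bar> \<le> 1) \<longrightarrow>
      (\<forall>s. s \<longlonglongrightarrow> t \<longrightarrow> (AE p in PU t. (\<lambda>n. \<Phi> (s n) p) \<longlonglongrightarrow> \<Phi> t p)) \<longrightarrow>
      isCont (\<lambda>s. \<integral>p. \<Phi> s p * V s p \<partial>PU s) t) \<and>
    (\<forall>t. isCont \<tau> t) \<and> (\<forall>s. 0 \<le> \<tau> s) \<and> (\<forall>s l. \<tau> s < real l + 1 \<longrightarrow> good \<eta> l s)"
proof -
  obtain W c m \<rho> where W: "\<And>t. weight (W t) (c t)" and one: "\<And>t x. (\<integral>u. W t (x, u) \<partial>unif) = 1"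
    and \<rho>: "\<And>t. 0 < \<rho> t" and gd: "\<And>s t. dist s t < \<rho> t \<Longrightarrow> good \<eta> (m t) s"
    and dens_le: "\<And>s t u. dist s t < \<rho> t \<Longrightarrow> dens s (W t) u \<le> 1 + 3 * \<eta>"
    and cost_le: "\<And>s t. dist s t < \<rho> t \<Longrightarrow> ennreal (cost s (W t)) \<le> K s + ennreal (\<eta> * (6 + 10 * B))"
    using template_map_exists[OF \<eta>] by metis
  obtain \<phi> :: "nat \<times> 'c \<Rightarrow> 'c \<Rightarrow> real" where \<phi>: "partition_of_unity \<phi>"
    and \<phi>_near: "\<And>i s. \<phi> i s \<noteq> 0 \<Longrightarrow> dist s (snd i) < \<rho> (snd i)"
    using partition_of_unity_exists[of \<rho>] \<rho> by metis
  define e where "e = 3 * \<eta>"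
  have e: "0 \<le> e" using \<eta> by (simp add: e_def)
  define A where "A i s = transfer s e (W (snd i))" for i :: "nat \<times> 'c" and s
  have A_w: "weight (A i s) (c (snd i) + 1)" and A_plan: "plan s (A i s)"
    and A_cost: "cost s (A i s) \<le> cost s (W (snd i)) + B * e" if "\<phi> i s \<noteq> 0" for i s
    using transfer_weight[OF e W one] transfer_plan[OF e W one] transfer_cost[OF e W one] dens_le[OF \<phi>_near[OF that]]
    by (simp_all add: A_def e_def)
  define J where "J s = {i. \<phi> i s \<noteq> 0}" for s
  have J: "finite (J s)" "(\<Sum>i\<in>J s. \<phi> i s) = 1" for s
    using \<phi> by (auto simp: J_def partition_of_unityD)
  have \<phi>0: "0 \<le> \<phi> i s" and \<phi>1: "\<phi> i s \<le> 1" for i s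
    using \<phi> by (auto simp: partition_of_unityD partition_of_unity_le_1)
  have \<phi>_cont: "isCont (\<phi> i) t" for i t
    using partition_of_unityD(1)[OF \<phi>] by (simp add: continuous_on_eq_continuous_at)
  define V where "V s p = (\<Sum>i\<in>J s. \<phi> i s * A i s p)" for s p
  define C where "C s = (\<Sum>i\<in>J s. \<phi> i s * (c (snd i) + 1))" for s
  have V_w: "weight (V s) (C s)" for s
  proof -
    have "V s \<in> borel_measurable (borel \<Otimes>\<^sub>M borel)"
      unfolding V_def[abs_def] using weightD(1)[OF A_w] by (auto simp: J_def)
    moreover have "0 \<le> V s p" for p
      unfolding V_def
    proof (rule sum_nonneg)
      show "0 \<le> \<phi> i s * A i s p" if "i \<in> J s" for i
        using that \<phi>0 weightD(2)[OF A_w] by (auto simp: J_def)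
    qed
    moreover have "V s p \<le> C s" for p
      unfolding V_def C_def
    proof (intro sum_mono mult_left_mono \<phi>0)
      show "A i s p \<le> c (snd i) + 1" if "i \<in> J s" for i
        using that weightD(3)[OF A_w] by (auto simp: J_def)
    qed
    ultimately show ?thesis by (simp add: weight_def)
  qed
  have V_plan: "plan s (V s)" for s
  proof -
    have "(\<integral>u. V s (x, u) \<partial>unif) = 1" for x
    proof -
      have "integrable unif (\<lambda>u. A i s (x, u))" if "i \<in> J s" for i
        using that A_w[of i s] by (intro integrable_bounded[OF prob_borelD(2,4)[OF prob_borel_unif]] section_meas weightD(4)) (auto simp: J_def)
      then have "(\<integral>u. V s (x, u) \<partial>unif) = (\<Sum>i\<in>J s. \<phi> i s * (\<integral>u. A i s (x, u) \<partial>unif))"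
        unfolding V_def by (subst Bochner_Integration.integral_sum) auto
      also have "\<dots> = (\<Sum>i\<in>J s. \<phi> i s)" using A_plan by (intro sum.cong) (auto simp: J_def plan_def)
      finally show ?thesis using J by simp
    qed
    moreover have "dens s (V s) u = 1" for u
    proof -
      have "integrable (\<mu> s) (\<lambda>x. A i s (x, u))" if "i \<in> J s" for i
        using that A_w[of i s] by (intro integrable_bounded[OF prob_borelD(2,4)[OF mu]] section_meas weightD(4)) (auto simp: J_def)
      then have "dens s (V s) u = (\<Sum>i\<in>J s. \<phi> i s * dens s (A i s) u)"
        unfolding dens_def V_def by (subst Bochner_Integration.integral_sum) auto
      also have "\<dots> = (\<Sum>i\<in>J s. \<phi> i s)" using A_plan by (intro sum.cong) (auto simp: J_def plan_def)
      finally show ?thesis using J by simp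
    qed
    ultimately show ?thesis by (simp add: plan_def)
  qed
  have V_int: "(\<integral>p. f p * V s p \<partial>PU s) = (\<Sum>i\<in>J s. \<phi> i s * (\<integral>p. f p * A i s p \<partial>PU s))"
    if f: "f \<in> borel_measurable (borel \<Otimes>\<^sub>M borel)" "\<And>p. \<bar>f p\<bar> \<le> b" for f s b
  proof -
    have "integrable (PU s) (\<lambda>p. f p * A i s p)" if "i \<in> J s" for i
    proof (rule integrable_PU)
      have w: "weight (A i s) (c (snd i) + 1)" using that by (intro A_w) (simp add: J_def)
      show "(\<lambda>p. f p * A i s p) \<in> borel_measurable (borel \<Otimes>\<^sub>M borel)" using f(1) weightD(1)[OF w] by auto
      show "\<bar>f p * A i s p\<bar> \<le> b * (c (snd i) + 1)" for p
        unfolding abs_mult using f(2)[of p] weightD(4)[OF w, of p] by (intro mult_mono) auto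
    qed
    then have "(\<Sum>i\<in>J s. \<phi> i s * (\<integral>p. f p * A i s p \<partial>PU s)) = (\<integral>p. (\<Sum>i\<in>J s. \<phi> i s * (f p * A i s p)) \<partial>PU s)"
      by (subst Bochner_Integration.integral_sum) auto
    also have "\<dots> = (\<integral>p. f p * V s p \<partial>PU s)"
      unfolding V_def sum_distrib_left by (intro Bochner_Integration.integral_cong sum.cong refl) (simp add: mult.left_commute)
    finally show ?thesis by simp
  qed
  have V_cost: "ennreal (cost s (V s)) \<le> K s + ennreal (\<eta> * (6 + 13 * B))" for s
  proof -
    obtain k where k: "0 \<le> k" "K s = ennreal k" by (rule K_real)
    have "\<bar>H s p\<bar> \<le> B" for p using H0[of s p] HB[of s p] by simp
    then have "cost s (V s) = (\<Sum>i\<in>J s. \<phi> i s * cost s (A i s))"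
      unfolding cost_def by (intro V_int[OF H_meas])
    also have "\<dots> \<le> (\<Sum>i\<in>J s. \<phi> i s * (k + \<eta> * (6 + 13 * B)))"
    proof (intro sum_mono mult_left_mono \<phi>0)
      fix i assume "i \<in> J s"
      then have i: "\<phi> i s \<noteq> 0" by (simp add: J_def)
      have "ennreal (cost s (W (snd i))) \<le> ennreal (k + \<eta> * (6 + 10 * B))"
        using cost_le[OF \<phi>_near[OF i]] k \<eta> B0 by (simp add: ennreal_plus)
      then have "cost s (W (snd i)) \<le> k + \<eta> * (6 + 10 * B)"
        using k \<eta> B0 by (subst (asm) ennreal_le_iff) auto
      moreover have "\<eta> * (6 + 10 * B) + B * e = \<eta> * (6 + 13 * B)" by (simp add: e_def algebra_simps)
      ultimately show "cost s (A i s) \<le> k + \<eta> * (6 + 13 * B)" using A_cost[OF i] by linarith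
    qed
    also have "\<dots> = k + \<eta> * (6 + 13 * B)" unfolding sum_distrib_right[symmetric] using J by simp
    finally have "ennreal (cost s (V s)) \<le> ennreal (k + \<eta> * (6 + 13 * B))" by (rule ennreal_leI)
    also have "\<dots> = K s + ennreal (\<eta> * (6 + 13 * B))" using k \<eta> B0 by (simp add: ennreal_plus)
    finally show ?thesis .
  qed
  \<comment> \<open>The test function may move with the parameter, because it will contain the
    indicator of a cell of a partition that itself depends on the parameter.\<close>
  have V_cont: "isCont (\<lambda>s. \<integral>p. \<Phi> s p * V s p \<partial>PU s) t"
    if \<Phi>: "\<And>s. \<Phi> s \<in> borel_measurable (borel \<Otimes>\<^sub>M borel)" "\<And>s p. \<bar>\<Phi> s p\<bar> \<le> 1"
      and lim: "\<And>s. s \<longlonglongrightarrow> t \<Longrightarrow> AE p in PU t. (\<lambda>n. \<Phi> (s n) p) \<longlonglongrightarrow> \<Phi> t p" for \<Phi> t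
  proof -
    define g where "g i s = (\<integral>p. \<Phi> s p * A i s p \<partial>PU s)" for i s
    have "isCont (\<lambda>s. \<Sum>i | \<phi> i s \<noteq> 0. \<phi> i s * g i s) t"
    proof (rule partition_of_unity_isCont_sum[OF \<phi>, where c = 1])
      show "\<bar>g i s\<bar> \<le> 1" if "\<phi> i s \<noteq> 0" for i s
        unfolding g_def using integral_plan_le[OF A_w[OF that] A_plan[OF that] \<Phi>] .
      show "isCont (\<lambda>s. \<phi> i s * g i s) t" for i
      proof (intro isCont_mult \<phi>_cont)
        note tb = transfer_bound[OF e W[of "snd i"]]
        have "(\<lambda>n. g i (s n)) \<longlonglongrightarrow> g i t" if s: "s \<longlonglongrightarrow> t" for s
          unfolding g_def
        proof (rule tv_dominated_convergence_pair[OF mu mu prob_borel_unif tv_seq[OF s], where c = "2 * c (snd i) + 1"])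
          show "(\<lambda>p. \<Phi> r p * A i r p) \<in> borel_measurable (borel \<Otimes>\<^sub>M borel)" for r
            unfolding A_def using \<Phi>(1)[of r] tb(1)[of r] by measurable
          then show "(\<lambda>p. \<Phi> t p * A i t p) \<in> borel_measurable (borel \<Otimes>\<^sub>M borel)" .
          show "\<bar>\<Phi> (s n) p * A i (s n) p\<bar> \<le> 2 * c (snd i) + 1" for n p
            unfolding abs_mult A_def using mult_mono[OF \<Phi>(2) tb(2)] by simp
          show "0 < 2 * c (snd i) + 1" using weightD(5)[OF W[of "snd i"]] by linarith
          show "AE p in PU t. (\<lambda>n. \<Phi> (s n) p * A i (s n) p) \<longlonglongrightarrow> \<Phi> t p * A i t p"
            using lim[OF s] unfolding A_def
            by eventually_elim (intro tendsto_mult transfer_tendsto[OF e W s])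
        qed
        then show "isCont (g i) t" by (simp add: continuous_at_sequentially o_def)
      qed
    qed
    moreover have "(\<integral>p. \<Phi> s p * V s p \<partial>PU s) = (\<Sum>i | \<phi> i s \<noteq> 0. \<phi> i s * g i s)" for s
      unfolding g_def J_def[symmetric] by (rule V_int[OF \<Phi>])
    ultimately show ?thesis by simp
  qed
  \<comment> \<open>The admissible level \<open>m\<close> is an integer and cannot vary
    continuously. The weighted mean of the meshes does, and \<tau> below is its level: if
    \<open>\<tau> s < l + 1\<close>, the mean exceeds \<open>(1/2)^(l + 1)\<close>, so some active
    template has level at most \<open>l\<close>.\<close>
  define T where "T s = (\<Sum>i | \<phi> i s \<noteq> 0. \<phi> i s * (1/2) ^ m (snd i))" for s
  have T_cont: "isCont T t" for t
    unfolding T_def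
    by (rule partition_of_unity_isCont_sum[OF \<phi>, where c = 1]) (auto intro!: isCont_mult \<phi>_cont power_le_one)
  have T_pos: "0 < T s" for s
  proof -
    have "J s \<noteq> {}" using J(2)[of s] by auto
    moreover have "0 < \<phi> i s * (1/2) ^ m (snd i)" if "i \<in> J s" for i
    proof -
      have "\<phi> i s \<noteq> 0" using that by (simp add: J_def)
      then have "0 < \<phi> i s" using \<phi>0[of i s] by linarith
      then show ?thesis by simp
    qed
    ultimately show ?thesis unfolding T_def J_def[symmetric] by (rule sum_pos[OF J(1)])
  qed
  have T_le: "T s \<le> 1" for s
  proof -
    have "T s \<le> (\<Sum>i\<in>J s. \<phi> i s * 1)"
      unfolding T_def J_def[symmetric] using \<phi>0 by (intro sum_mono mult_left_mono power_le_one) auto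
    then show ?thesis using J by simp
  qed
  define \<tau> where "\<tau> s = - log 2 (T s)" for s
  have \<tau>_cont: "isCont \<tau> t" for t
    unfolding \<tau>_def using T_cont[of t] T_pos[of t] by (intro continuous_intros) auto
  have \<tau>0: "0 \<le> \<tau> s" for s using T_le[of s] T_pos[of s] by (simp add: \<tau>_def)
  have \<tau>_good: "good \<eta> l s" if l: "\<tau> s < real l + 1" for s l
  proof -
    have "\<exists>i\<in>J s. m (snd i) \<le> l"
    proof (rule ccontr)
      assume no: "\<not> ?thesis"
      have "T s \<le> (\<Sum>i\<in>J s. \<phi> i s * (1/2) ^ Suc l)"
        unfolding T_def J_def[symmetric] using \<phi>0 no
        by (intro sum_mono mult_left_mono power_decreasing) (auto simp: not_le Suc_le_eq)
      also have "\<dots> = (1/2) ^ Suc l" unfolding sum_distrib_right[symmetric] using J by simp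
      finally have "log 2 (T s) \<le> log 2 ((1/2) ^ Suc l)" using T_pos[of s] by (subst log_le_cancel_iff) auto
      also have "\<dots> = real (Suc l) * log 2 (1/2)" by (rule log_nat_power) simp
      also have "log 2 (1/2 :: real) = - 1" by (simp add: log_divide)
      finally have "log 2 (T s) \<le> real (Suc l) * - 1" .
      moreover have "real (Suc l) * - 1 = - (real l + 1)" by simp
      ultimately show False using l unfolding \<tau>_def by linarith
    qed
    then obtain i where i: "\<phi> i s \<noteq> 0" "m (snd i) \<le> l" by (auto simp: J_def)
    from good_mono[OF gd[OF \<phi>_near[OF i(1)]] i(2)] show ?thesis .
  qed
  show ?thesis
    by (intro exI[of _ V] exI[of _ C] exI[of _ \<tau>] conjI allI impI V_w V_plan V_cost V_cont \<tau>_cont \<tau>0 \<tau>_good) blast+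
qed

section \<open>Monge maps\<close>

text \<open>The mass at \<open>x\<close> is discretized at level \<open>\<lfloor>\<tau> s + F s x\<rfloor>\<close>, where \<open>F s x\<close> is uniformly
  distributed on \<open>(0, 1)\<close>: for almost every \<open>x\<close> the level, hence the cell of \<open>x\<close>, is locally constant
  in \<open>s\<close>, although the admissible mesh size depends on \<open>s\<close>. On each cell the second marginal of the
  plan is realized by the composition of the conditional distribution function with a parametrization
  of that marginal.\<close>

theorem monge_maps_exist:
  assumes \<epsilon>: "0 < \<epsilon>"
  shows "\<exists>S :: 'c \<Rightarrow> 'a \<Rightarrow> 'b.
    (\<forall>t. eps_optimal_monge \<epsilon> (\<lambda>x y. h x y t) (\<mu> t) (\<nu> t) (S t)) \<and>
    (\<forall>t s. s \<longlonglongrightarrow> t \<longrightarrow> (AE x in \<mu> t. (\<lambda>n. S (s n) x) \<longlonglongrightarrow> S t x))"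
proof -
  interpret m: prob_space "\<mu> t" for t using mu by (rule prob_borelD)
  interpret un: prob_space unif using prob_borel_unif by (rule prob_borelD)
  note s\<mu> = prob_borelD(2)[OF mu] and sp\<mu> = prob_borelD(3)[OF mu]
  \<comment> \<open>The plans cost \<open>\<eta> * (6 + 13 * B)\<close> above the optimum, and
    replacing them by maps costs another \<open>2 * (\<eta> + 2 * B * \<eta>)\<close>.\<close>
  define \<eta> where "\<eta> = min 1 (\<epsilon> / (8 + 17 * B))"
  have \<eta>: "0 < \<eta>" "\<eta> \<le> 1" using \<epsilon> B0 by (auto simp: \<eta>_def)
  have \<eta>\<epsilon>: "\<eta> * (8 + 17 * B) \<le> \<epsilon>"
  proof -
    have "\<eta> \<le> \<epsilon> / (8 + 17 * B)" by (simp add: \<eta>_def)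
    then show ?thesis using B0 by (simp add: le_divide_eq)
  qed
  obtain V C \<tau> where "\<forall>s. weight (V s) (C s)" "\<forall>s. plan s (V s)"
    and "\<forall>s. ennreal (cost s (V s)) \<le> K s + ennreal (\<eta> * (6 + 13 * B))"
    and cont: "\<forall>\<Phi> t. (\<forall>s. \<Phi> s \<in> borel_measurable (borel \<Otimes>\<^sub>M borel)) \<longrightarrow> (\<forall>s p. \<bar>\<Phi> s p\<bar> \<le> 1) \<longrightarrow>
      (\<forall>s. s \<longlonglongrightarrow> t \<longrightarrow> (AE p in PU t. (\<lambda>n. \<Phi> (s n) p) \<longlonglongrightarrow> \<Phi> t p)) \<longrightarrow>
      isCont (\<lambda>s. \<integral>p. \<Phi> s p * V s p \<partial>PU s) t"
    and "\<forall>t. isCont \<tau> t" "\<forall>s. 0 \<le> \<tau> s" "\<forall>s l. \<tau> s < real l + 1 \<longrightarrow> good \<eta> l s"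
    using plan_family_exists[OF \<eta>]
    apply (elim exE conjE)
    subgoal for V C \<tau> by (rule that[of V C \<tau>])
    done
  then have V: "\<And>s. weight (V s) (C s)" and V_plan: "\<And>s. plan s (V s)"
    and V_cost: "\<And>s. ennreal (cost s (V s)) \<le> K s + ennreal (\<eta> * (6 + 13 * B))"
    and \<tau>_cont: "\<And>t. isCont \<tau> t" and \<tau>0: "\<And>s. 0 \<le> \<tau> s"
    and \<tau>_good: "\<And>s l. \<tau> s < real l + 1 \<Longrightarrow> good \<eta> l s"
    by simp_all
  note V_cont = cont[rule_format]
  obtain f :: "'a \<Rightarrow> real" where f[measurable]: "f \<in> borel_measurable borel" and inj: "inj f"
    using borel_injection_real by blast
  obtain cell :: "nat \<Rightarrow> 'a \<Rightarrow> nat" where cell[measurable]: "\<And>l. cell l \<in> borel \<rightarrow>\<^sub>M count_space UNIV"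
    and cell_dist: "\<And>l x y. cell l x = cell l y \<Longrightarrow> dist x y < (1/2)^l"
    using small_cells_exist by metis
  have vimf[measurable]: "f -` {..a} \<in> sets borel" for a using measurable_sets[OF f, of "{..a}"] by simp
  define F where "F s x = measure (\<mu> s) (UNIV \<inter> f -` {..f x})" for s x
  have F_meas[measurable]: "F s \<in> borel_measurable borel" and F_distr: "distr (\<mu> s) borel (F s) = unif" for s
    using distr_cdf_comp[OF mu mu_nonatomic f inj, of UNIV s] m.prob_space[of s]
    by (simp_all add: F_def[abs_def] density_1 unif_def sp\<mu>)
  have F0: "0 \<le> F s x" for s x by (simp add: F_def)
  have F_lim: "(\<lambda>n. F (s n) x) \<longlonglongrightarrow> F t x" if s: "s \<longlonglongrightarrow> t" for s t x
  proof -
    have "(\<lambda>n. F (s n) x - F t x) \<longlonglongrightarrow> 0"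
      unfolding F_def
      by (rule Lim_null_comparison[OF _ tv_seq[OF s]]) (auto intro!: always_eventually tv_dist_ge mu)
    then show ?thesis by (simp add: LIM_zero_iff)
  qed
  define lv where "lv s x = nat \<lfloor>\<tau> s + F s x\<rfloor>" for s x
  define k where "k s x = prod_encode (lv s x, cell (lv s x) x)" for s x
  have lv_meas[measurable]: "lv s \<in> borel \<rightarrow>\<^sub>M count_space UNIV" for s
    unfolding lv_def[abs_def] by measurable
  have k_meas[measurable]: "k s \<in> borel \<rightarrow>\<^sub>M count_space UNIV" for s
    unfolding k_def[abs_def]
    by (rule measurable_compose_countable[OF _ lv_meas]) (rule measurable_compose[OF cell], simp)
  have k_lim: "AE x in \<mu> t. \<forall>\<^sub>F n in sequentially. k (s n) x = k t x" if s: "s \<longlonglongrightarrow> t" for s t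
  proof -
    \<comment> \<open>The floor in \<open>lv\<close> is locally constant unless its argument is an
      integer, which happens for countably many values of \<open>F t x\<close>, hence on a null set
      because \<open>F t\<close> is uniformly distributed.\<close>
    have "countable {u :: real. \<tau> t + u \<in> \<int>}"
    proof -
      have "{u. \<tau> t + u \<in> \<int>} = (\<lambda>z. z - \<tau> t) ` \<int>" by (auto simp: image_iff) (metis add_diff_cancel_left')
      then show ?thesis by (simp add: countable_int)
    qed
    then have "AE u in lborel. \<tau> t + u \<notin> \<int>"
      by (intro AE_I'[OF countable_imp_null_set_lborel]) auto
    then have "AE u in unif. \<tau> t + u \<notin> \<int>"
      unfolding unif_def by (subst AE_density_indicator_iff) auto
    then have "AE x in \<mu> t. \<tau> t + F t x \<notin> \<int>"
      unfolding F_distr[of t, symmetric] by (rule AE_distrD[rotated]) (simp add: measurable_cong_sets[OF s\<mu> refl])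
    then show ?thesis
    proof eventually_elim
      case (elim x)
      have "(\<lambda>n. \<tau> (s n) + F (s n) x) \<longlonglongrightarrow> \<tau> t + F t x"
        using isCont_tendsto_compose[OF \<tau>_cont s] F_lim[OF s] by (rule tendsto_add)
      from eventually_floor_eq[OF this elim] show ?case by eventually_elim (simp add: k_def lv_def)
    qed
  qed
  \<comment> \<open>Since \<open>F\<close> is nonnegative, every cell in use at \<open>s\<close> has
    at least the level given by the floor of \<open>\<tau> s\<close>, and that level is already
    good.\<close>
  have k_good: "\<exists>l. good \<eta> l s \<and> (\<forall>x y. k s x = k s y \<longrightarrow> dist x y < (1/2)^l)" for s
  proof -
    define l where "l = nat \<lfloor>\<tau> s\<rfloor>"
    have "\<tau> s < real l + 1" using \<tau>0[of s] unfolding l_def by linarith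
    then have "good \<eta> l s" by (rule \<tau>_good)
    moreover have "dist x y < (1/2)^l" if "k s x = k s y" for x y
    proof -
      have eq: "lv s x = lv s y" "cell (lv s x) x = cell (lv s x) y" using that by (auto simp: k_def)
      have "\<tau> s \<le> \<tau> s + F s x" using F0 by simp
      then have "l \<le> lv s x" unfolding l_def lv_def by (intro nat_mono floor_mono)
      then have "(1/2::real)^lv s x \<le> (1/2)^l" by (intro power_decreasing) auto
      with cell_dist[OF eq(2)] show ?thesis by linarith
    qed
    ultimately show ?thesis by blast
  qed
  define D where "D i s = k s -` {i}" for i s
  have D[measurable]: "D i s \<in> sets borel" for i s unfolding D_def by (rule count_space_vimage[OF k_meas])
  have D_lim: "AE x in \<mu> t. (\<lambda>n. indicator (D i (s n)) x :: real) \<longlonglongrightarrow> indicator (D i t) x" if s: "s \<longlonglongrightarrow> t" for i s t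
    using k_lim[OF s]
  proof eventually_elim
    case (elim x)
    from elim show ?case
      by (intro tendsto_eventually) (auto elim!: eventually_mono simp: D_def indicator_def)
  qed
  \<comment> \<open>The part of the second marginal of the plan coming from cell \<open>i\<close>,
    in the coordinate \<open>u\<close> rather than in Y. On the real line finite Borel measures are
    automatically Radon, so the parametrization theorem applies to each \<open>i\<close>
    separately.\<close>
  define n where "n i s = distr (density (PU s) (\<lambda>p. ennreal (indicator (D i s) (fst p) * V s p))) borel snd" for i s
  have DV_meas: "(\<lambda>p. indicator (D i s) (fst p) * V s p) \<in> borel_measurable (borel \<Otimes>\<^sub>M borel)" for i s
    using weightD(1)[OF V[of s]] by measurable
  have DV_bound: "0 \<le> indicator (D i s) (fst p) * V s p" "\<bar>indicator (D i s) (fst p) * V s p\<bar> \<le> C s" for i s p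
    using weightD(2,4,5)[OF V[of s]] by (auto simp: indicator_def)
  have sn: "sets (n i s) = sets borel" for i s by (simp add: n_def)
  have snd_meas: "snd \<in> borel_measurable (density (PU s) (\<lambda>p. ennreal (indicator (D i s) (fst p) * V s p)))" for i s
    by (simp add: measurable_PU)
  have n_em: "emeasure (n i s) E = ennreal (\<integral>p. indicator (D i s) (fst p) * indicator E (snd p) * V s p \<partial>PU s)"
    if [measurable]: "E \<in> sets borel" for i s E
  proof -
    have DVm: "(\<lambda>p. ennreal (indicator (D i s) (fst p) * V s p)) \<in> borel_measurable (PU s)"
      using DV_meas by (simp add: measurable_PU)
    have EP: "snd -` E \<in> sets (PU s)"
      unfolding sets_PU using measurable_sets[OF measurable_snd that, of borel] by (simp add: space_pair_measure)
    have "emeasure (n i s) E = emeasure (density (PU s) (\<lambda>p. ennreal (indicator (D i s) (fst p) * V s p))) (snd -` E)"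
      unfolding n_def using that by (subst emeasure_distr[OF snd_meas]) (auto simp: space_pair_measure sp\<mu>)
    also have "\<dots> = (\<integral>\<^sup>+p. ennreal (indicator (D i s) (fst p) * V s p) * indicator (snd -` E) p \<partial>PU s)"
      using DVm EP by (rule emeasure_density)
    also have "\<dots> = (\<integral>\<^sup>+p. ennreal (indicator (D i s) (fst p) * indicator E (snd p) * V s p) \<partial>PU s)"
      by (intro nn_integral_cong) (auto simp: indicator_def)
    also have "\<dots> = ennreal (\<integral>p. indicator (D i s) (fst p) * indicator E (snd p) * V s p \<partial>PU s)"
    proof (rule nn_integral_eq_integral)
      show "integrable (PU s) (\<lambda>p. indicator (D i s) (fst p) * indicator E (snd p) * V s p)"
      proof (rule integrable_PU)
        show "(\<lambda>p. indicator (D i s) (fst p) * indicator E (snd p) * V s p) \<in> borel_measurable (borel \<Otimes>\<^sub>M borel)"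
          using weightD(1)[OF V[of s]] by measurable
        show "\<bar>indicator (D i s) (fst p) * indicator E (snd p) * V s p\<bar> \<le> C s" for p
          using weightD(4,5)[OF V[of s]] by (auto simp: indicator_def)
      qed
    qed (auto simp: weightD(2)[OF V])
    finally show ?thesis .
  qed
  have n_fin: "finite_measure (n i s)" for i s
    using n_em[of UNIV i s] by (intro finite_measureI) (simp add: sets_eq_imp_space_eq[OF sn])
  have n_mass: "measure (n i s) UNIV = measure (\<mu> s) (D i s)" for i s
  proof -
    have "(\<integral>p. indicator (D i s) (fst p) * V s p \<partial>PU s) = (\<integral>x. \<integral>u. indicator (D i s) x * V s (x, u) \<partial>unif \<partial>\<mu> s)"
      using integral_pair_iterated(1)[OF mu prob_borel_unif DV_meas DV_bound(2)] by simp
    also have "\<dots> = (\<integral>x. indicator (D i s) x \<partial>\<mu> s)" using V_plan[of s] by (simp add: plan_def del: Bochner_Integration.integral_indicator)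
    finally have "(\<integral>p. indicator (D i s) (fst p) * V s p \<partial>PU s) = measure (\<mu> s) (D i s)"
      unfolding integral_indicator_mu[OF D] .
    then show ?thesis using n_em[of UNIV i s] by (simp add: measure_def)
  qed
  have n_weak: "continuous_on UNIV (\<lambda>s. \<integral>y. g y \<partial>n i s)"
    if g: "continuous_on UNIV g" "\<And>y. \<bar>g y :: real\<bar> \<le> b" for g b i
  proof -
    \<comment> \<open>\<open>V_cont\<close> asks for test functions bounded by 1, so
      \<open>g\<close> is normalized; the lower bound 1 makes the division safe.\<close>
    define b' where "b' = max b 1"
    have b': "0 < b'" "\<bar>g y\<bar> \<le> b'" for y using g(2)[of y] by (auto simp: b'_def)
    have gm[measurable]: "g \<in> borel_measurable borel" using g(1) by (rule borel_measurable_continuous_onI)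
    have eq: "(\<integral>y. g y \<partial>n i s) = b' * (\<integral>p. g (snd p) / b' * indicator (D i s) (fst p) * V s p \<partial>PU s)" for s
    proof -
      have "(\<integral>y. g y \<partial>n i s) = (\<integral>p. g (snd p) \<partial>density (PU s) (\<lambda>p. ennreal (indicator (D i s) (fst p) * V s p)))"
        unfolding n_def by (rule integral_distr[OF snd_meas gm])
      also have "\<dots> = (\<integral>p. indicator (D i s) (fst p) * V s p * g (snd p) \<partial>PU s)"
        using DV_meas DV_bound(1) by (subst integral_density) (auto simp: measurable_PU)
      also have "\<dots> = (\<integral>p. b' * (g (snd p) / b' * indicator (D i s) (fst p) * V s p) \<partial>PU s)"
        using b'(1) by (intro Bochner_Integration.integral_cong) auto
      also have "\<dots> = b' * (\<integral>p. g (snd p) / b' * indicator (D i s) (fst p) * V s p \<partial>PU s)"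
        by (rule integral_mult_right_zero)
      finally show ?thesis .
    qed
    have "isCont (\<lambda>s. \<integral>p. g (snd p) / b' * indicator (D i s) (fst p) * V s p \<partial>PU s) t" for t
    proof (rule V_cont)
      show "(\<lambda>p. g (snd p) / b' * indicator (D i s) (fst p)) \<in> borel_measurable (borel \<Otimes>\<^sub>M borel)" for s by measurable
      show "\<bar>g (snd p) / b' * indicator (D i s) (fst p)\<bar> \<le> 1" for s p
        using b'(1) b'(2)[of "snd p"] by (auto simp: indicator_def abs_mult)
      show "AE p in PU t. (\<lambda>n. g (snd p) / b' * indicator (D i (s n)) (fst p)) \<longlonglongrightarrow> g (snd p) / b' * indicator (D i t) (fst p)"
        if "s \<longlonglongrightarrow> t" for s
        using AE_pair_fst[OF mu prob_borel_unif D_lim[OF that, of i]] by eventually_elim (rule tendsto_mult_left)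
    qed
    from isCont_mult[OF continuous_const this] show ?thesis
      unfolding eq continuous_on_eq_continuous_at[OF open_UNIV] by blast
  qed
  have "\<exists>z :: 'c \<Rightarrow> real \<Rightarrow> real. (\<forall>t. z t \<in> borel_measurable borel) \<and>
      (\<forall>t. distr (density lborel (indicator {0<..<measure (\<mu> t) (D i t)})) borel (z t) = n i t) \<and>
      (\<forall>t. AE u in density lborel (indicator {0<..<measure (\<mu> t) (D i t)}). isCont (\<lambda>(s, v). z s v) (t, u))" for i
    unfolding n_mass[symmetric]
  proof (rule skorokhod_parametrization)
    show "radon_measure (n i t)" for t by (rule radon_measure_polish[OF sn n_fin])
    show "continuous_on UNIV (\<lambda>t. \<integral>y. g y \<partial>n i t)"
      if "continuous_on UNIV g" "\<And>y. \<bar>g y :: real\<bar> \<le> b" for g b by (rule n_weak[OF that])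
  qed
  then obtain z :: "nat \<Rightarrow> 'c \<Rightarrow> real \<Rightarrow> real" where z_meas[measurable]: "\<And>i t. z i t \<in> borel_measurable borel"
    and z_law: "\<And>i t. distr (density lborel (indicator {0<..<measure (\<mu> t) (D i t)})) borel (z i t) = n i t"
    and z_cont: "\<And>i t. AE u in density lborel (indicator {0<..<measure (\<mu> t) (D i t)}). isCont (\<lambda>(s, v). z i s v) (t, u)"
    by metis
  define G where "G i s x = measure (\<mu> s) (D i s \<inter> f -` {..f x})" for i s x
  have G_meas[measurable]: "G i s \<in> borel_measurable borel"
    and G_distr: "distr (density (\<mu> s) (indicator (D i s))) borel (G i s) = density lborel (indicator {0<..<measure (\<mu> s) (D i s)})" for i s
    using distr_cdf_comp[OF mu mu_nonatomic f inj D] by (simp_all add: G_def[abs_def])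
  have G_lim: "(\<lambda>n. G i (s n) x) \<longlonglongrightarrow> G i t x" if s: "s \<longlonglongrightarrow> t" for i s t x
  proof -
    have eq: "G i r x = (\<integral>y. indicator (D i r) y * indicator (f -` {..f x}) y \<partial>\<mu> r)" for r
      unfolding G_def indicator_inter_arith[symmetric] by (rule integral_indicator_mu[symmetric]) measurable
    show ?thesis
      unfolding eq
    proof (rule tv_dominated_convergence[OF mu mu tv_seq[OF s], where c = 1])
      show "AE y in \<mu> t. (\<lambda>n. indicator (D i (s n)) y * indicator (f -` {..f x}) y :: real) \<longlonglongrightarrow> indicator (D i t) y * indicator (f -` {..f x}) y"
        using D_lim[OF s, of i] by eventually_elim (rule tendsto_mult_right)
    qed (auto simp: indicator_def)
  qed
  \<comment> \<open>On cell \<open>i\<close>, \<open>G i s\<close> carries \<open>\<mu> s\<close> to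
    Lebesgue measure on an interval of the mass of the cell, and \<open>z i s\<close> carries this
    to \<open>n i s\<close>. Summed over the cells the law is the second marginal of the plan in the
    coordinate \<open>u\<close>, which is uniform.\<close>
  define R where "R s x = z (k s x) s (G (k s x) s x)" for s x
  have R_meas[measurable]: "R s \<in> borel_measurable borel" for s
    unfolding R_def[abs_def] by (rule measurable_compose_countable[OF _ k_meas]) measurable
  have zG_meas: "(\<lambda>x. z i s (G i s x)) \<in> borel_measurable borel" for i s by measurable
  \<comment> \<open>Cell by cell, the graph of \<open>R s\<close> and the plan have the same second
    marginal. This gives the law of \<open>R s\<close> as well as the agreement needed by
    \<open>coupling_cost_le\<close>.\<close>
  have R_D: "emeasure (\<mu> s) (D i s \<inter> R s -` E) = emeasure (n i s) E" if E: "E \<in> sets borel" for i s E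
  proof -
    have Gm: "G i s \<in> borel_measurable (density (\<mu> s) (indicator (D i s)))"
      using G_meas by (simp add: measurable_cong_sets[OF s\<mu> refl])
    have "n i s = distr (density (\<mu> s) (indicator (D i s))) borel (\<lambda>x. z i s (G i s x))"
      unfolding z_law[symmetric] G_distr[symmetric] using z_meas Gm by (subst distr_distr) (auto simp: o_def)
    then have "emeasure (n i s) E = emeasure (density (\<mu> s) (indicator (D i s))) ((\<lambda>x. z i s (G i s x)) -` E)"
      using E zG_meas by (simp add: emeasure_distr measurable_cong_sets[OF s\<mu> refl] sp\<mu>)
    also have "\<dots> = (\<integral>\<^sup>+x. indicator (D i s) x * indicator ((\<lambda>x. z i s (G i s x)) -` E) x \<partial>\<mu> s)"
    proof (rule emeasure_density)
      show "indicator (D i s) \<in> borel_measurable (\<mu> s)"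
        by (rule borel_measurable_indicator) (simp add: s\<mu>)
      show "(\<lambda>x. z i s (G i s x)) -` E \<in> sets (\<mu> s)" using measurable_sets[OF zG_meas E] by (simp add: s\<mu>)
    qed
    also have "\<dots> = (\<integral>\<^sup>+x. indicator (D i s \<inter> R s -` E) x \<partial>\<mu> s)"
      by (intro nn_integral_cong) (auto simp: indicator_def D_def R_def)
    also have "\<dots> = emeasure (\<mu> s) (D i s \<inter> R s -` E)"
      using measurable_sets[OF R_meas E] D by (intro nn_integral_indicator) (auto simp: s\<mu>)
    finally show ?thesis ..
  qed
  have R_distr: "distr (\<mu> s) borel (R s) = unif" for s
  proof (rule measure_eqI)
    fix E assume "E \<in> sets (distr (\<mu> s) borel (R s))"
    then have E: "E \<in> sets borel" by simp
    have RE: "R s -` E \<in> sets borel" using measurable_sets[OF R_meas E] by simp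
    have VE: "(\<lambda>p. indicator E (snd p) * V s p) \<in> borel_measurable (borel \<Otimes>\<^sub>M borel)"
      using weightD(1)[OF V[of s]] E by measurable
    have "emeasure (distr (\<mu> s) borel (R s)) E = emeasure (\<mu> s) (R s -` E)"
      using E by (simp add: emeasure_distr measurable_cong_sets[OF s\<mu> refl] sp\<mu>)
    also have "R s -` E = (\<Union>i. D i s \<inter> R s -` E)" by (auto simp: D_def)
    also have "emeasure (\<mu> s) \<dots> = (\<Sum>i. emeasure (\<mu> s) (D i s \<inter> R s -` E))"
    proof (rule suminf_emeasure[symmetric])
      show "range (\<lambda>i. D i s \<inter> R s -` E) \<subseteq> sets (\<mu> s)" using D RE by (auto simp: s\<mu>)
      show "disjoint_family (\<lambda>i. D i s \<inter> R s -` E)" by (auto simp: disjoint_family_on_def D_def)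
    qed
    also have "\<dots> = (\<Sum>i. ennreal (\<integral>p. indicator (D i s) (fst p) * indicator E (snd p) * V s p \<partial>PU s))"
      by (simp add: R_D[OF E] n_em[OF E])
    also have "\<dots> = (\<Sum>i. \<integral>\<^sup>+p. ennreal (indicator (D i s) (fst p) * indicator E (snd p) * V s p) \<partial>PU s)"
    proof (intro suminf_cong nn_integral_eq_integral[symmetric] integrable_PU)
      show "(\<lambda>p. indicator (D i s) (fst p) * indicator E (snd p) * V s p) \<in> borel_measurable (borel \<Otimes>\<^sub>M borel)" for i
        using weightD(1)[OF V[of s]] E by measurable
      show "\<bar>indicator (D i s) (fst p) * indicator E (snd p) * V s p\<bar> \<le> C s" for i p
        using weightD(4,5)[OF V[of s]] by (auto simp: indicator_def)
    qed (auto simp: weightD(2)[OF V])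
    also have "\<dots> = (\<integral>\<^sup>+p. (\<Sum>i. ennreal (indicator (D i s) (fst p) * indicator E (snd p) * V s p)) \<partial>PU s)"
      using weightD(1)[OF V[of s]] E by (intro nn_integral_suminf[symmetric]) (simp add: measurable_PU)
    also have "\<dots> = (\<integral>\<^sup>+p. ennreal (indicator E (snd p) * V s p) \<partial>PU s)"
    proof (rule nn_integral_cong)
      fix p :: "'a \<times> real"
      have "(\<lambda>i. ennreal (indicator (D i s) (fst p) * indicator E (snd p) * V s p)) sums
          (\<Sum>i\<in>{k s (fst p)}. ennreal (indicator (D i s) (fst p) * indicator E (snd p) * V s p))"
        by (rule sums_finite) (auto simp: D_def)
      then show "(\<Sum>i. ennreal (indicator (D i s) (fst p) * indicator E (snd p) * V s p)) = ennreal (indicator E (snd p) * V s p)"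
        by (simp add: sums_iff D_def)
    qed
    also have "\<dots> = ennreal (\<integral>p. indicator E (snd p) * V s p \<partial>PU s)"
      using weightD(4,5)[OF V[of s]] weightD(2)[OF V[of s]]
      by (intro nn_integral_eq_integral integrable_PU[OF VE, where c = "C s"]) (auto simp: indicator_def)
    also have "(\<integral>p. indicator E (snd p) * V s p \<partial>PU s) = (\<integral>u. indicator E u * dens s (V s) u \<partial>unif)"
      using weightD(4,5)[OF V[of s]]
      by (subst integral_pair_iterated(2)[OF mu prob_borel_unif VE, where c = "C s"]) (auto simp: indicator_def dens_def)
    also have "\<dots> = measure unif E" using V_plan[of s] E by (simp add: plan_def)
    finally show "emeasure (distr (\<mu> s) borel (R s)) E = emeasure unif E" by (simp add: un.emeasure_eq_measure)
  qed simp
  define S where "S s x = \<xi> s (R s x)" for s x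
  have S_meas: "S s \<in> borel_measurable borel" for s unfolding S_def[abs_def] by measurable
  have S_distr: "distr (\<mu> s) borel (S s) = \<nu> s" for s
  proof -
    have "distr (\<mu> s) borel (S s) = distr (distr (\<mu> s) borel (R s)) borel (\<xi> s)"
      by (subst distr_distr) (auto simp: o_def S_def[abs_def] measurable_cong_sets[OF s\<mu> refl])
    then show ?thesis by (simp add: R_distr xi_law)
  qed
  have S_cost: "(\<integral>\<^sup>+x. ennreal (h x (S s x) s) \<partial>\<mu> s) \<le> K s + ennreal \<epsilon>" for s
  proof -
    have gm: "(\<lambda>x. (x, S s x)) \<in> borel_measurable borel"
    proof -
      have "(\<lambda>x. (x, S s x)) \<in> borel \<rightarrow>\<^sub>M (borel :: 'a measure) \<Otimes>\<^sub>M (borel :: 'b measure)"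
        using S_meas by measurable
      moreover have "measurable M (borel :: ('a \<times> 'b) measure) = measurable M (borel \<Otimes>\<^sub>M borel)" for M :: "'a measure"
        by (rule measurable_cong_sets) (simp_all only: sets_borel_prod_second_countable)
      ultimately show ?thesis by simp
    qed
    then have gm': "(\<lambda>x. (x, S s x)) \<in> borel_measurable (\<mu> s)" by (simp add: measurable_cong_sets[OF s\<mu> refl])
    define \<sigma>' where "\<sigma>' = distr (\<mu> s) borel (\<lambda>x. (x, S s x))"
    have \<sigma>'_em: "emeasure \<sigma>' (A \<times> E) = emeasure (\<mu> s) (A \<inter> S s -` E)" if "A \<in> sets borel" "E \<in> sets borel" for A E
      unfolding \<sigma>'_def using times_borel[OF that]
      by (subst emeasure_distr[OF gm']) (auto simp: sp\<mu> intro!: arg_cong[where f = "emeasure (\<mu> s)"])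
    obtain l where l: "good \<eta> l s" "\<And>x y. k s x = k s y \<Longrightarrow> dist x y < (1/2)^l" using k_good by blast
    from l(1) obtain A E where AE: "A \<in> sets borel" "E \<in> sets borel" "measure (\<mu> s) A \<le> \<eta>" "measure (\<nu> s) E \<le> \<eta>"
      "\<And>x x' y. x \<notin> A \<Longrightarrow> y \<notin> E \<Longrightarrow> dist x x' < (1/2)^l \<Longrightarrow> \<bar>h x y s - h x' y s\<bar> \<le> \<eta>"
      unfolding good_def by blast
    interpret nn: prob_space "\<nu> s" using nu by (rule prob_borelD)
    have plan_int: "\<And>x. (\<integral>u. V s (x, u) \<partial>unif) = 1" "\<And>u. dens s (V s) u = 1" using V_plan[of s] by (auto simp: plan_def)
    have cmp: "(\<integral>\<^sup>+p. ennreal ((\<lambda>(x, y). h x y s) p) \<partial>\<sigma>') \<le>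
        (\<integral>\<^sup>+p. ennreal ((\<lambda>(x, y). h x y s) p) \<partial>coupling_of s (V s)) + ennreal (2 * (\<eta> + B * (\<eta> + \<eta>)))"
    proof (rule coupling_cost_le[OF sets_coupling_of _ _ _ k_meas[of s]])
      show "sets \<sigma>' = sets borel" by (simp add: \<sigma>'_def)
      show "emeasure (coupling_of s (V s)) UNIV \<le> 1"
        using emeasure_coupling_of_margins(3)[OF V[of s] _ sets.empty_sets plan_int(1), of UNIV] m.prob_space[of s] by (simp add: sp\<mu>)
      show "emeasure \<sigma>' UNIV \<le> 1"
        using \<sigma>'_em[of UNIV UNIV] m.emeasure_space_1[of s] by (simp add: sp\<mu>)
      show "emeasure (coupling_of s (V s)) (k s -` {i} \<times> X) = emeasure \<sigma>' (k s -` {i} \<times> X)" if X: "X \<in> sets borel" for i X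
      proof -
        have xX: "\<xi> s -` X \<in> sets borel" using measurable_sets[OF xi_meas X] by simp
        have "emeasure \<sigma>' (D i s \<times> X) = emeasure (\<mu> s) (D i s \<inter> R s -` (\<xi> s -` X))"
          by (simp add: \<sigma>'_em[OF D X] S_def[abs_def] vimage_def)
        also have "\<dots> = ennreal (\<integral>p. indicator (D i s) (fst p) * indicator (\<xi> s -` X) (snd p) * V s p \<partial>PU s)"
          by (simp add: R_D[OF xX] n_em[OF xX])
        also have "\<dots> = emeasure (coupling_of s (V s)) (D i s \<times> X)"
          by (simp add: emeasure_coupling_of[OF V D X] indicator_vimage[unfolded o_def])
        finally show ?thesis by (simp add: D_def)
      qed
      show "A \<in> sets borel" "E \<in> sets borel" by fact+
      show "emeasure (coupling_of s (V s)) (A \<times> UNIV) \<le> ennreal \<eta>"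
        using emeasure_coupling_of_margins(3)[OF V[of s] AE(1) sets.empty_sets plan_int(1)] ennreal_leI[OF AE(3)] by simp
      show "emeasure \<sigma>' (A \<times> UNIV) \<le> ennreal \<eta>"
        using \<sigma>'_em[OF AE(1), of UNIV] ennreal_leI[OF AE(3)] by (simp add: m.emeasure_eq_measure)
      show "emeasure (coupling_of s (V s)) (UNIV \<times> E) \<le> ennreal \<eta>"
        using emeasure_coupling_of_margins(4)[OF V[of s] sets.empty_sets AE(2) plan_int(2)] ennreal_leI[OF AE(4)] by simp
      have "emeasure (\<mu> s) (S s -` E) = emeasure (\<nu> s) E"
        unfolding S_distr[symmetric] using AE(2) S_meas by (simp add: emeasure_distr measurable_cong_sets[OF s\<mu> refl] sp\<mu>)
      then show "emeasure \<sigma>' (UNIV \<times> E) \<le> ennreal \<eta>"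
        using \<sigma>'_em[OF _ AE(2), of UNIV] ennreal_leI[OF AE(4)] by (simp add: nn.emeasure_eq_measure)
      show "(\<lambda>(x, y). h x y s) \<in> borel_measurable borel" by (rule h_meas)
      show "\<bar>(case (x, y) of (x, y) \<Rightarrow> h x y s) - (case (x', y) of (x, y) \<Rightarrow> h x y s)\<bar> \<le> \<eta>"
        if "x \<notin> A" "y \<notin> E" "k s x = k s x'" for x x' y
        using AE(5)[OF that(1,2) l(2)[OF that(3)]] by simp
    qed (use \<eta> h0 hB in auto)
    have eq: "(\<lambda>p. ennreal ((\<lambda>(x, y). h x y s) p)) = (\<lambda>(x, y). ennreal (h x y s))"
      by (simp add: fun_eq_iff)
    from cmp have "(\<integral>\<^sup>+(x, y). ennreal (h x y s) \<partial>\<sigma>') \<le> ennreal (cost s (V s)) + ennreal (2 * (\<eta> + B * (\<eta> + \<eta>)))"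
      unfolding eq nn_integral_cost_coupling_of[OF V] .
    also have "\<dots> \<le> (K s + ennreal (\<eta> * (6 + 13 * B))) + ennreal (2 * (\<eta> + B * (\<eta> + \<eta>)))"
      using V_cost by (rule add_right_mono)
    also have "\<dots> = K s + ennreal (\<eta> * (6 + 13 * B) + 2 * (\<eta> + B * (\<eta> + \<eta>)))"
      using \<eta> B0 by (subst ennreal_plus) (auto simp: add.assoc)
    also have "\<eta> * (6 + 13 * B) + 2 * (\<eta> + B * (\<eta> + \<eta>)) = \<eta> * (8 + 17 * B)" by (simp add: algebra_simps)
    also have "K s + ennreal (\<eta> * (8 + 17 * B)) \<le> K s + ennreal \<epsilon>"
      using \<eta>\<epsilon> by (intro add_left_mono ennreal_leI)
    finally have "(\<integral>\<^sup>+(x, y). ennreal (h x y s) \<partial>\<sigma>') \<le> K s + ennreal \<epsilon>" .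
    moreover have "(\<integral>\<^sup>+(x, y). ennreal (h x y s) \<partial>\<sigma>') = (\<integral>\<^sup>+x. ennreal (h x (S s x) s) \<partial>\<mu> s)"
      unfolding \<sigma>'_def using measurable_compose[OF h_meas measurable_ennreal, of s]
      by (subst nn_integral_distr[OF gm']) (auto simp: case_prod_beta)
    ultimately show ?thesis by simp
  qed
  \<comment> \<open>For almost every \<open>x\<close> the cell is eventually constant. Then
    \<open>z i\<close> and \<xi> are applied at moving parameters and moving arguments, where their
    joint continuity is used.\<close>
  have S_lim: "AE x in \<mu> t. (\<lambda>n. S (s n) x) \<longlonglongrightarrow> S t x" if s: "s \<longlonglongrightarrow> t" for s t
  proof -
    have "AE x in \<mu> t. x \<in> D i t \<longrightarrow> isCont (\<lambda>(s, v). z i s v) (t, G i t x)" for i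
    proof -
      have "AE u in distr (density (\<mu> t) (indicator (D i t))) borel (G i t). isCont (\<lambda>(s, v). z i s v) (t, u)"
        unfolding G_distr by (rule z_cont)
      then have "AE x in density (\<mu> t) (indicator (D i t)). isCont (\<lambda>(s, v). z i s v) (t, G i t x)"
        by (rule AE_distrD[rotated]) (simp add: measurable_cong_sets[OF s\<mu> refl])
      then show ?thesis by (subst (asm) AE_density_indicator_iff) (auto simp: s\<mu>)
    qed
    then have 1: "AE x in \<mu> t. \<forall>i. x \<in> D i t \<longrightarrow> isCont (\<lambda>(s, v). z i s v) (t, G i t x)"
      by (simp add: AE_all_countable)
    have "AE u in distr (\<mu> t) borel (R t). isCont (\<lambda>(s, v). \<xi> s v) (t, u)"
      unfolding R_distr by (rule xi_cont)
    then have 2: "AE x in \<mu> t. isCont (\<lambda>(s, v). \<xi> s v) (t, R t x)"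
      by (rule AE_distrD[rotated]) (simp add: measurable_cong_sets[OF s\<mu> refl])
    from 1 2 k_lim[OF s] show ?thesis
    proof eventually_elim
      case (elim x)
      define i where "i = k t x"
      have c: "isCont (\<lambda>(s, v). z i s v) (t, G i t x)" using elim(1) by (simp add: i_def D_def)
      have "(\<lambda>n. (s n, G i (s n) x)) \<longlonglongrightarrow> (t, G i t x)" using s G_lim[OF s] by (rule tendsto_Pair)
      from isCont_tendsto_compose[OF c this] have "(\<lambda>n. z i (s n) (G i (s n) x)) \<longlonglongrightarrow> R t x"
        by (simp add: R_def i_def)
      moreover have "\<forall>\<^sub>F n in sequentially. z i (s n) (G i (s n) x) = R (s n) x"
        using elim(3) by eventually_elim (simp add: R_def i_def)
      ultimately have "(\<lambda>n. R (s n) x) \<longlonglongrightarrow> R t x" by (rule Lim_transform_eventually)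
      then show ?case unfolding S_def by (rule xi_tendsto[OF s elim(2)])
    qed
  qed
  show ?thesis
    using S_meas S_distr S_cost S_lim by (intro exI[of _ S]) (auto simp: eps_optimal_monge_def)
qed

end

section \<open>Weak continuity in terms of integrals, and reduction to bounded costs\<close>

lemma weak_topology_radon_prob:
  assumes "continuous_map euclidean weak_topology \<nu>"
  shows "\<nu> t \<in> radon_prob"
proof -
  have "\<nu> t \<in> topspace weak_topology"
    using assms by (auto simp: continuous_map_def)
  then show ?thesis by (auto simp: weak_topology_def topology_generated_by_topspace)
qed

lemma weak_topology_integral:
  fixes f :: "'b::t2_space \<Rightarrow> real" and \<nu> :: "'c::metric_space \<Rightarrow> 'b measure"
  assumes \<nu>: "continuous_map euclidean weak_topology \<nu>"
    and f: "continuous_on UNIV f" "\<And>y. \<bar>f y\<bar> \<le> c"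
  shows "continuous_on UNIV (\<lambda>t. \<integral>y. f y \<partial>\<nu> t)"
proof -
  have bdd: "bounded (range f)" using f(2) by (auto simp: bounded_iff)
  have "((\<lambda>s. \<integral>y. f y \<partial>\<nu> s) \<longlongrightarrow> (\<integral>y. f y \<partial>\<nu> t)) (nhds t)" for t
  proof (rule tendstoI)
    fix r :: real assume r: "r > 0"
    define U where "U = {\<mu> \<in> radon_prob. \<bar>(\<integral>x. f x \<partial>\<mu>) - (\<integral>x. f x \<partial>\<nu> t)\<bar> < r}"
    have "openin weak_topology U"
      unfolding weak_topology_def U_def
      using f(1) bdd r weak_topology_radon_prob[OF \<nu>] by (intro topology_generated_by_Basis) blast
    from openin_continuous_map_preimage[OF \<nu> this] have "open {s. \<nu> s \<in> U}" by simp
    moreover have "\<nu> t \<in> U" using weak_topology_radon_prob[OF \<nu>] r by (simp add: U_def)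
    ultimately have "\<forall>\<^sub>F s in nhds t. \<nu> s \<in> U" by (auto simp: eventually_nhds)
    then show "\<forall>\<^sub>F s in nhds t. dist (\<integral>y. f y \<partial>\<nu> s) (\<integral>y. f y \<partial>\<nu> t) < r"
      by eventually_elim (simp add: U_def dist_real_def)
  qed
  then show ?thesis
    by (simp add: continuous_on_eq_continuous_at isCont_def tendsto_nhds_iff)
qed

text \<open>\<open>a\<close> may be negative somewhere, but for positive \<open>R\<close> the
  truncated integrand is nonnegative, so the set integral becomes a nonnegative integral.\<close>

lemma nn_integral_tail:
  fixes a :: "'a \<Rightarrow> real"
  assumes a: "integrable M a" and R: "0 < R"
  shows "(\<integral>\<^sup>+x. ennreal (if R \<le> a x then a x else 0) \<partial>M) = ennreal (LINT x:{x. R \<le> a x}|M. a x)"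
    "0 \<le> (LINT x:{x. R \<le> a x}|M. a x)"
proof -
  have eq: "(if R \<le> a x then a x else 0) = indicator {x. R \<le> a x} x *\<^sub>R a x" for x
    by (simp add: indicator_def)
  have [measurable]: "a \<in> borel_measurable M" using a by (rule borel_measurable_integrable)
  have int: "integrable M (\<lambda>x. if R \<le> a x then a x else 0)"
    by (rule Bochner_Integration.integrable_bound[OF a]) auto
  show "(\<integral>\<^sup>+x. ennreal (if R \<le> a x then a x else 0) \<partial>M) = ennreal (LINT x:{x. R \<le> a x}|M. a x)"
    unfolding set_lebesgue_integral_def eq[symmetric] using int R by (intro nn_integral_eq_integral) auto
  show "0 \<le> (LINT x:{x. R \<le> a x}|M. a x)"
    unfolding set_lebesgue_integral_def eq[symmetric] using R by (intro Bochner_Integration.integral_nonneg) auto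
qed

theorem theorem3p3:
  fixes \<mu> :: "'c::metric_space \<Rightarrow> 'a::polish_space measure"
    and \<nu> :: "'c \<Rightarrow> 'b::complete_space measure"
    and h :: "'a \<Rightarrow> 'b \<Rightarrow> 'c \<Rightarrow> real"
    and a :: "'c \<Rightarrow> 'a \<Rightarrow> real"
    and b :: "'c \<Rightarrow> 'b \<Rightarrow> real"
    and \<epsilon> :: real
  assumes "continuous_map euclidean weak_topology \<nu>"
    and "\<And>t. \<mu> t \<in> radon_prob"
    and "tv_continuous \<mu>"
    and "\<And>t. nonatomic (\<mu> t)"
    and "continuous_on UNIV (\<lambda>(x, y, t). h x y t)"
    and "\<And>x y t. 0 \<le> h x y t"
    and "\<And>t. integrable (\<mu> t) (a t)"
    and "\<And>t. integrable (\<nu> t) (b t)"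
    and "\<And>x y t. h x y t \<le> a t x + b t y"
    and "((\<lambda>R. SUP t. ereal ((LINT x:{x. a t x \<ge> R}|\<mu> t. a t x)
                           + (LINT y:{y. b t y \<ge> R}|\<nu> t. b t y))) \<longlongrightarrow> 0) at_top"
    and "\<epsilon> > 0"
  shows "\<exists>S :: 'c \<Rightarrow> 'a \<Rightarrow> 'b.
    (\<forall>t. eps_optimal_monge \<epsilon> (\<lambda>x y. h x y t) (\<mu> t) (\<nu> t) (S t)) \<and>
    (\<forall>t s. s \<longlonglongrightarrow> t \<longrightarrow> (AE x in \<mu> t. (\<lambda>n. S (s n) x) \<longlonglongrightarrow> S t x))"
proof -
  let ?tail = "\<lambda>R t. (LINT x:{x. a t x \<ge> R}|\<mu> t. a t x) + (LINT y:{y. b t y \<ge> R}|\<nu> t. b t y)"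
  have nu: "\<nu> t \<in> radon_prob" for t by (rule weak_topology_radon_prob[OF assms(1)])
  note weak = weak_topology_integral[OF assms(1)]
  have "\<forall>\<^sub>F R in at_top. (SUP t. ereal (?tail R t)) < ereal (\<epsilon> / 2)"
    using assms(10,11) by (intro order_tendstoD(2)[of _ 0]) auto
  then have "\<forall>\<^sub>F R in at_top. (SUP t. ereal (?tail R t)) < ereal (\<epsilon> / 2) \<and> 1 \<le> R"
    using eventually_ge_at_top[of "1::real"] by eventually_elim simp
  \<comment> \<open>Half of \<epsilon> is reserved for the tails, the other half for the bounded
    problem.\<close>
  then obtain R where R: "(SUP t. ereal (?tail R t)) < ereal (\<epsilon> / 2)" "1 \<le> R"
    using eventually_happens'[OF trivial_limit_at_top_linorder] by blast
  have tail: "?tail R t \<le> \<epsilon> / 2" for t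
  proof -
    have "ereal (?tail R t) \<le> (SUP t. ereal (?tail R t))" by (rule SUP_upper) simp
    from le_less_trans[OF this R(1)] show ?thesis by simp
  qed
  \<comment> \<open>The level is \<open>2 * R\<close> because \<open>h\<close> is at most
    \<open>a + b\<close>, and each of the two summands is either below \<open>R\<close> or counted
    completely in its tail; so \<open>h - g\<close> is at most the sum of the tails.\<close>
  define g where "g x y t = min (h x y t) (2 * R)" for x y t
  have nu1: "measure (\<nu> t) UNIV = 1" for t
    using prob_space.prob_space[OF prob_borelD(1)[OF radon_prob_prob_borel[OF nu]]] prob_borelD(3)[OF radon_prob_prob_borel[OF nu]] by metis
  have "\<exists>x :: 'c \<Rightarrow> real \<Rightarrow> 'b. (\<forall>t. x t \<in> borel_measurable borel) \<and>
      (\<forall>t. distr (density lborel (indicator {0<..<measure (\<nu> t) UNIV})) borel (x t) = \<nu> t) \<and>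
      (\<forall>t. AE u in density lborel (indicator {0<..<measure (\<nu> t) UNIV}). isCont (\<lambda>(s, v). x s v) (t, u))"
  proof (rule skorokhod_parametrization)
    show "radon_measure (\<nu> t)" for t using nu[of t] by (simp add: radon_prob_def)
  qed (rule weak)
  then obtain \<xi> :: "'c \<Rightarrow> real \<Rightarrow> 'b" where \<xi>: "\<And>t. \<xi> t \<in> borel_measurable borel"
    "\<And>t. distr unif borel (\<xi> t) = \<nu> t" "\<And>t. AE u in unif. isCont (\<lambda>(s, v). \<xi> s v) (t, u)"
    unfolding nu1 unif_def[symmetric] by blast
  interpret monge_family \<mu> \<nu> g "2 * R" \<xi>
  proof
    have "continuous_on UNIV (\<lambda>p. min ((\<lambda>(x, y, t). h x y t) p) (2 * R))"
      by (intro continuous_intros assms)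
    then show "continuous_on UNIV (\<lambda>(x, y, t). g x y t)" by (simp add: g_def case_prod_beta)
    show "continuous_on UNIV (\<lambda>t. \<integral>y. f y \<partial>\<nu> t)" if "continuous_on UNIV f" "\<And>y. \<bar>f y\<bar> \<le> c" for f :: "'b \<Rightarrow> real" and c
      using that by (rule weak)
  qed (use assms nu R \<xi> in \<open>auto simp: g_def\<close>)
  have "0 < \<epsilon> / 2" using assms(11) by simp
  from monge_maps_exist[OF this] obtain S :: "'c \<Rightarrow> 'a \<Rightarrow> 'b"
    where S: "\<And>t. eps_optimal_monge (\<epsilon> / 2) (\<lambda>x y. g x y t) (\<mu> t) (\<nu> t) (S t)"
      and lim: "\<forall>t s. s \<longlonglongrightarrow> t \<longrightarrow> (AE x in \<mu> t. (\<lambda>n. S (s n) x) \<longlonglongrightarrow> S t x)" by blast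
  have "eps_optimal_monge \<epsilon> (\<lambda>x y. h x y t) (\<mu> t) (\<nu> t) (S t)" for t
  proof -
    have S_meas: "S t \<in> borel_measurable borel" and S_distr: "distr (\<mu> t) borel (S t) = \<nu> t"
      and S_cost: "(\<integral>\<^sup>+x. ennreal (g x (S t x) t) \<partial>\<mu> t) \<le> K t + ennreal (\<epsilon> / 2)"
      using S[of t] by (auto simp: eps_optimal_monge_def)
    have S_meas': "S t \<in> borel_measurable (\<mu> t)" using S_meas by (simp add: measurable_cong_sets[OF prob_borelD(2)[OF mu] refl])
    define A where "A x = (if R \<le> a t x then a t x else 0)" for x
    define Bt where "Bt y = (if R \<le> b t y then b t y else 0)" for y
    have [measurable]: "a t \<in> borel_measurable (\<mu> t)" "b t \<in> borel_measurable (\<nu> t)"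
      using assms(7,8) by (auto intro: borel_measurable_integrable)
    have A_meas: "A \<in> borel_measurable (\<mu> t)" unfolding A_def by measurable
    have B_meas: "Bt \<in> borel_measurable (\<nu> t)" unfolding Bt_def by measurable
    then have B_meas': "Bt \<in> borel_measurable borel" by (simp add: measurable_cong_sets[OF prob_borelD(2)[OF nu] refl])
    have AB0: "0 \<le> A x" "0 \<le> Bt y" for x y using R(2) by (auto simp: A_def Bt_def)
    have le: "ennreal (h x y t) \<le> ennreal (g x y t) + (ennreal (A x) + ennreal (Bt y))" for x y
    proof -
      have "h x y t \<le> g x y t + (A x + Bt y)"
        using assms(9)[of x y t] AB0(1)[of x] AB0(2)[of y] R(2) by (auto simp: g_def A_def Bt_def min_def)
      then have "ennreal (h x y t) \<le> ennreal (g x y t + (A x + Bt y))" by (rule ennreal_leI)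
      then show ?thesis using AB0 h0 by (simp add: ennreal_plus)
    qed
    have g_meas: "(\<lambda>x. ennreal (g x (S t x) t)) \<in> borel_measurable (\<mu> t)"
    proof -
      have "(\<lambda>x. (x, S t x)) \<in> borel \<rightarrow>\<^sub>M (borel :: 'a measure) \<Otimes>\<^sub>M (borel :: 'b measure)"
        using S_meas by measurable
      moreover have "measurable M (borel :: ('a \<times> 'b) measure) = measurable M (borel \<Otimes>\<^sub>M borel)" for M :: "'a measure"
        by (rule measurable_cong_sets) (simp_all only: sets_borel_prod_second_countable)
      ultimately have "(\<lambda>x. (x, S t x)) \<in> borel_measurable borel" by simp
      from measurable_compose[OF this h_meas[of t]] show ?thesis by (simp add: measurable_cong_sets[OF prob_borelD(2)[OF mu] refl])
    qed
    have BS_meas: "(\<lambda>x. ennreal (Bt (S t x))) \<in> borel_measurable (\<mu> t)"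
      using measurable_compose[OF S_meas' B_meas'] by simp
    have "(\<integral>\<^sup>+x. ennreal (h x (S t x) t) \<partial>\<mu> t) \<le>
        (\<integral>\<^sup>+x. ennreal (g x (S t x) t) + (ennreal (A x) + ennreal (Bt (S t x))) \<partial>\<mu> t)"
      by (intro nn_integral_mono le)
    also have "\<dots> = (\<integral>\<^sup>+x. ennreal (g x (S t x) t) \<partial>\<mu> t) + ((\<integral>\<^sup>+x. ennreal (A x) \<partial>\<mu> t) + (\<integral>\<^sup>+x. ennreal (Bt (S t x)) \<partial>\<mu> t))"
      using g_meas A_meas BS_meas by (simp add: nn_integral_add)
    also have "(\<integral>\<^sup>+x. ennreal (Bt (S t x)) \<partial>\<mu> t) = (\<integral>\<^sup>+y. ennreal (Bt y) \<partial>\<nu> t)"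
      unfolding S_distr[symmetric] using S_meas' B_meas' by (subst nn_integral_distr) auto
    also have "(\<integral>\<^sup>+x. ennreal (A x) \<partial>\<mu> t) + (\<integral>\<^sup>+y. ennreal (Bt y) \<partial>\<nu> t) = ennreal (?tail R t)"
      unfolding A_def Bt_def using nn_integral_tail[OF assms(7)[of t], of R] nn_integral_tail[OF assms(8)[of t], of R] R(2)
      by (simp add: ennreal_plus)
    also have "(\<integral>\<^sup>+x. ennreal (g x (S t x) t) \<partial>\<mu> t) + ennreal (?tail R t) \<le> (K t + ennreal (\<epsilon> / 2)) + ennreal (\<epsilon> / 2)"
      by (rule add_mono[OF S_cost ennreal_leI[OF tail]])
    also have "\<dots> = K t + ennreal \<epsilon>"
      using assms(11) by (simp add: add.assoc ennreal_plus[symmetric] del: ennreal_plus)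
    \<comment> \<open>Truncation only lowers the Kantorovich cost, so the tails enter once, on the
      side of the map, where the law of \<open>S t\<close> turns the second one into an integral
      over \<open>\<nu> t\<close>.\<close>
    also have "K t \<le> kantorovich_cost (\<lambda>x y. h x y t) (\<mu> t) (\<nu> t)"
      unfolding kantorovich_cost_def
      by (intro INF_mono') (auto intro!: nn_integral_mono ennreal_leI simp: g_def)
    finally show ?thesis using S_meas S_distr by (simp add: eps_optimal_monge_def add_right_mono)
  qed
  with lim show ?thesis by blast
qed

end
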